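(* Let $\mathcal C$ be a finite arrangement of affine hyperplanes in $X=\mathbb C^N$ with graph $\Gamma$. For any quiver $\mathcal V\in Qui_\Gamma$, the complex of left $\mathcal D_X$-modules $$\overline{\mathcal R}E\mathcal V:\quad 0\to\mathcal R^{-N}E\mathcal V\xrightarrow{d}\mathcal R^{-N+1}E\mathcal V\xrightarrow{d}\cdots\xrightarrow{d}\mathcal R^0E\mathcal V\xrightarrow{\nu}E\mathcal V\to0$$ is acyclic.
   Context: **Arrangement, graph.** $\mathcal C$ is a finite set of affine hyperplanes in $X=\mathbb C^N$. The nonempty intersections of subfamilies (including $X$) are denoted $\overline X_\alpha$, $\alpha\in I$; the stratum $X_\alpha$ is $\overline X_\alpha$ minus all smaller $\overline X_\beta$; $l(\alpha)=\operatorname{codim}_X\overline X_\alpha$. Write $\alpha\succ\beta$ if $\overline X_\alpha\supset\overline X_\beta$ with $\operatorname{codim}_{\overline X_\alpha}\overline X_\beta=1$; $\alpha,\beta$ are adjacent if $\alpha\succ\beta$ or $\beta\succ\alpha$. $\Gamma$ is the graph on $I$ with these adjacencies. **Quivers.** A quiver $\mathcal V=\{V_\alpha,A_{\alpha,\beta}\}\in Qui_\Gamma$ consists of finite-dimensional complex vector spaces $V_\alpha$ ($\alpha\in I$) and linear maps $A_{\alpha,\beta}:V_\beta\to V_\alpha$ such that (a) $A_{\alpha,\beta}=0$ if $\alpha,\beta$ are not adjacent; (b) $\sum_\beta A_{\alpha,\beta}A_{\beta,\gamma}=0$ if $|l(\alpha)-l(\gamma)|=2$; (c) $\sum_\beta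 A_{\alpha,\beta}A_{\beta,\gamma}=0$ if $l(\alpha)=l(\gamma)$, $\alpha\ne\gamma$, and there is $\delta$ with $\alpha\succ\delta,\gamma\succ\delta$. **Framings.** $F_\alpha$ = affine functions vanishing on $X_\alpha$; $T_\alpha$ = constant vector fields parallel to $X_\alpha$; $\mathcal T_\alpha=T_\alpha\oplus F_\alpha$ (dimension $N$); $\langle\xi,f\rangle=\xi(f)$; $\overline\Omega_\alpha$ = one-dimensional space of translation-invariant top forms on $\overline X_\alpha$. Choose an edge framing: for each $\alpha\succ\beta$, $f_{\beta,\alpha}\in F_\beta\setminus F_\alpha$ and $\xi_{\alpha,\beta}\in T_\alpha\setminus T_\beta$. Define $\pi_{\beta,\alpha}:\overline\Omega_\alpha\to\overline\Omega_\beta$: if $\alpha\succ\beta$, $\pi_{\beta,\alpha}(\overline\omega_\alpha)=\overline\omega_\beta$ iff $df_{\beta,\alpha}\wedge\overline\omega_\beta=\overline\omega_\alpha$; if $\beta\succ\alpha$, $\pi_{\beta,\alpha}(\overline\omega_\alpha)=\overline\omega_\beta$ iff $i_{\xi_{\beta,\alpha}}\overline\omega_\beta=\overline\omega_\alpha$. For $\alpha\succ\beta$, contraction by $df$ ($f\in F_\beta$) gives $i_f:\bigwedge^pT_\alpha\to\bigwedge^{p-1}T_\beta$, $i_f(\xi_1\wedge\cdots\wedge\xi_p)=\langle\xi_1,f\rangle\xi_2\wedge\cdots\wedge\xi_p$ if $\xi_2,\dots,\xi_p\in T_\beta$; contraction by $\xi\in T_\alpha$ gives $i_\xi:\bigwedge^pF_\beta\to\bigwedge^{p-1}F_\alpha$,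 $i_\xi(f_1\wedge\cdots\wedge f_p)=\langle\xi,f_1\rangle f_2\wedge\cdots\wedge f_p$ if $f_2,\dots,f_p\in F_\alpha$. **The module $E\mathcal V$.** The quotient of the free left $\mathcal D_X$-module $\mathcal D_X\otimes\bigoplus_\alpha\overline\Omega_\alpha\otimes V_\alpha$ by the submodule generated by $\xi\otimes\overline\omega_\alpha\otimes v_\alpha-\sum_{\beta:\alpha\succ\beta}\langle\xi,f_{\beta,\alpha}\rangle 1\otimes\pi_{\beta,\alpha}(\overline\omega_\alpha)\otimes A_{\beta,\alpha}(v_\alpha)$ ($\xi\in T_\alpha$) and $f\otimes\overline\omega_\alpha\otimes v_\alpha-\sum_{\beta:\beta\succ\alpha}\langle\xi_{\beta,\alpha},f\rangle 1\otimes\pi_{\beta,\alpha}(\overline\omega_\alpha)\otimes A_{\beta,\alpha}(v_\alpha)$ ($f\in F_\alpha$). It does not depend on the framing. **The complex.** For $r=0,-1,\dots,-N$: $\mathcal R^rE\mathcal V=\bigoplus_{\alpha\in I}\mathcal D_X\otimes\bigwedge^{-r}\mathcal T_\alpha\otimes\overline\Omega_\alpha\otimes V_\alpha$, a free left $\mathcal D_X$-module. For adjacent $\alpha,\beta$ and $\vec\xi\in\bigwedge^pT_\alpha$, $\vec f\in\bigwedge^{r-p}F_\alpha$ define $A^r_{\beta,\alpha}:\bigwedge^r\mathcal T_\alpha\otimes\overline\Omega_\alpha\otimes V_\alpha\to\bigwedge^{r-1}\mathcal T_\beta\otimes\overline\Omega_\beta\otimes V_\beta$ by $A^r_{\beta,\alpha}(\vec\xi\wedge\vec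 f\otimes\overline\omega_\alpha\otimes v_\alpha)=i_{f_{\beta,\alpha}}(\vec\xi)\wedge\vec f\otimes\pi_{\beta,\alpha}(\overline\omega_\alpha)\otimes A_{\beta,\alpha}(v_\alpha)$ if $\alpha\succ\beta$ (using $F_\alpha\subset F_\beta$), and $A^r_{\beta,\alpha}(\vec\xi\wedge\vec f\otimes\overline\omega_\alpha\otimes v_\alpha)=(-1)^p\,\vec\xi\wedge i_{\xi_{\beta,\alpha}}(\vec f)\otimes\pi_{\beta,\alpha}(\overline\omega_\alpha)\otimes A_{\beta,\alpha}(v_\alpha)$ if $\beta\succ\alpha$ (using $T_\alpha\subset T_\beta$). The $\mathcal D_X$-linear maps $d_0,d_1$ are $d_1(1\otimes t_1\wedge\cdots\wedge t_r\otimes\overline\omega_\alpha\otimes v_\alpha)=\sum_{i=1}^r(-1)^{i+1}t_i\otimes t_1\wedge\cdots\widehat{t_i}\cdots\wedge t_r\otimes\overline\omega_\alpha\otimes v_\alpha$ (with $t_i\in\mathcal T_\alpha\subset D_X$), and $d_0(1\otimes t_1\wedge\cdots\wedge t_r\otimes\overline\omega_\alpha\otimes v_\alpha)=\sum_{\beta\text{ adjacent to }\alpha}1\otimes A^r_{\beta,\alpha}(t_1\wedge\cdots\wedge t_r\otimes\overline\omega_\alpha\otimes v_\alpha)$; both vanish on $\mathcal R^0E\mathcal V$. Set $d=d_1-d_0$ and $\nu(1\otimes\overline\omega_\alpha\otimes v_\alpha)=$ the class of $1\otimes\overline\omega_\alpha\otimes v_\alpha$ in $E\mathcal V$. One has $d^2=0$,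 $\nu d=0$. *)

theory Defs
  imports "HOL-Analysis.Analysis" "HOL-Library.Poly_Mapping" "HOL-Library.Function_Algebras"
begin

section \<open>Complex vector spaces\<close>

class complex_vector = ab_group_add +
  fixes scaleC :: "complex \<Rightarrow> 'a \<Rightarrow> 'a"  (infixr \<open>*\<^sub>C\<close> 75)
  assumes scaleC_add_right: "c *\<^sub>C (x + y) = c *\<^sub>C x + c *\<^sub>C y"
    and scaleC_add_left: "(b + c) *\<^sub>C x = b *\<^sub>C x + c *\<^sub>C x"
    and scaleC_scaleC: "b *\<^sub>C c *\<^sub>C x = (b * c) *\<^sub>C x"
    and scaleC_one: "1 *\<^sub>C x = x"

global_interpretation complex_vector: vector_space "scaleC :: complex \<Rightarrow> 'a \<Rightarrow> 'a::complex_vector"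
  by unfold_locales (simp_all add: scaleC_add_right scaleC_add_left scaleC_scaleC scaleC_one)

abbreviation cspan :: "'a::complex_vector set \<Rightarrow> 'a set"
  where "cspan \<equiv> complex_vector.span"

abbreviation csubspace :: "'a::complex_vector set \<Rightarrow> bool"
  where "csubspace \<equiv> complex_vector.subspace"

abbreviation clinear :: "('a::complex_vector \<Rightarrow> 'b::complex_vector) \<Rightarrow> bool"
  where "clinear \<equiv> Vector_Spaces.linear scaleC scaleC"

lemma clinearI:
  assumes "\<And>x y. f (x + y) = f x + f y" and "\<And>c x. f (c *\<^sub>C x) = c *\<^sub>C f x"
  shows "clinear f"
  by (rule Vector_Spaces.linear.intro,
      simp_all add: complex_vector.vector_space_axioms module_hom_def module_hom_axioms_def
        complex_vector.module_axioms assms)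

lemma clinear_add: "clinear f \<Longrightarrow> f (x + y) = f x + f y"
  by (simp add: Vector_Spaces.linear_def module_hom_def module_hom_axioms_def)

lemma clinear_scale: "clinear f \<Longrightarrow> f (c *\<^sub>C x) = c *\<^sub>C f x"
  by (simp add: Vector_Spaces.linear_def module_hom_def module_hom_axioms_def)

lemma clinear_0: "clinear f \<Longrightarrow> f 0 = 0"
  by (metis clinear_scale complex_vector.scale_zero_left)

lemma clinear_diff: "clinear f \<Longrightarrow> f (x - y) = f x - f y"
  using clinear_add[of f "x - y" y] by (simp add: algebra_simps)

lemma clinear_sum: "clinear f \<Longrightarrow> f (sum g A) = (\<Sum>a\<in>A. f (g a))"
  by (induction A rule: infinite_finite_induct) (simp_all add: clinear_0 clinear_add)

definition clinear_on :: "'a::complex_vector set \<Rightarrow> ('a \<Rightarrow> 'b::complex_vector) \<Rightarrow> bool"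
  where "clinear_on S f \<longleftrightarrow>
    (\<forall>x\<in>S. \<forall>y\<in>S. f (x + y) = f x + f y) \<and> (\<forall>c. \<forall>x\<in>S. f (c *\<^sub>C x) = c *\<^sub>C f x)"

text \<open>A linear map given on a subspace \<open>S\<close> is extended to the ambient type; only its values on
  \<open>S\<close> matter below.\<close>

definition lin_ext :: "'a::complex_vector set \<Rightarrow> ('a \<Rightarrow> 'b::complex_vector) \<Rightarrow> 'a \<Rightarrow> 'b"
  where "lin_ext S f = (SOME g. clinear g \<and> (\<forall>x\<in>S. g x = f x))"

lemma
  assumes "csubspace S" and "clinear_on S f"
  shows clinear_lin_ext: "clinear (lin_ext S f)"
    and lin_ext_eq: "x \<in> S \<Longrightarrow> lin_ext S f x = f x"
proof -
  interpret p: vector_space_pair "scaleC :: complex \<Rightarrow> 'a \<Rightarrow> 'a" "scaleC :: complex \<Rightarrow> 'b \<Rightarrow> 'b"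
    by unfold_locales
  obtain B where B: "B \<subseteq> S" "complex_vector.independent B" "S \<subseteq> cspan B"
    using complex_vector.maximal_independent_subset by blast
  obtain g where g: "clinear g" "\<forall>x\<in>B. g x = f x"
    using p.linear_independent_extend[OF B(2)] by blast
  have *: "x \<in> S \<and> g x = f x" if "x \<in> cspan B" for x
    using that
  proof (induction rule: complex_vector.span_induct_alt)
    case base
    have "f 0 = 0"
      using assms unfolding clinear_on_def
      using complex_vector.subspace_0[OF assms(1)] complex_vector.scale_zero_left by metis
    then show ?case using assms(1) clinear_0[OF g(1)] by (simp add: complex_vector.subspace_0)
  next
    case (step c x y)
    have "c *\<^sub>C x \<in> S" "x \<in> S" "c *\<^sub>C x + y \<in> S"
      using step B(1) assms(1) by (auto simp: complex_vector.subspace_def)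
    moreover have "f (c *\<^sub>C x + y) = c *\<^sub>C f x + f y"
      using assms(2) \<open>c *\<^sub>C x \<in> S\<close> \<open>x \<in> S\<close> step unfolding clinear_on_def by simp
    ultimately show ?case
      using step g by (simp add: clinear_add[OF g(1)] clinear_scale[OF g(1)])
  qed
  have ex: "\<exists>g. clinear g \<and> (\<forall>x\<in>S. g x = f x)"
    using g(1) * B(3) by blast
  show "clinear (lin_ext S f)" "x \<in> S \<Longrightarrow> lin_ext S f x = f x"
    using someI_ex[OF ex] unfolding lin_ext_def by auto
qed

instantiation complex :: complex_vector
begin
definition scaleC_complex :: "complex \<Rightarrow> complex \<Rightarrow> complex" where "scaleC_complex c x = c * x"
instance by standard (simp_all add: scaleC_complex_def algebra_simps)
end

instantiation vec :: (complex_vector, finite) complex_vector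
begin
definition scaleC_vec :: "complex \<Rightarrow> 'a ^ 'b \<Rightarrow> 'a ^ 'b" where "scaleC_vec c x = (\<chi> i. c *\<^sub>C x $ i)"
instance
  by standard (simp_all add: scaleC_vec_def vec_eq_iff scaleC_add_right scaleC_add_left
      scaleC_scaleC scaleC_one)
end

lemma scaleC_vec_eq: "c *\<^sub>C x = c *s x" for x :: "complex ^ 'n"
  by (simp add: scaleC_vec_def vec_eq_iff scaleC_complex_def)

instantiation prod :: (complex_vector, complex_vector) complex_vector
begin
definition scaleC_prod :: "complex \<Rightarrow> 'a \<times> 'b \<Rightarrow> 'a \<times> 'b"
  where "scaleC_prod c x = (c *\<^sub>C fst x, c *\<^sub>C snd x)"
instance
  by standard (simp_all add: scaleC_prod_def prod_eq_iff scaleC_add_right scaleC_add_left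
      scaleC_scaleC scaleC_one)
end

instantiation "fun" :: (type, complex_vector) complex_vector
begin
definition scaleC_fun :: "complex \<Rightarrow> ('a \<Rightarrow> 'b) \<Rightarrow> 'a \<Rightarrow> 'b"
  where "scaleC_fun c f = (\<lambda>x. c *\<^sub>C f x)"
instance
  by standard (simp_all add: scaleC_fun_def fun_eq_iff scaleC_add_right scaleC_add_left
      scaleC_scaleC scaleC_one)
end

instantiation poly_mapping :: (type, complex_vector) complex_vector
begin
definition scaleC_poly_mapping :: "complex \<Rightarrow> ('a \<Rightarrow>\<^sub>0 'b) \<Rightarrow> 'a \<Rightarrow>\<^sub>0 'b"
  where "scaleC_poly_mapping c p = Poly_Mapping.map (scaleC c) p"

lemma lookup_scaleC: "Poly_Mapping.lookup (c *\<^sub>C p) k = c *\<^sub>C Poly_Mapping.lookup p k" for p :: "'a \<Rightarrow>\<^sub>0 'b"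
  by (simp add: scaleC_poly_mapping_def Poly_Mapping.map.rep_eq when_def)

instance
  by standard (simp_all add: poly_mapping_eq_iff fun_eq_iff lookup_scaleC lookup_add
      scaleC_add_right scaleC_add_left scaleC_scaleC scaleC_one)
end

text \<open>\<open>'x \<Rightarrow>\<^sub>0 complex\<close> is the free vector space on \<open>'x\<close>, and \<open>free_lin\<close> its universal property.\<close>

definition free_lin :: "('x \<Rightarrow> 'c::complex_vector) \<Rightarrow> ('x \<Rightarrow>\<^sub>0 complex) \<Rightarrow> 'c"
  where "free_lin h p = (\<Sum>k\<in>Poly_Mapping.keys p. Poly_Mapping.lookup p k *\<^sub>C h k)"

lemma free_lin_superset:
  assumes "finite A" "Poly_Mapping.keys p \<subseteq> A"
  shows "free_lin h p = (\<Sum>k\<in>A. Poly_Mapping.lookup p k *\<^sub>C h k)"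
  unfolding free_lin_def
  by (rule sum.mono_neutral_left) (use assms in \<open>auto simp: in_keys_iff\<close>)

lemma clinear_free_lin: "clinear (free_lin h)"
proof (rule clinearI)
  fix p q :: "'a \<Rightarrow>\<^sub>0 complex" and c
  let ?A = "Poly_Mapping.keys p \<union> Poly_Mapping.keys q"
  have "Poly_Mapping.keys (p + q) \<subseteq> ?A" by (rule keys_add)
  then show "free_lin h (p + q) = free_lin h p + free_lin h q"
    by (simp add: free_lin_superset[where A = ?A] lookup_add scaleC_add_left sum.distrib)
  have "Poly_Mapping.keys (c *\<^sub>C p) \<subseteq> Poly_Mapping.keys p"
    by (auto simp: in_keys_iff lookup_scaleC)
  then show "free_lin h (c *\<^sub>C p) = c *\<^sub>C free_lin h p"
    by (simp add: free_lin_superset[where A = "Poly_Mapping.keys p"] lookup_scaleC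
        complex_vector.scale_sum_right scaleC_complex_def)
qed

lemma free_lin_single: "free_lin h (Poly_Mapping.single x c) = c *\<^sub>C h x"
  by (simp add: free_lin_def)

lemma free_span: "p \<in> cspan (range (\<lambda>x. Poly_Mapping.single x 1))" for p :: "'x \<Rightarrow>\<^sub>0 complex"
proof (induction p rule: update_induct)
  case const
  then show ?case by (simp add: complex_vector.span_zero)
next
  case (update p a b)
  have "Poly_Mapping.update a b p = p + b *\<^sub>C Poly_Mapping.single a 1"
    using update by (auto simp: poly_mapping_eq_iff fun_eq_iff lookup_update lookup_add
        lookup_scaleC lookup_single when_def in_keys_iff scaleC_complex_def)
  then show ?case
    using update by (simp add: complex_vector.span_add complex_vector.span_scale
        complex_vector.span_base)
qed


section \<open>Tensor products\<close>

definition tensor_rel :: "('a::complex_vector \<times> 'b::complex_vector \<Rightarrow>\<^sub>0 complex) set"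
  where "tensor_rel = cspan (
    {Poly_Mapping.single (a + a', b) 1 - Poly_Mapping.single (a, b) 1
       - Poly_Mapping.single (a', b) 1 | a a' b. True} \<union>
    {Poly_Mapping.single (a, b + b') 1 - Poly_Mapping.single (a, b) 1
       - Poly_Mapping.single (a, b') 1 | a b b'. True} \<union>
    {Poly_Mapping.single (c *\<^sub>C a, b) 1 - c *\<^sub>C Poly_Mapping.single (a, b) 1 | a b c. True} \<union>
    {Poly_Mapping.single (a, c *\<^sub>C b) 1 - c *\<^sub>C Poly_Mapping.single (a, b) 1 | a b c. True})"

lemma equivp_mod_cspan: "equivp (\<lambda>x y. x - y \<in> cspan S)"
proof (rule equivpI)
  show "reflp (\<lambda>x y. x - y \<in> cspan S)"
    by (simp add: reflp_def complex_vector.span_zero)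
  show "symp (\<lambda>x y. x - y \<in> cspan S)"
    by (rule sympI) (use complex_vector.span_neg in fastforce)
  show "transp (\<lambda>x y. x - y \<in> cspan S)"
    by (rule transpI) (use complex_vector.span_add in fastforce)
qed

quotient_type (overloaded) ('a, 'b) tensor =
  "('a::complex_vector \<times> 'b::complex_vector) \<Rightarrow>\<^sub>0 complex" / "\<lambda>x y. x - y \<in> tensor_rel"
  unfolding tensor_rel_def by (rule equivp_mod_cspan)

lemma mod_cspan_add:
  assumes "x - x' \<in> cspan S" "y - y' \<in> cspan S"
  shows "(x + y) - (x' + y') \<in> cspan S"
  using complex_vector.span_add[OF assms] by (simp add: algebra_simps)

lemma mod_cspan_diff:
  assumes "x - x' \<in> cspan S" "y - y' \<in> cspan S"
  shows "(x - y) - (x' - y') \<in> cspan S"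
  using complex_vector.span_diff[OF assms] by (simp add: algebra_simps)

lemma mod_cspan_minus: "x - x' \<in> cspan S \<Longrightarrow> (- x) - (- x') \<in> cspan S"
  using complex_vector.span_neg[of "x - x'" S] by (simp add: algebra_simps)

lemma mod_cspan_scale: "x - x' \<in> cspan S \<Longrightarrow> c *\<^sub>C x - c *\<^sub>C x' \<in> cspan S"
  using complex_vector.span_scale[of "x - x'" S c]
  by (simp add: complex_vector.scale_right_diff_distrib)

instantiation tensor :: (complex_vector, complex_vector) complex_vector
begin
lift_definition zero_tensor :: "('a, 'b) tensor" is 0 .
lift_definition plus_tensor :: "('a, 'b) tensor \<Rightarrow> ('a, 'b) tensor \<Rightarrow> ('a, 'b) tensor" is "(+)"
  unfolding tensor_rel_def by (rule mod_cspan_add)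
lift_definition minus_tensor :: "('a, 'b) tensor \<Rightarrow> ('a, 'b) tensor \<Rightarrow> ('a, 'b) tensor" is "(-)"
  unfolding tensor_rel_def by (rule mod_cspan_diff)
lift_definition uminus_tensor :: "('a, 'b) tensor \<Rightarrow> ('a, 'b) tensor" is uminus
  unfolding tensor_rel_def by (rule mod_cspan_minus)
lift_definition scaleC_tensor :: "complex \<Rightarrow> ('a, 'b) tensor \<Rightarrow> ('a, 'b) tensor" is scaleC
  unfolding tensor_rel_def by (rule mod_cspan_scale)
instance
  by (standard; transfer)
    (simp_all add: tensor_rel_def complex_vector.span_zero algebra_simps scaleC_add_right
      scaleC_add_left scaleC_scaleC scaleC_one)
end

lift_definition tensor :: "'a::complex_vector \<Rightarrow> 'b::complex_vector \<Rightarrow> ('a, 'b) tensor"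
    (infixr \<open>\<otimes>\<close> 70)
  is "\<lambda>a b. Poly_Mapping.single (a, b) 1" .

lemma tensor_bilinear:
  "(a + a') \<otimes> b = a \<otimes> b + a' \<otimes> b" "a \<otimes> (b + b') = a \<otimes> b + a \<otimes> b'"
  "(c *\<^sub>C a) \<otimes> b = c *\<^sub>C (a \<otimes> b)" "a \<otimes> (c *\<^sub>C b) = c *\<^sub>C (a \<otimes> b)"
  by (transfer, unfold tensor_rel_def, rule complex_vector.span_base, auto simp: diff_diff_add; blast)+

text \<open>The tensor product of subspaces, as a subspace of the tensor product of the ambient spaces (the
  canonical map between the two is injective over a field). Likewise for \<open>ext_power\<close> below.\<close>

definition tensor_sub :: "'a::complex_vector set \<Rightarrow> 'b::complex_vector set \<Rightarrow> ('a, 'b) tensor set"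
    (infixr \<open>\<otimes>\<^sub>s\<close> 70)
  where "S \<otimes>\<^sub>s U = cspan {a \<otimes> b | a b. a \<in> S \<and> b \<in> U}"

definition bilin :: "('a::complex_vector \<Rightarrow> 'b::complex_vector \<Rightarrow> 'c::complex_vector) \<Rightarrow> bool"
  where "bilin h \<longleftrightarrow> (\<forall>b. clinear (\<lambda>a. h a b)) \<and> (\<forall>a. clinear (h a))"

definition tensor_lift ::
    "('a::complex_vector \<Rightarrow> 'b::complex_vector \<Rightarrow> 'c::complex_vector) \<Rightarrow> ('a, 'b) tensor \<Rightarrow> 'c"
  where "tensor_lift h x = free_lin (case_prod h) (rep_tensor x)"

lemma cspan_kernel:
  assumes "clinear f" "\<And>x. x \<in> S \<Longrightarrow> f x = 0" "x \<in> cspan S"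
  shows "f x = 0"
  using assms(3)
  by (induction rule: complex_vector.span_induct_alt)
    (simp_all add: assms clinear_0 clinear_add clinear_scale)

lemma
  assumes "bilin h"
  shows clinear_tensor_lift: "clinear (tensor_lift h)"
    and tensor_lift_tensor: "tensor_lift h (a \<otimes> b) = h a b"
proof -
  have h: "h (x + x') b = h x b + h x' b" "h x (b + b') = h x b + h x b'"
    "h (c *\<^sub>C x) b = c *\<^sub>C h x b" "h x (c *\<^sub>C b) = c *\<^sub>C h x b" for x x' b b' c
    using assms clinear_add[of "\<lambda>a. h a b"] clinear_scale[of "\<lambda>a. h a b"]
    by (auto simp: bilin_def clinear_add clinear_scale)
  let ?F = "free_lin (case_prod h)"
  have F0: "?F p = 0" if "p \<in> tensor_rel" for p
    using that unfolding tensor_rel_def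
    by (rule cspan_kernel[OF clinear_free_lin, rotated])
      (auto simp: clinear_diff[OF clinear_free_lin] clinear_scale[OF clinear_free_lin]
        free_lin_single scaleC_one h)
  have Feq: "?F p = ?F q" if "p - q \<in> tensor_rel" for p q
    using F0[OF that] by (simp add: clinear_diff[OF clinear_free_lin])
  have lift: "tensor_lift h (abs_tensor p) = ?F p" for p
    unfolding tensor_lift_def
    by (rule Feq) (rule Quotient3_rep_abs[OF Quotient3_tensor], simp add: tensor_rel_def complex_vector.span_zero)
  show "tensor_lift h (a \<otimes> b) = h a b"
    by (simp add: tensor_def lift free_lin_single scaleC_one)
  show "clinear (tensor_lift h)"
  proof (rule clinearI)
    fix x y :: "('a, 'b) tensor" and c
    obtain p q where pq: "x = abs_tensor p" "y = abs_tensor q"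
      by (metis Quotient3_abs_rep[OF Quotient3_tensor])
    show "tensor_lift h (x + y) = tensor_lift h x + tensor_lift h y"
      by (simp add: pq plus_tensor.abs_eq lift clinear_add[OF clinear_free_lin])
    show "tensor_lift h (c *\<^sub>C x) = c *\<^sub>C tensor_lift h x"
      by (simp add: pq scaleC_tensor.abs_eq lift clinear_scale[OF clinear_free_lin])
  qed
qed

definition tensor_map :: "('a::complex_vector \<Rightarrow> 'c::complex_vector) \<Rightarrow>
    ('b::complex_vector \<Rightarrow> 'd::complex_vector) \<Rightarrow> ('a, 'b) tensor \<Rightarrow> ('c, 'd) tensor"
  where "tensor_map f g = tensor_lift (\<lambda>a b. f a \<otimes> g b)"

lemma
  assumes "clinear f" "clinear g"
  shows clinear_tensor_map: "clinear (tensor_map f g)"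
    and tensor_map_tensor: "tensor_map f g (a \<otimes> b) = f a \<otimes> g b"
proof -
  have "bilin (\<lambda>a b. f a \<otimes> g b)"
    using assms
    by (auto simp: bilin_def clinear_add clinear_scale tensor_bilinear intro!: clinearI)
  then show "clinear (tensor_map f g)" "tensor_map f g (a \<otimes> b) = f a \<otimes> g b"
    unfolding tensor_map_def by (simp_all add: clinear_tensor_lift tensor_lift_tensor)
qed


section \<open>Alternating multilinear maps and exterior powers\<close>

text \<open>Maps of \<open>r\<close> arguments, \<open>r\<close> arbitrary, are functions on lists.\<close>

definition alternating_on :: "'a::complex_vector set \<Rightarrow> ('a list \<Rightarrow> 'b::complex_vector) \<Rightarrow> bool"
  where "alternating_on S h \<longleftrightarrow>
    (\<forall>us ws. set us \<subseteq> S \<and> set ws \<subseteq> S \<longrightarrow> clinear_on S (\<lambda>x. h (us @ x # ws))) \<and>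
    (\<forall>vs. set vs \<subseteq> S \<and> \<not> distinct vs \<longrightarrow> h vs = 0)"

definition ext_rel :: "('w::complex_vector list \<Rightarrow>\<^sub>0 complex) set"
  where "ext_rel = cspan (
    {Poly_Mapping.single (us @ (x + y) # ws) 1 - Poly_Mapping.single (us @ x # ws) 1
       - Poly_Mapping.single (us @ y # ws) 1 | us x y ws. True} \<union>
    {Poly_Mapping.single (us @ (c *\<^sub>C x) # ws) 1 - c *\<^sub>C Poly_Mapping.single (us @ x # ws) 1
       | us c x ws. True} \<union>
    {Poly_Mapping.single ws 1 | ws. \<not> distinct ws})"

quotient_type (overloaded) 'w ext = "'w::complex_vector list \<Rightarrow>\<^sub>0 complex"
  / "\<lambda>x y. x - y \<in> ext_rel"
  unfolding ext_rel_def by (rule equivp_mod_cspan)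

instantiation ext :: (complex_vector) complex_vector
begin
lift_definition zero_ext :: "'a ext" is 0 .
lift_definition plus_ext :: "'a ext \<Rightarrow> 'a ext \<Rightarrow> 'a ext" is "(+)"
  unfolding ext_rel_def by (rule mod_cspan_add)
lift_definition minus_ext :: "'a ext \<Rightarrow> 'a ext \<Rightarrow> 'a ext" is "(-)"
  unfolding ext_rel_def by (rule mod_cspan_diff)
lift_definition uminus_ext :: "'a ext \<Rightarrow> 'a ext" is uminus
  unfolding ext_rel_def by (rule mod_cspan_minus)
lift_definition scaleC_ext :: "complex \<Rightarrow> 'a ext \<Rightarrow> 'a ext" is scaleC
  unfolding ext_rel_def by (rule mod_cspan_scale)
instance
  by (standard; transfer)
    (simp_all add: ext_rel_def complex_vector.span_zero algebra_simps scaleC_add_right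
      scaleC_add_left scaleC_scaleC scaleC_one)
end

text \<open>\<open>wedge [t\<^sub>1, \<dots>, t\<^sub>r]\<close> is \<open>t\<^sub>1 \<and> \<dots> \<and> t\<^sub>r\<close>; in particular \<open>wedge []\<close> is the unit of the exterior algebra.\<close>

lift_definition wedge :: "'w::complex_vector list \<Rightarrow> 'w ext"
  is "\<lambda>ts. Poly_Mapping.single ts 1" .

lemma wedge_add: "wedge (us @ (x + y) # ws) = wedge (us @ x # ws) + wedge (us @ y # ws)"
  by (transfer, unfold ext_rel_def, rule complex_vector.span_base, auto simp: diff_diff_add; blast)

lemma wedge_scale: "wedge (us @ (c *\<^sub>C x) # ws) = c *\<^sub>C wedge (us @ x # ws)"
  by (transfer, unfold ext_rel_def, rule complex_vector.span_base, auto; blast)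

lemma wedge_eq_0: "\<not> distinct ts \<Longrightarrow> wedge ts = 0"
  by (transfer, unfold ext_rel_def) (rule complex_vector.span_base, auto)

lemma alternating_wedge: "alternating_on UNIV wedge"
  by (simp add: alternating_on_def clinear_on_def wedge_add wedge_scale wedge_eq_0)

definition ext_power :: "nat \<Rightarrow> 'w::complex_vector set \<Rightarrow> 'w ext set"
  where "ext_power r S = cspan {wedge ts | ts. length ts = r \<and> set ts \<subseteq> S}"

definition ext_lift :: "('w::complex_vector list \<Rightarrow> 'c::complex_vector) \<Rightarrow> 'w ext \<Rightarrow> 'c"
  where "ext_lift h x = free_lin h (rep_ext x)"

lemma
  assumes "alternating_on UNIV h"
  shows clinear_ext_lift: "clinear (ext_lift h)"
    and ext_lift_wedge: "ext_lift h (wedge ts) = h ts"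
proof -
  let ?F = "free_lin h"
  have F0: "?F p = 0" if "p \<in> ext_rel" for p
    using that unfolding ext_rel_def
    by (rule cspan_kernel[OF clinear_free_lin, rotated])
      (use assms in \<open>auto simp: clinear_free_lin clinear_diff clinear_scale free_lin_single scaleC_one
        alternating_on_def clinear_on_def\<close>)
  have Feq: "?F p = ?F q" if "p - q \<in> ext_rel" for p q
    using F0[OF that] by (simp add: clinear_diff[OF clinear_free_lin])
  have lift: "ext_lift h (abs_ext p) = ?F p" for p
    unfolding ext_lift_def
    by (rule Feq) (rule Quotient3_rep_abs[OF Quotient3_ext], simp add: ext_rel_def complex_vector.span_zero)
  show "ext_lift h (wedge ts) = h ts"
    by (simp add: wedge_def lift free_lin_single scaleC_one)
  show "clinear (ext_lift h)"
  proof (rule clinearI)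
    fix x y :: "'a ext" and c
    obtain p q where pq: "x = abs_ext p" "y = abs_ext q"
      by (metis Quotient3_abs_rep[OF Quotient3_ext])
    show "ext_lift h (x + y) = ext_lift h x + ext_lift h y"
      by (simp add: pq plus_ext.abs_eq lift clinear_add[OF clinear_free_lin])
    show "ext_lift h (c *\<^sub>C x) = c *\<^sub>C ext_lift h x"
      by (simp add: pq scaleC_ext.abs_eq lift clinear_scale[OF clinear_free_lin])
  qed
qed


definition drop_nth :: "nat \<Rightarrow> 'a list \<Rightarrow> 'a list"
  where "drop_nth i ts = take i ts @ drop (Suc i) ts"

definition alt_sum :: "('w \<Rightarrow> 'w list \<Rightarrow> 'c::complex_vector) \<Rightarrow> 'w list \<Rightarrow> 'c"
  where "alt_sum B ts = (\<Sum>i<length ts. (- 1) ^ i *\<^sub>C B (ts ! i) (drop_nth i ts))"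

lemma alternating_swap:
  assumes h: "alternating_on S h" and S: "csubspace S"
    and "set us \<subseteq> S" "x \<in> S" "y \<in> S" "set ws \<subseteq> S"
  shows "h (us @ x # y # ws) = - h (us @ y # x # ws)"
proof -
  have xy: "x + y \<in> S" using assms by (simp add: complex_vector.subspace_add)
  have lin: "h (us' @ (a + b) # ws') = h (us' @ a # ws') + h (us' @ b # ws')"
    if "set us' \<subseteq> S" "set ws' \<subseteq> S" "a \<in> S" "b \<in> S" for us' ws' a b
    using h that unfolding alternating_on_def clinear_on_def by blast
  have nd: "h vs = 0" if "set vs \<subseteq> S" "\<not> distinct vs" for vs
    using h that unfolding alternating_on_def by blast
  have "0 = h (us @ (x + y) # (x + y) # ws)"
    using assms xy by (subst nd) auto
  also have "\<dots> = h (us @ x # (x + y) # ws) + h (us @ y # (x + y) # ws)"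
    using assms xy by (subst lin) auto
  also have "h (us @ x # (x + y) # ws) = h (us @ x # x # ws) + h (us @ x # y # ws)"
    using lin[of "us @ [x]" ws x y] assms by simp
  also have "h (us @ y # (x + y) # ws) = h (us @ y # x # ws) + h (us @ y # y # ws)"
    using lin[of "us @ [y]" ws x y] assms by simp
  also have "h (us @ x # x # ws) = 0" using assms by (subst nd) auto
  also have "h (us @ y # y # ws) = 0" using assms by (subst nd) auto
  finally show ?thesis by (simp add: eq_neg_iff_add_eq_0)
qed

lemma alternating_move:
  assumes h: "alternating_on S h" and S: "csubspace S"
    and "set us \<subseteq> S" "x \<in> S" "set vs \<subseteq> S" "set ws \<subseteq> S"
  shows "h (us @ x # vs @ ws) = (- 1) ^ length vs *\<^sub>C h (us @ vs @ x # ws)"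
  using assms(3-)
proof (induction vs arbitrary: us)
  case (Cons v vs)
  have "h (us @ x # v # vs @ ws) = - h (us @ v # x # vs @ ws)"
    by (rule alternating_swap[OF h S]) (use Cons.prems in auto)
  also have "h (us @ v # x # vs @ ws) = (- 1) ^ length vs *\<^sub>C h (us @ v # vs @ x # ws)"
    using Cons.IH[of "us @ [v]"] Cons.prems by simp
  finally show ?case by (simp add: complex_vector.scale_minus_left)
qed (simp add: scaleC_one)

lemma clinear_on_sum:
  assumes "\<And>i. i \<in> I \<Longrightarrow> clinear_on S (f i)"
  shows "clinear_on S (\<lambda>x. \<Sum>i\<in>I. c i *\<^sub>C f i x)"
  using assms unfolding clinear_on_def
  by (simp add: sum.distrib scaleC_add_right complex_vector.scale_sum_right scaleC_scaleC mult.commute)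

lemma alternating_alt_sum:
  assumes S: "csubspace S"
    and lin: "\<And>us. set us \<subseteq> S \<Longrightarrow> clinear_on S (\<lambda>x. B x us)"
    and alt: "\<And>v. v \<in> S \<Longrightarrow> alternating_on S (B v)"
  shows "alternating_on S (alt_sum B)"
  unfolding alternating_on_def
proof (intro conjI allI impI; elim conjE)
  fix us ws assume uw: "set us \<subseteq> S" "set ws \<subseteq> S"
  have *: "clinear_on S (\<lambda>x. B ((us @ x # ws) ! i) (drop_nth i (us @ x # ws)))"
    if "i < Suc (length us + length ws)" for i
  proof -
    have alt': "clinear_on S (\<lambda>x. B v (us' @ x # ws'))"
      if "v \<in> S" "set us' \<subseteq> S" "set ws' \<subseteq> S" for v us' ws'
      using alt[OF that(1)] that unfolding alternating_on_def by blast
    consider "i < length us" | "i = length us" | "i > length us" by linarith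
    then show ?thesis
    proof cases
      case 1
      then have eq: "(us @ x # ws) ! i = us ! i" "drop_nth i (us @ x # ws) = drop_nth i us @ x # ws" for x
        by (auto simp: drop_nth_def nth_append Suc_diff_le)
      show ?thesis unfolding eq
        by (rule alt') (use 1 uw in \<open>auto simp: drop_nth_def dest: in_set_takeD in_set_dropD\<close>)
    next
      case 2
      then have eq: "(us @ x # ws) ! i = x" "drop_nth i (us @ x # ws) = us @ ws" for x
        by (auto simp: drop_nth_def)
      show ?thesis unfolding eq by (rule lin) (use uw in auto)
    next
      case 3
      define j where "j = i - Suc (length us)"
      have i: "i = Suc (length us + j)" using 3 by (simp add: j_def)
      have eq: "(us @ x # ws) ! i = ws ! j" "drop_nth i (us @ x # ws) = us @ x # drop_nth j ws" for x
        by (auto simp: drop_nth_def i nth_append)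
      show ?thesis unfolding eq
        by (rule alt')
          (use that i uw in \<open>auto simp: drop_nth_def dest: in_set_takeD in_set_dropD\<close>)
    qed
  qed
  show "clinear_on S (\<lambda>x. alt_sum B (us @ x # ws))"
    unfolding alt_sum_def length_append length_Cons by (rule clinear_on_sum) (use * in simp)
next
  fix vs assume vs: "set vs \<subseteq> S" "\<not> distinct vs"
  then obtain a v b c where abc: "vs = a @ [v] @ b @ [v] @ c"
    using not_distinct_decomp by blast
  define i j where "i = length a" and "j = Suc (length a + length b)"
  have sub: "v \<in> S" "set a \<subseteq> S" "set b \<subseteq> S" "set c \<subseteq> S" using vs(1) abc by auto
  let ?t = "\<lambda>k. (- 1) ^ k *\<^sub>C B (vs ! k) (drop_nth k vs)"
  have "?t k = 0" if "k < length vs" "k \<noteq> i" "k \<noteq> j" for k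
  proof -
    have "\<not> distinct (drop_nth k vs)"
    proof -
      consider "k < i" | "i < k" "k < j" | "j < k"
        using \<open>k \<noteq> i\<close> \<open>k \<noteq> j\<close> by (metis linorder_neqE_nat)
      then show ?thesis
      proof cases
        case 1
        then have "drop_nth k vs = drop_nth k a @ [v] @ b @ [v] @ c"
          by (auto simp: drop_nth_def abc i_def Suc_diff_le)
        then show ?thesis by simp
      next
        case 2
        then obtain l where l: "k = Suc (length a + l)" "l < length b"
          unfolding i_def j_def by (metis Suc_less_eq add_less_cancel_left less_iff_Suc_add add_Suc_right)
        then have "drop_nth k vs = a @ [v] @ drop_nth l b @ [v] @ c"
          by (auto simp: drop_nth_def abc Suc_diff_le)
        then show ?thesis by simp
      next
        case 3
        then obtain l where l: "k = Suc (Suc (length a + length b + l))"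
          unfolding j_def by (metis add_Suc less_iff_Suc_add)
        then have "drop_nth k vs = a @ [v] @ b @ [v] @ drop_nth l c"
          by (auto simp: drop_nth_def abc numeral_eq_Suc)
        then show ?thesis by simp
      qed
    qed
    moreover have "set (drop_nth k vs) \<subseteq> S"
      using vs(1) by (auto simp: drop_nth_def dest: in_set_takeD in_set_dropD)
    moreover have "vs ! k \<in> S" using vs(1) that(1) by auto
    ultimately have "B (vs ! k) (drop_nth k vs) = 0"
      using alt unfolding alternating_on_def by blast
    then show ?thesis by simp
  qed
  then have "alt_sum B vs = (\<Sum>k\<in>{i, j}. ?t k)"
    unfolding alt_sum_def
    by (intro sum.mono_neutral_right) (auto simp: i_def j_def abc)
  also have "\<dots> = ?t i + ?t j" by (simp add: i_def j_def)
  also have "?t i = (- 1) ^ i *\<^sub>C B v (a @ b @ v # c)"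
    by (simp add: drop_nth_def abc i_def)
  also have "?t j = (- 1) ^ j *\<^sub>C B v (a @ v # b @ c)"
    by (simp add: drop_nth_def abc j_def nth_append)
  also have "B v (a @ v # b @ c) = (- 1) ^ length b *\<^sub>C B v (a @ b @ v # c)"
    by (rule alternating_move[OF alt S]) (use sub in auto)
  also have "(- 1) ^ j *\<^sub>C (- 1) ^ length b *\<^sub>C B v (a @ b @ v # c)
    = - ((- 1) ^ i *\<^sub>C B v (a @ b @ v # c))"
  proof -
    have "(- 1 :: complex) ^ j * (- 1) ^ length b = - ((- 1) ^ i)"
      unfolding i_def j_def power_add power_Suc by (cases "even (length b)") simp_all
    then show ?thesis by (simp add: scaleC_scaleC complex_vector.scale_minus_left)
  qed
  finally show "alt_sum B vs = 0" by simp
qed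

text \<open>Interior product with a linear functional \<open>\<phi>\<close>.\<close>

definition contract :: "('w::complex_vector \<Rightarrow> complex) \<Rightarrow> 'w ext \<Rightarrow> 'w ext"
  where "contract \<phi> = ext_lift (alt_sum (\<lambda>t us. \<phi> t *\<^sub>C wedge us))"

lemma
  assumes "clinear \<phi>"
  shows clinear_contract: "clinear (contract \<phi>)"
    and contract_wedge:
      "contract \<phi> (wedge ts) = (\<Sum>i<length ts. (- 1) ^ i *\<^sub>C \<phi> (ts ! i) *\<^sub>C wedge (drop_nth i ts))"
proof -
  have "alternating_on UNIV (alt_sum (\<lambda>t us. \<phi> t *\<^sub>C wedge us))"
    by (rule alternating_alt_sum)
      (use alternating_wedge in \<open>auto simp: clinear_on_def alternating_on_def clinear_add[OF assms]
        clinear_scale[OF assms] scaleC_add_left scaleC_add_right scaleC_scaleC scaleC_complex_def mult.commute\<close>)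
  then show "clinear (contract \<phi>)"
    "contract \<phi> (wedge ts) = (\<Sum>i<length ts. (- 1) ^ i *\<^sub>C \<phi> (ts ! i) *\<^sub>C wedge (drop_nth i ts))"
    unfolding contract_def by (simp_all add: clinear_ext_lift ext_lift_wedge alt_sum_def)
qed

section \<open>Polynomial differential operators\<close>

inductive_set polyfuns :: "(complex ^ 'n \<Rightarrow> complex) set" where
  const: "(\<lambda>x. c) \<in> polyfuns"
| coord: "(\<lambda>x. x $ i) \<in> polyfuns"
| add: "p \<in> polyfuns \<Longrightarrow> q \<in> polyfuns \<Longrightarrow> (\<lambda>x. p x + q x) \<in> polyfuns"
| mult: "p \<in> polyfuns \<Longrightarrow> q \<in> polyfuns \<Longrightarrow> (\<lambda>x. p x * q x) \<in> polyfuns"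

typedef 'n polyfn = "polyfuns :: (complex ^ 'n \<Rightarrow> complex) set" morphisms peval Abs_polyfn
  using polyfuns.const by blast

setup_lifting type_definition_polyfn

instantiation polyfn :: (finite) comm_ring_1
begin
lift_definition zero_polyfn :: "'a polyfn" is "\<lambda>x. 0" by (rule polyfuns.const)
lift_definition one_polyfn :: "'a polyfn" is "\<lambda>x. 1" by (rule polyfuns.const)
lift_definition plus_polyfn :: "'a polyfn \<Rightarrow> 'a polyfn \<Rightarrow> 'a polyfn"
  is "\<lambda>p q x. p x + q x" by (rule polyfuns.add)
lift_definition times_polyfn :: "'a polyfn \<Rightarrow> 'a polyfn \<Rightarrow> 'a polyfn"
  is "\<lambda>p q x. p x * q x" by (rule polyfuns.mult)
lift_definition uminus_polyfn :: "'a polyfn \<Rightarrow> 'a polyfn" is "\<lambda>p x. - p x"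
  using polyfuns.mult[OF polyfuns.const[of "- 1"]] by simp
lift_definition minus_polyfn :: "'a polyfn \<Rightarrow> 'a polyfn \<Rightarrow> 'a polyfn"
  is "\<lambda>p q x. p x - q x"
  using polyfuns.add[OF _ polyfuns.mult[OF polyfuns.const[of "- 1"]]] by simp
instance
  by (standard; transfer) (auto simp: fun_eq_iff algebra_simps)
end

instantiation polyfn :: (finite) complex_vector
begin
lift_definition scaleC_polyfn :: "complex \<Rightarrow> 'a polyfn \<Rightarrow> 'a polyfn" is "\<lambda>c p x. c * p x"
  by (rule polyfuns.mult[OF polyfuns.const])
instance
  by (standard; transfer) (auto simp: fun_eq_iff algebra_simps)
end

lemma polyfn_scale_mult: "(c *\<^sub>C p) * q = c *\<^sub>C (p * q)" for p q :: "'n::finite polyfn"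
  by transfer (simp add: mult.assoc)

lemma polyfuns_deriv:
  assumes "p \<in> polyfuns"
  shows "\<exists>q\<in>polyfuns. \<forall>x. ((\<lambda>t. p (x + t *s \<xi>)) has_field_derivative q x) (at 0)"
  using assms
proof (induction rule: polyfuns.induct)
  case (const c)
  then show ?case by (auto intro!: bexI[OF _ polyfuns.const[of 0]])
next
  case (coord i)
  show ?case
    by (rule bexI[OF _ polyfuns.const[of "\<xi> $ i"]]) (auto intro!: derivative_eq_intros)
next
  case (add p q)
  then obtain p' q' where "p' \<in> polyfuns" "q' \<in> polyfuns"
    "\<forall>x. ((\<lambda>t. p (x + t *s \<xi>)) has_field_derivative p' x) (at 0)"
    "\<forall>x. ((\<lambda>t. q (x + t *s \<xi>)) has_field_derivative q' x) (at 0)" by blast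
  then show ?case
    by (auto intro!: bexI[OF _ polyfuns.add] DERIV_add)
next
  case (mult p q)
  then obtain p' q' where pq: "p' \<in> polyfuns" "q' \<in> polyfuns"
    "\<forall>x. ((\<lambda>t. p (x + t *s \<xi>)) has_field_derivative p' x) (at 0)"
    "\<forall>x. ((\<lambda>t. q (x + t *s \<xi>)) has_field_derivative q' x) (at 0)" by blast
  show ?case
  proof (rule bexI)
    show "\<forall>x. ((\<lambda>t. p (x + t *s \<xi>) * q (x + t *s \<xi>)) has_field_derivative
        (\<lambda>x. p' x * q x + q' x * p x) x) (at 0)"
    proof
      fix x
      show "((\<lambda>t. p (x + t *s \<xi>) * q (x + t *s \<xi>)) has_field_derivative
        (\<lambda>x. p' x * q x + q' x * p x) x) (at 0)"
        using DERIV_mult[OF pq(3)[rule_format, of x] pq(4)[rule_format, of x]] by simp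
    qed
    show "(\<lambda>x. p' x * q x + q' x * p x) \<in> polyfuns"
      using pq mult by (intro polyfuns.add polyfuns.mult) auto
  qed
qed

text \<open>The derivative of a polynomial along the constant vector field \<open>\<xi>\<close>.\<close>

lift_definition vderiv :: "complex ^ 'n \<Rightarrow> 'n polyfn \<Rightarrow> 'n polyfn"
  is "\<lambda>\<xi> p x. deriv (\<lambda>t. p (x + t *s \<xi>)) 0"
proof -
  fix \<xi> and p :: "complex ^ 'n \<Rightarrow> complex" assume "p \<in> polyfuns"
  then obtain q where "q \<in> polyfuns"
    "\<forall>x. ((\<lambda>t. p (x + t *s \<xi>)) has_field_derivative q x) (at 0)"
    using polyfuns_deriv by blast
  moreover from this have "(\<lambda>x. deriv (\<lambda>t. p (x + t *s \<xi>)) 0) = q"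
    by (auto simp: DERIV_imp_deriv)
  ultimately show "(\<lambda>x. deriv (\<lambda>t. p (x + t *s \<xi>)) 0) \<in> polyfuns" by simp
qed

lemma peval_vderiv:
  "((\<lambda>t. peval p (x + t *s \<xi>)) has_field_derivative peval (vderiv \<xi> p) x) (at 0)"
proof -
  obtain q where "((\<lambda>t. peval p (x + t *s \<xi>)) has_field_derivative q x) (at 0)"
    using polyfuns_deriv[OF peval[of p]] by blast
  then show ?thesis by (simp add: vderiv.rep_eq DERIV_imp_deriv)
qed

lemma vderiv_unique:
  assumes "\<And>x. ((\<lambda>t. peval p (x + t *s \<xi>)) has_field_derivative peval q x) (at 0)"
  shows "vderiv \<xi> p = q"
  by (rule peval_inject[THEN iffD1]) (rule ext, rule DERIV_unique[OF peval_vderiv assms])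

lemma clinear_vderiv: "clinear (vderiv \<xi>)"
proof (rule clinearI; rule vderiv_unique)
  fix p q :: "'a polyfn" and c x
  show "((\<lambda>t. peval (p + q) (x + t *s \<xi>)) has_field_derivative
      peval (vderiv \<xi> p + vderiv \<xi> q) x) (at 0)"
    unfolding plus_polyfn.rep_eq by (intro DERIV_add peval_vderiv)
  show "((\<lambda>t. peval (c *\<^sub>C p) (x + t *s \<xi>)) has_field_derivative
      peval (c *\<^sub>C vderiv \<xi> p) x) (at 0)"
    unfolding scaleC_polyfn.rep_eq by (intro DERIV_cmult peval_vderiv)
qed

text \<open>Linearity in the direction, from the formula for polynomials.\<close>

lemma clinear_vderiv_dir: "clinear (\<lambda>\<xi>. vderiv \<xi> p)"
proof -
  have *: "\<exists>D. (\<forall>j. D j \<in> polyfuns) \<and> (\<forall>\<xi> x. ((\<lambda>t. q (x + t *s \<xi>)) has_field_derivative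
      (\<Sum>j\<in>UNIV. \<xi> $ j * D j x)) (at 0))" if "q \<in> polyfuns" for q :: "complex ^ 'a \<Rightarrow> complex"
    using that
  proof (induction rule: polyfuns.induct)
    case (const c)
    show ?case by (rule exI[of _ "\<lambda>j x. 0"]) (auto intro: polyfuns.const)
  next
    case (coord i)
    have "(\<Sum>j\<in>UNIV. \<xi> $ j * (if j = i then 1 else 0)) = \<xi> $ i" for \<xi> :: "complex ^ 'a"
      by (simp add: if_distrib cong: if_cong)
    then show ?case
      by (intro exI[of _ "\<lambda>j x. if j = i then 1 else 0"])
        (auto intro: polyfuns.const intro!: derivative_eq_intros)
  next
    case (add p q)
    then obtain D E where D: "\<forall>j. D j \<in> polyfuns" "\<And>\<xi> x. ((\<lambda>t. p (x + t *s \<xi>)) has_field_derivative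
        (\<Sum>j\<in>UNIV. \<xi> $ j * D j x)) (at 0)"
      and E: "\<forall>j. E j \<in> polyfuns" "\<And>\<xi> x. ((\<lambda>t. q (x + t *s \<xi>)) has_field_derivative
        (\<Sum>j\<in>UNIV. \<xi> $ j * E j x)) (at 0)" by blast
    have "((\<lambda>t. p (x + t *s \<xi>) + q (x + t *s \<xi>)) has_field_derivative
        (\<Sum>j\<in>UNIV. \<xi> $ j * (D j x + E j x))) (at 0)" for \<xi> x
      using DERIV_add[OF D(2) E(2)] by (simp add: sum.distrib distrib_left)
    then show ?case
      using D(1) E(1) by (intro exI[of _ "\<lambda>j x. D j x + E j x"]) (auto intro: polyfuns.add)
  next
    case (mult p q)
    then obtain D E where D: "\<forall>j. D j \<in> polyfuns" "\<And>\<xi> x. ((\<lambda>t. p (x + t *s \<xi>)) has_field_derivative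
        (\<Sum>j\<in>UNIV. \<xi> $ j * D j x)) (at 0)"
      and E: "\<forall>j. E j \<in> polyfuns" "\<And>\<xi> x. ((\<lambda>t. q (x + t *s \<xi>)) has_field_derivative
        (\<Sum>j\<in>UNIV. \<xi> $ j * E j x)) (at 0)" by blast
    have "((\<lambda>t. p (x + t *s \<xi>) * q (x + t *s \<xi>)) has_field_derivative
        (\<Sum>j\<in>UNIV. \<xi> $ j * (D j x * q x + E j x * p x))) (at 0)" for \<xi> x
      using DERIV_mult[OF D(2)[of x \<xi>] E(2)[of x \<xi>]]
      by (simp add: sum.distrib distrib_left sum_distrib_right mult.assoc)
    then show ?case
      using D(1) E(1) mult.hyps
      by (intro exI[of _ "\<lambda>j x. D j x * q x + E j x * p x"]) (auto intro!: polyfuns.add polyfuns.mult)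
  qed
  then obtain D where D: "\<And>j. D j \<in> polyfuns" "\<And>\<xi> x. ((\<lambda>t. peval p (x + t *s \<xi>)) has_field_derivative
      (\<Sum>j\<in>UNIV. \<xi> $ j * D j x)) (at 0)"
    using *[OF peval[of p]] by blast
  have eq: "peval (vderiv \<xi> p) x = (\<Sum>j\<in>UNIV. \<xi> $ j * D j x)" for \<xi> x
    by (rule DERIV_unique[OF peval_vderiv D(2)])
  show ?thesis
    by (rule clinearI; rule peval_inject[THEN iffD1])
      (simp_all add: fun_eq_iff eq plus_polyfn.rep_eq scaleC_polyfn.rep_eq scaleC_vec_eq sum.distrib
        distrib_right sum_distrib_left mult.assoc)
qed

text \<open>The ring \<open>D\<^sub>X\<close> of differential operators on \<open>\<complex>\<^sup>n\<close> with polynomial coefficients, as the ring of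
  operators on polynomial functions generated by multiplications and derivations.\<close>

inductive_set diffops :: "('n::finite polyfn \<Rightarrow> 'n polyfn) set" where
  mult: "(\<lambda>g. p * g) \<in> diffops"
| deriv: "vderiv \<xi> \<in> diffops"
| add: "P \<in> diffops \<Longrightarrow> Q \<in> diffops \<Longrightarrow> (\<lambda>g. P g + Q g) \<in> diffops"
| comp: "P \<in> diffops \<Longrightarrow> Q \<in> diffops \<Longrightarrow> (\<lambda>g. P (Q g)) \<in> diffops"

typedef 'n weyl = "diffops :: ('n::finite polyfn \<Rightarrow> 'n polyfn) set" morphisms weyl_apply Abs_weyl
  using diffops.deriv by blast

setup_lifting type_definition_weyl

lemma clinear_diffops: "P \<in> diffops \<Longrightarrow> clinear P"
proof (induction rule: diffops.induct)
  case (mult p)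
  show ?case by (rule clinearI; transfer) (simp_all add: algebra_simps)
next
  case (deriv \<xi>)
  show ?case by (rule clinear_vderiv)
next
  case (add P Q)
  then show ?case
    by (intro clinearI)
      (simp_all add: clinear_add[of P] clinear_add[of Q] clinear_scale[of P] clinear_scale[of Q]
        scaleC_add_right add_ac)
next
  case (comp P Q)
  then show ?case
    by (intro clinearI)
      (simp_all add: clinear_add[of P] clinear_add[of Q] clinear_scale[of P] clinear_scale[of Q])
qed

lemma diffops_scale:
  assumes "P \<in> diffops"
  shows "(\<lambda>g. c *\<^sub>C P g) \<in> diffops"
  using diffops.comp[OF diffops.mult[of "c *\<^sub>C 1"] assms] by (simp add: polyfn_scale_mult)

instantiation weyl :: (finite) ring_1
begin
lift_definition zero_weyl :: "'a weyl" is "\<lambda>g. 0"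
  using diffops.mult[of 0] by (simp only: lambda_zero)
lift_definition one_weyl :: "'a weyl" is "\<lambda>g. g"
  using diffops.mult[of 1] by (simp only: lambda_one)
lift_definition plus_weyl :: "'a weyl \<Rightarrow> 'a weyl \<Rightarrow> 'a weyl" is "\<lambda>P Q g. P g + Q g"
  by (rule diffops.add)
lift_definition times_weyl :: "'a weyl \<Rightarrow> 'a weyl \<Rightarrow> 'a weyl" is "\<lambda>P Q g. P (Q g)"
  by (rule diffops.comp)
lift_definition uminus_weyl :: "'a weyl \<Rightarrow> 'a weyl" is "\<lambda>P g. - P g"
  using diffops_scale[of _ "- 1"] by (simp add: complex_vector.scale_minus_left scaleC_one)
lift_definition minus_weyl :: "'a weyl \<Rightarrow> 'a weyl \<Rightarrow> 'a weyl" is "\<lambda>P Q g. P g - Q g"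
  using diffops.add[OF _ diffops_scale[of _ "- 1"]]
  by (simp add: complex_vector.scale_minus_left scaleC_one)
instance
proof
  fix a b c :: "'a weyl"
  show "(0 :: 'a weyl) \<noteq> 1"
    by transfer (metis zero_neq_one)
  show "a * (b + c) = a * b + a * c"
    by transfer (rule ext, rule clinear_add[OF clinear_diffops])
qed (transfer; simp add: fun_eq_iff algebra_simps)+
end

instantiation weyl :: (finite) complex_vector
begin
lift_definition scaleC_weyl :: "complex \<Rightarrow> 'a weyl \<Rightarrow> 'a weyl" is "\<lambda>c P g. c *\<^sub>C P g"
  by (rule diffops_scale)
instance
  by (standard; transfer) (simp_all add: scaleC_add_right scaleC_add_left scaleC_scaleC scaleC_one)
end

lemma weyl_scale_mult:
  "(c *\<^sub>C P) * Q = c *\<^sub>C (P * Q)" "P * (c *\<^sub>C Q) = c *\<^sub>C (P * Q)" for P Q :: "'n::finite weyl"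
  by (transfer, simp) (transfer, rule ext, rule clinear_scale[OF clinear_diffops])

lifting_forget polyfn.lifting

lift_definition weyl_mult :: "'n::finite polyfn \<Rightarrow> 'n weyl" is "\<lambda>p g. p * g"
  by (rule diffops.mult)

lift_definition weyl_deriv :: "complex ^ 'n::finite \<Rightarrow> 'n weyl" is vderiv
  by (rule diffops.deriv)

text \<open>\<open>weyl_embed (\<xi>, f)\<close> is the operator \<open>\<xi> + f\<close>.\<close>

definition weyl_embed :: "(complex ^ 'n) \<times> 'n polyfn \<Rightarrow> 'n::finite weyl"
  where "weyl_embed t = weyl_deriv (fst t) + weyl_mult (snd t)"

lemma weyl_deriv_linear:
  "weyl_deriv (\<xi> + \<eta>) = weyl_deriv \<xi> + weyl_deriv \<eta>" "weyl_deriv (c *\<^sub>C \<xi>) = c *\<^sub>C weyl_deriv \<xi>"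
  by (transfer, rule ext, rule clinear_add[OF clinear_vderiv_dir])
    (transfer, rule ext, rule clinear_scale[OF clinear_vderiv_dir])

lemma weyl_mult_linear:
  "weyl_mult (p + q) = weyl_mult p + weyl_mult q" "weyl_mult (c *\<^sub>C p) = c *\<^sub>C weyl_mult p"
  by (transfer, rule ext, rule distrib_right) (transfer, rule ext, rule polyfn_scale_mult)

lemma clinear_weyl_embed: "clinear weyl_embed"
  by (rule clinearI)
    (simp_all add: weyl_embed_def scaleC_prod_def scaleC_add_right weyl_deriv_linear weyl_mult_linear add_ac)

section \<open>Arrangements, quivers and framings\<close>

definition hyperplane :: "(complex ^ 'n) set \<Rightarrow> bool"
  where "hyperplane H \<longleftrightarrow> (\<exists>a b. a \<noteq> 0 \<and> H = {x. (\<Sum>i\<in>UNIV. a $ i * x $ i) = b})"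

definition arrangement :: "(complex ^ 'n) set set \<Rightarrow> bool"
  where "arrangement \<C> \<longleftrightarrow> finite \<C> \<and> (\<forall>H\<in>\<C>. hyperplane H)"

text \<open>The index \<open>\<alpha>\<close> of a stratum is identified with the closure of the stratum, i.e. with the
  corresponding intersection of hyperplanes.\<close>

definition flats :: "(complex ^ 'n) set set \<Rightarrow> (complex ^ 'n) set set"
  where "flats \<C> = {\<Inter>\<S> | \<S>. \<S> \<subseteq> \<C>} - {{}}"

definition stratum :: "(complex ^ 'n) set set \<Rightarrow> (complex ^ 'n) set \<Rightarrow> (complex ^ 'n) set"
  where "stratum \<C> \<alpha> = \<alpha> - \<Union>{\<beta> \<in> flats \<C>. \<beta> \<subset> \<alpha>}"

definition tangent :: "(complex ^ 'n) set \<Rightarrow> (complex ^ 'n) set"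
  where "tangent \<alpha> = {\<xi>. \<forall>x\<in>\<alpha>. x + \<xi> \<in> \<alpha>}"

definition level :: "(complex ^ 'n) set \<Rightarrow> int"
  where "level \<alpha> = int CARD('n) - int (vec.dim (tangent \<alpha>))"

definition covers :: "(complex ^ 'n) set \<Rightarrow> (complex ^ 'n) set \<Rightarrow> bool"  (infix \<open>\<succ>\<close> 50)
  where "\<alpha> \<succ> \<beta> \<longleftrightarrow> \<beta> \<subseteq> \<alpha> \<and> vec.dim (tangent \<alpha>) = vec.dim (tangent \<beta>) + 1"

definition adjacent :: "(complex ^ 'n) set \<Rightarrow> (complex ^ 'n) set \<Rightarrow> bool"
  where "adjacent \<alpha> \<beta> \<longleftrightarrow> \<alpha> \<succ> \<beta> \<or> \<beta> \<succ> \<alpha>"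

definition affine_fn :: "'n::finite polyfn \<Rightarrow> bool"
  where "affine_fn f \<longleftrightarrow> (\<exists>a c. \<forall>x. peval f x = (\<Sum>i\<in>UNIV. a $ i * x $ i) + c)"

definition vanishing :: "(complex ^ 'n) set set \<Rightarrow> (complex ^ 'n) set \<Rightarrow> 'n::finite polyfn set"
  where "vanishing \<C> \<alpha> = {f. affine_fn f \<and> (\<forall>x\<in>stratum \<C> \<alpha>. peval f x = 0)}"

text \<open>\<open>\<T>\<^sub>\<alpha> = T\<^sub>\<alpha> \<oplus> F\<^sub>\<alpha>\<close>.\<close>

definition lagrangian ::
    "(complex ^ 'n) set set \<Rightarrow> (complex ^ 'n) set \<Rightarrow> ((complex ^ 'n) \<times> 'n::finite polyfn) set"
  where "lagrangian \<C> \<alpha> = tangent \<alpha> \<times> vanishing \<C> \<alpha>"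

text \<open>\<open>\<xi>(f)\<close> is constant for affine \<open>f\<close>.\<close>

definition pairing :: "complex ^ 'n \<Rightarrow> 'n::finite polyfn \<Rightarrow> complex"
  where "pairing \<xi> f = peval (vderiv \<xi> f) 0"

text \<open>The spaces \<open>V \<alpha>\<close> are finite-dimensional subspaces of an arbitrary ambient space \<open>'v\<close>, and
  \<open>A \<alpha> \<beta>\<close> is relevant on \<open>V \<beta>\<close> only.\<close>

definition quiver :: "(complex ^ 'n) set set \<Rightarrow> ((complex ^ 'n) set \<Rightarrow> 'v::complex_vector set) \<Rightarrow>
    ((complex ^ 'n) set \<Rightarrow> (complex ^ 'n) set \<Rightarrow> 'v \<Rightarrow> 'v) \<Rightarrow> bool"
  where "quiver \<C> V A \<longleftrightarrow>
    (\<forall>\<alpha>\<in>flats \<C>. \<exists>B. finite B \<and> V \<alpha> = cspan B) \<and>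
    (\<forall>\<alpha>\<in>flats \<C>. \<forall>\<beta>\<in>flats \<C>. clinear_on (V \<beta>) (A \<alpha> \<beta>) \<and> A \<alpha> \<beta> ` V \<beta> \<subseteq> V \<alpha>) \<and>
    (\<forall>\<alpha>\<in>flats \<C>. \<forall>\<beta>\<in>flats \<C>. \<not> adjacent \<alpha> \<beta> \<longrightarrow> (\<forall>v\<in>V \<beta>. A \<alpha> \<beta> v = 0)) \<and>
    (\<forall>\<alpha>\<in>flats \<C>. \<forall>\<gamma>\<in>flats \<C>. \<bar>level \<alpha> - level \<gamma>\<bar> = 2 \<longrightarrow>
      (\<forall>v\<in>V \<gamma>. (\<Sum>\<beta>\<in>flats \<C>. A \<alpha> \<beta> (A \<beta> \<gamma> v)) = 0)) \<and>
    (\<forall>\<alpha>\<in>flats \<C>. \<forall>\<gamma>\<in>flats \<C>. level \<alpha> = level \<gamma> \<and> \<alpha> \<noteq> \<gamma> \<and>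
      (\<exists>\<delta>\<in>flats \<C>. \<alpha> \<succ> \<delta> \<and> \<gamma> \<succ> \<delta>) \<longrightarrow>
      (\<forall>v\<in>V \<gamma>. (\<Sum>\<beta>\<in>flats \<C>. A \<alpha> \<beta> (A \<beta> \<gamma> v)) = 0))"

text \<open>For an edge \<open>\<alpha> \<succ> \<beta>\<close>, \<open>fr \<beta> \<alpha>\<close> is \<open>f\<^bsub>\<beta>,\<alpha>\<^esub>\<close> and \<open>xi \<alpha> \<beta>\<close> is \<open>\<xi>\<^bsub>\<alpha>,\<beta>\<^esub>\<close>.\<close>

definition edge_framing :: "(complex ^ 'n) set set \<Rightarrow>
    ((complex ^ 'n) set \<Rightarrow> (complex ^ 'n) set \<Rightarrow> 'n::finite polyfn) \<Rightarrow>
    ((complex ^ 'n) set \<Rightarrow> (complex ^ 'n) set \<Rightarrow> complex ^ 'n) \<Rightarrow> bool"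
  where "edge_framing \<C> fr xi \<longleftrightarrow> (\<forall>\<alpha>\<in>flats \<C>. \<forall>\<beta>\<in>flats \<C>. \<alpha> \<succ> \<beta> \<longrightarrow>
    fr \<beta> \<alpha> \<in> vanishing \<C> \<beta> - vanishing \<C> \<alpha> \<and> xi \<alpha> \<beta> \<in> tangent \<alpha> - tangent \<beta>)"

text \<open>Translation-invariant \<open>k\<close>-forms on an affine space with translation space \<open>S\<close>, i.e. alternating
  \<open>k\<close>-linear forms on \<open>S\<close>, set to \<open>0\<close> outside their domain.\<close>

definition forms :: "nat \<Rightarrow> 'a::complex_vector set \<Rightarrow> ('a list \<Rightarrow> complex) set"
  where "forms k S = {\<omega>. alternating_on S \<omega> \<and> (\<forall>vs. \<not> (set vs \<subseteq> S \<and> length vs = k) \<longrightarrow> \<omega> vs = 0)}"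

definition top_forms :: "(complex ^ 'n) set \<Rightarrow> ((complex ^ 'n) list \<Rightarrow> complex) set"
  where "top_forms \<alpha> = forms (vec.dim (tangent \<alpha>)) (tangent \<alpha>)"

text \<open>\<open>df \<and> \<eta>\<close> for a form \<open>\<eta>\<close> on \<open>S\<close>.\<close>

definition df_wedge :: "(complex ^ 'n) set \<Rightarrow> 'n::finite polyfn \<Rightarrow>
    ((complex ^ 'n) list \<Rightarrow> complex) \<Rightarrow> (complex ^ 'n) list \<Rightarrow> complex"
  where "df_wedge S f \<eta> vs = (if set vs \<subseteq> S then alt_sum (\<lambda>v us. pairing v f * \<eta> us) vs else 0)"

text \<open>\<open>form_map fr xi \<beta> \<alpha>\<close> is \<open>\<pi>\<^bsub>\<beta>,\<alpha>\<^esub>\<close>. For \<open>\<alpha> \<succ> \<beta>\<close>, the product \<open>df \<and> \<omega>'\<close> on \<open>\<alpha>\<close> is formed by means of an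
  arbitrary extension \<open>\<eta>\<close> of \<open>\<omega>'\<close> to \<open>\<alpha>\<close>.\<close>

definition form_rel :: "((complex ^ 'n) set \<Rightarrow> (complex ^ 'n) set \<Rightarrow> 'n::finite polyfn) \<Rightarrow>
    ((complex ^ 'n) set \<Rightarrow> (complex ^ 'n) set \<Rightarrow> complex ^ 'n) \<Rightarrow>
    (complex ^ 'n) set \<Rightarrow> (complex ^ 'n) set \<Rightarrow>
    ((complex ^ 'n) list \<Rightarrow> complex) \<Rightarrow> ((complex ^ 'n) list \<Rightarrow> complex) \<Rightarrow> bool"
  where "form_rel fr xi \<beta> \<alpha> \<omega> \<omega>' \<longleftrightarrow> \<omega>' \<in> top_forms \<beta> \<and>
    (if \<alpha> \<succ> \<beta> then
      \<exists>\<eta>\<in>forms (vec.dim (tangent \<beta>)) (tangent \<alpha>).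
        (\<forall>vs. set vs \<subseteq> tangent \<beta> \<longrightarrow> \<eta> vs = \<omega>' vs) \<and> df_wedge (tangent \<alpha>) (fr \<beta> \<alpha>) \<eta> = \<omega>
    else \<forall>vs. set vs \<subseteq> tangent \<alpha> \<longrightarrow> \<omega>' (xi \<beta> \<alpha> # vs) = \<omega> vs)"

definition form_map :: "((complex ^ 'n) set \<Rightarrow> (complex ^ 'n) set \<Rightarrow> 'n::finite polyfn) \<Rightarrow>
    ((complex ^ 'n) set \<Rightarrow> (complex ^ 'n) set \<Rightarrow> complex ^ 'n) \<Rightarrow>
    (complex ^ 'n) set \<Rightarrow> (complex ^ 'n) set \<Rightarrow>
    ((complex ^ 'n) list \<Rightarrow> complex) \<Rightarrow> (complex ^ 'n) list \<Rightarrow> complex"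
  where "form_map fr xi \<beta> \<alpha> \<omega> = (THE \<omega>'. form_rel fr xi \<beta> \<alpha> \<omega> \<omega>')"


section \<open>The complex\<close>

text \<open>\<open>D\<^sub>X \<otimes> \<Lambda>W \<otimes> \<Omega> \<otimes> V\<close> for the ambient spaces \<open>W\<close> of all \<open>\<T>\<^sub>\<alpha>\<close>, \<open>\<Omega>\<close> of all spaces of top forms, and \<open>'v\<close> of
  all \<open>V \<alpha>\<close>. A direct sum over \<open>\<alpha>\<close> is the set of functions of \<open>\<alpha>\<close> vanishing off \<open>flats \<C>\<close>.\<close>

type_synonym ('n, 'v) summand =
  "('n weyl, (((complex ^ 'n) \<times> 'n polyfn) ext, ((complex ^ 'n) list \<Rightarrow> complex, 'v) tensor) tensor) tensor"

type_synonym ('n, 'v) chain = "(complex ^ 'n) set \<Rightarrow> ('n, 'v) summand"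

definition chains :: "(complex ^ 'n) set set \<Rightarrow> ((complex ^ 'n) set \<Rightarrow> 'v::complex_vector set) \<Rightarrow>
    nat \<Rightarrow> ('n::finite, 'v) chain set"
  where "chains \<C> V r = {x. (\<forall>\<alpha>\<in>flats \<C>. x \<alpha> \<in>
      UNIV \<otimes>\<^sub>s ext_power r (lagrangian \<C> \<alpha>) \<otimes>\<^sub>s top_forms \<alpha> \<otimes>\<^sub>s V \<alpha>) \<and> (\<forall>\<alpha>. \<alpha> \<notin> flats \<C> \<longrightarrow> x \<alpha> = 0)}"

definition pure :: "(complex ^ 'n) set \<Rightarrow> 'n::finite weyl \<Rightarrow> ((complex ^ 'n) \<times> 'n polyfn) list \<Rightarrow>
    ((complex ^ 'n) list \<Rightarrow> complex) \<Rightarrow> 'v::complex_vector \<Rightarrow> ('n, 'v) chain"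
  where "pure \<alpha> P ts \<omega> v = (\<lambda>\<gamma>. if \<gamma> = \<alpha> then P \<otimes> wedge ts \<otimes> \<omega> \<otimes> v else 0)"

definition weyl_act :: "'n::finite weyl \<Rightarrow> ('n, 'v::complex_vector) chain \<Rightarrow> ('n, 'v) chain"
  where "weyl_act P x = (\<lambda>\<alpha>. tensor_map (\<lambda>Q. P * Q) (\<lambda>m. m) (x \<alpha>))"

definition d1 :: "('n::finite, 'v::complex_vector) chain \<Rightarrow> ('n, 'v) chain"
  where "d1 x = (\<lambda>\<alpha>. tensor_lift (\<lambda>P. tensor_lift (\<lambda>e u.
    ext_lift (alt_sum (\<lambda>t us. (P * weyl_embed t) \<otimes> wedge us \<otimes> u)) e)) (x \<alpha>))"

text \<open>The maps \<open>A\<^sup>r\<^bsub>\<beta>,\<alpha>\<^esub>\<close>, for all \<open>r\<close> at once. The interior product by \<open>edge_fun fr xi \<beta> \<alpha>\<close> on the exterior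
  algebra of \<open>\<T>\<^sub>\<alpha> = T\<^sub>\<alpha> \<oplus> F\<^sub>\<alpha>\<close> is the contraction of the first factor of \<open>\<Lambda>T\<^sub>\<alpha> \<otimes> \<Lambda>F\<^sub>\<alpha>\<close> by \<open>df\<^bsub>\<beta>,\<alpha>\<^esub>\<close> if
  \<open>\<alpha> \<succ> \<beta>\<close>, and that of the second factor by \<open>\<xi>\<^bsub>\<beta>,\<alpha>\<^esub>\<close>, with sign \<open>(-1)\<^sup>p\<close>, if \<open>\<beta> \<succ> \<alpha>\<close>;
  see \<open>edge_op_wedge_down\<close> and \<open>edge_op_wedge_up\<close>.\<close>

definition edge_fun :: "((complex ^ 'n) set \<Rightarrow> (complex ^ 'n) set \<Rightarrow> 'n::finite polyfn) \<Rightarrow>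
    ((complex ^ 'n) set \<Rightarrow> (complex ^ 'n) set \<Rightarrow> complex ^ 'n) \<Rightarrow>
    (complex ^ 'n) set \<Rightarrow> (complex ^ 'n) set \<Rightarrow> (complex ^ 'n) \<times> 'n polyfn \<Rightarrow> complex"
  where "edge_fun fr xi \<beta> \<alpha> t =
    (if \<alpha> \<succ> \<beta> then pairing (fst t) (fr \<beta> \<alpha>) else pairing (xi \<beta> \<alpha>) (snd t))"

definition edge_op where
  "edge_op V A fr xi \<beta> \<alpha> = tensor_map (contract (edge_fun fr xi \<beta> \<alpha>))
    (tensor_map (lin_ext (top_forms \<alpha>) (form_map fr xi \<beta> \<alpha>)) (lin_ext (V \<alpha>) (A \<beta> \<alpha>)))"

definition d0 :: "(complex ^ 'n) set set \<Rightarrow> ((complex ^ 'n) set \<Rightarrow> 'v::complex_vector set) \<Rightarrow>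
    ((complex ^ 'n) set \<Rightarrow> (complex ^ 'n) set \<Rightarrow> 'v \<Rightarrow> 'v) \<Rightarrow>
    ((complex ^ 'n) set \<Rightarrow> (complex ^ 'n) set \<Rightarrow> 'n::finite polyfn) \<Rightarrow>
    ((complex ^ 'n) set \<Rightarrow> (complex ^ 'n) set \<Rightarrow> complex ^ 'n) \<Rightarrow>
    ('n, 'v) chain \<Rightarrow> ('n, 'v) chain"
  where "d0 \<C> V A fr xi x = (\<lambda>\<beta>. if \<beta> \<in> flats \<C>
    then \<Sum>\<alpha> | \<alpha> \<in> flats \<C> \<and> adjacent \<beta> \<alpha>. tensor_map (\<lambda>P. P) (edge_op V A fr xi \<beta> \<alpha>) (x \<alpha>)
    else 0)"

definition differential :: "(complex ^ 'n) set set \<Rightarrow> ((complex ^ 'n) set \<Rightarrow> 'v::complex_vector set) \<Rightarrow>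
    ((complex ^ 'n) set \<Rightarrow> (complex ^ 'n) set \<Rightarrow> 'v \<Rightarrow> 'v) \<Rightarrow>
    ((complex ^ 'n) set \<Rightarrow> (complex ^ 'n) set \<Rightarrow> 'n::finite polyfn) \<Rightarrow>
    ((complex ^ 'n) set \<Rightarrow> (complex ^ 'n) set \<Rightarrow> complex ^ 'n) \<Rightarrow>
    ('n, 'v) chain \<Rightarrow> ('n, 'v) chain"
  where "differential \<C> V A fr xi x = d1 x - d0 \<C> V A fr xi x"


section \<open>The module of a quiver\<close>

definition weyl_submodule :: "('n::finite, 'v::complex_vector) chain set \<Rightarrow> bool"
  where "weyl_submodule M \<longleftrightarrow>
    0 \<in> M \<and> (\<forall>x\<in>M. \<forall>y\<in>M. x + y \<in> M) \<and> (\<forall>P. \<forall>x\<in>M. weyl_act P x \<in> M)"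

text \<open>\<open>chains \<C> V 0\<close> is the free module \<open>D\<^sub>X \<otimes> \<Oplus>\<^sub>\<alpha> \<Omega>\<^sub>\<alpha> \<otimes> V\<^sub>\<alpha>\<close>, as the exterior power of degree \<open>0\<close> is
  \<open>\<complex>\<close>, spanned by \<open>wedge []\<close>.\<close>

definition relations where
  "relations \<C> V A fr xi =
    {pure \<alpha> (weyl_deriv \<xi>) [] \<omega> v
      - (\<Sum>\<beta> | \<beta> \<in> flats \<C> \<and> \<alpha> \<succ> \<beta>.
          pairing \<xi> (fr \<beta> \<alpha>) *\<^sub>C pure \<beta> 1 [] (form_map fr xi \<beta> \<alpha> \<omega>) (A \<beta> \<alpha> v))
      | \<alpha> \<xi> \<omega> v. \<alpha> \<in> flats \<C> \<and> \<xi> \<in> tangent \<alpha> \<and> \<omega> \<in> top_forms \<alpha> \<and> v \<in> V \<alpha>} \<union>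
    {pure \<alpha> (weyl_mult f) [] \<omega> v
      - (\<Sum>\<beta> | \<beta> \<in> flats \<C> \<and> \<beta> \<succ> \<alpha>.
          pairing (xi \<beta> \<alpha>) f *\<^sub>C pure \<beta> 1 [] (form_map fr xi \<beta> \<alpha> \<omega>) (A \<beta> \<alpha> v))
      | \<alpha> f \<omega> v. \<alpha> \<in> flats \<C> \<and> f \<in> vanishing \<C> \<alpha> \<and> \<omega> \<in> top_forms \<alpha> \<and> v \<in> V \<alpha>}"

definition E_class where
  "E_class \<C> V A fr xi x = {y. y - x \<in> weyl_submodule hull relations \<C> V A fr xi}"

definition E_module where
  "E_module \<C> V A fr xi = E_class \<C> V A fr xi ` chains \<C> V 0"


section \<open>The defining formulas\<close>

text \<open>The rest of the theory shows that the maps above are well defined and given by the intended formulas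
  on generators: \<open>form_map_iff\<close>, \<open>d1_pure\<close>, \<open>d0_pure\<close>, \<open>edge_op_wedge_down\<close>, \<open>edge_op_wedge_up\<close>, and
  \<open>d1_weyl_act\<close>, \<open>d0_weyl_act\<close> for linearity over \<open>D\<^sub>X\<close>.\<close>

subsection \<open>Generators and \<open>d1\<close>\<close>

lemma tensor_span: "x \<in> cspan {a \<otimes> b | a b. True}"
proof -
  have *: "abs_tensor p \<in> cspan {a \<otimes> b | a b. True}" for p :: "'a \<times> 'b \<Rightarrow>\<^sub>0 complex"
    using free_span[of p]
  proof (induction rule: complex_vector.span_induct_alt)
    case base
    show ?case using complex_vector.span_zero by (metis zero_tensor.abs_eq)
  next
    case (step c x y)
    then obtain a b where "x = Poly_Mapping.single (a, b) 1" by auto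
    then have "abs_tensor (c *\<^sub>C x + y) = c *\<^sub>C (a \<otimes> b) + abs_tensor y"
      by (simp add: tensor_def flip: plus_tensor.abs_eq scaleC_tensor.abs_eq)
    moreover have "c *\<^sub>C (a \<otimes> b) \<in> cspan {a \<otimes> b | a b. True}"
      by (rule complex_vector.span_scale, rule complex_vector.span_base) auto
    ultimately show ?case using step by (simp add: complex_vector.span_add)
  qed
  show ?thesis by (metis * Quotient3_abs_rep[OF Quotient3_tensor])
qed

lemma ext_span: "x \<in> cspan (range wedge)"
proof -
  have *: "abs_ext p \<in> cspan (range wedge)" for p :: "'a list \<Rightarrow>\<^sub>0 complex"
    using free_span[of p]
  proof (induction rule: complex_vector.span_induct_alt)
    case base
    show ?case using complex_vector.span_zero by (metis zero_ext.abs_eq)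
  next
    case (step c x y)
    then obtain ts where "x = Poly_Mapping.single ts 1" by auto
    then have "abs_ext (c *\<^sub>C x + y) = c *\<^sub>C wedge ts + abs_ext y"
      by (simp add: wedge_def flip: plus_ext.abs_eq scaleC_ext.abs_eq)
    moreover have "c *\<^sub>C wedge ts \<in> cspan (range wedge)"
      by (rule complex_vector.span_scale, rule complex_vector.span_base) auto
    ultimately show ?case using step by (simp add: complex_vector.span_add)
  qed
  show ?thesis by (metis * Quotient3_abs_rep[OF Quotient3_ext])
qed

lemma clinear_eq_on_span:
  assumes "clinear f" "clinear g" "\<And>x. x \<in> S \<Longrightarrow> f x = g x" "x \<in> cspan S"
  shows "f x = g x"
  using assms(4)
  by (induction rule: complex_vector.span_induct_alt)
    (simp_all add: assms(3) clinear_0[OF assms(1)] clinear_0[OF assms(2)]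
      clinear_add[OF assms(1)] clinear_add[OF assms(2)]
      clinear_scale[OF assms(1)] clinear_scale[OF assms(2)])

lemma tensor_eqI:
  assumes "clinear f" "clinear g" "\<And>a b. f (a \<otimes> b) = g (a \<otimes> b)"
  shows "f x = g x"
  using assms(1,2) _ tensor_span by (rule clinear_eq_on_span) (use assms(3) in auto)

lemma ext_eqI:
  assumes "clinear f" "clinear g" "\<And>ts. f (wedge ts) = g (wedge ts)"
  shows "f x = g x"
  using assms(1,2) _ ext_span by (rule clinear_eq_on_span) (use assms(3) in auto)

lemma clinear_plus: "clinear f \<Longrightarrow> clinear g \<Longrightarrow> clinear (\<lambda>x. f x + g x)"
  by (rule clinearI) (simp_all add: clinear_add[of f] clinear_add[of g] clinear_scale[of f]
      clinear_scale[of g] scaleC_add_right add_ac)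

lemma clinear_scaled: "clinear f \<Longrightarrow> clinear (\<lambda>x. c *\<^sub>C f x)"
  by (rule clinearI) (simp_all add: clinear_add[of f] clinear_scale[of f]
      scaleC_add_right scaleC_scaleC mult.commute)

lemma clinear_compose: "clinear f \<Longrightarrow> clinear g \<Longrightarrow> clinear (\<lambda>x. f (g x))"
  by (rule clinearI) (simp_all add: clinear_add[of f] clinear_add[of g] clinear_scale[of f]
      clinear_scale[of g])

lemma clinear_weyl_times: "clinear (\<lambda>Q. P * Q)" for P :: "'n::finite weyl"
  by (rule clinearI) (simp_all add: distrib_left weyl_scale_mult)

lemma clinear_id': "clinear (\<lambda>x. x)"
  by (rule clinearI) simp_all

lemma tensor_zero: "0 \<otimes> b = 0" "a \<otimes> 0 = 0"
  using tensor_bilinear(3)[of 0 0 b] tensor_bilinear(4)[of a 0 0] by simp_all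

lemma alternating_d1:
  "alternating_on UNIV (alt_sum (\<lambda>t us. (P * weyl_embed t) \<otimes> wedge us \<otimes> u))"
proof (rule alternating_alt_sum)
  fix us :: "((complex ^ 'a) \<times> 'a polyfn) list"
  show "clinear_on UNIV (\<lambda>t. (P * weyl_embed t) \<otimes> wedge us \<otimes> u)"
    by (simp add: clinear_on_def clinear_add[OF clinear_weyl_embed]
        clinear_scale[OF clinear_weyl_embed] distrib_left weyl_scale_mult tensor_bilinear)
next
  fix t :: "(complex ^ 'a) \<times> 'a polyfn"
  show "alternating_on UNIV (\<lambda>us. (P * weyl_embed t) \<otimes> wedge us \<otimes> u)"
    by (simp add: alternating_on_def clinear_on_def wedge_add wedge_scale wedge_eq_0
        tensor_bilinear tensor_zero del: split_paired_All)
qed simp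

definition d1_ext where
  "d1_ext P e u = ext_lift (alt_sum (\<lambda>t us. (P * weyl_embed t) \<otimes> wedge us \<otimes> u)) e"

lemma clinear_d1_ext: "clinear (\<lambda>e. d1_ext P e u)"
  unfolding d1_ext_def by (rule clinear_ext_lift[OF alternating_d1])

lemma d1_ext_wedge: "d1_ext P (wedge ts) u =
    (\<Sum>i<length ts. (- 1) ^ i *\<^sub>C ((P * weyl_embed (ts ! i)) \<otimes> wedge (drop_nth i ts) \<otimes> u))"
  unfolding d1_ext_def by (simp add: ext_lift_wedge[OF alternating_d1] alt_sum_def)

lemma d1_ext_linear_u: "clinear (d1_ext P e)"
proof (rule clinearI)
  fix u u' and c
  show "d1_ext P e (u + u') = d1_ext P e u + d1_ext P e u'"
    by (rule ext_eqI[of "\<lambda>e. d1_ext P e (u + u')" "\<lambda>e. d1_ext P e u + d1_ext P e u'"])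
      (simp_all add: clinear_plus clinear_d1_ext d1_ext_wedge tensor_bilinear scaleC_add_right sum.distrib)
  show "d1_ext P e (c *\<^sub>C u) = c *\<^sub>C d1_ext P e u"
    by (rule ext_eqI[of "\<lambda>e. d1_ext P e (c *\<^sub>C u)" "\<lambda>e. c *\<^sub>C d1_ext P e u"])
      (simp_all add: clinear_scaled clinear_d1_ext d1_ext_wedge tensor_bilinear
        complex_vector.scale_sum_right scaleC_scaleC mult.commute)
qed

lemma bilin_d1_ext: "bilin (d1_ext P)"
  by (simp add: bilin_def clinear_d1_ext d1_ext_linear_u)

lemma d1_ext_linear_P:
  "d1_ext (P + Q) e u = d1_ext P e u + d1_ext Q e u" "d1_ext (c *\<^sub>C P) e u = c *\<^sub>C d1_ext P e u"
  by (rule ext_eqI[of "\<lambda>e. d1_ext (P + Q) e u" "\<lambda>e. d1_ext P e u + d1_ext Q e u"];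
      simp add: clinear_plus clinear_d1_ext d1_ext_wedge tensor_bilinear distrib_right scaleC_add_right sum.distrib)
    (rule ext_eqI[of "\<lambda>e. d1_ext (c *\<^sub>C P) e u" "\<lambda>e. c *\<^sub>C d1_ext P e u"];
      simp add: clinear_scaled clinear_d1_ext d1_ext_wedge tensor_bilinear weyl_scale_mult
        complex_vector.scale_sum_right scaleC_scaleC mult.commute)

lemma bilin_d1: "bilin (\<lambda>P. tensor_lift (d1_ext P))"
  unfolding bilin_def
proof (intro conjI allI clinearI)
  fix P Q :: "'a weyl" and m :: "(((complex ^ 'a) \<times> 'a polyfn) ext, 'b) tensor" and c
  note L = clinear_tensor_lift[OF bilin_d1_ext]
  show "tensor_lift (d1_ext (P + Q)) m = tensor_lift (d1_ext P) m + tensor_lift (d1_ext Q) m"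
  proof (rule tensor_eqI[of _ "\<lambda>m. tensor_lift (d1_ext P) m + tensor_lift (d1_ext Q) m"])
    show "tensor_lift (d1_ext (P + Q)) (e \<otimes> u) =
        tensor_lift (d1_ext P) (e \<otimes> u) + tensor_lift (d1_ext Q) (e \<otimes> u)" for e and u :: 'b
      unfolding tensor_lift_tensor[OF bilin_d1_ext] by (rule d1_ext_linear_P)
  qed (intro clinear_plus L)+
  show "tensor_lift (d1_ext (c *\<^sub>C P)) m = c *\<^sub>C tensor_lift (d1_ext P) m"
  proof (rule tensor_eqI[of _ "\<lambda>m. c *\<^sub>C tensor_lift (d1_ext P) m"])
    show "tensor_lift (d1_ext (c *\<^sub>C P)) (e \<otimes> u) = c *\<^sub>C tensor_lift (d1_ext P) (e \<otimes> u)"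
      for e and u :: 'b
      unfolding tensor_lift_tensor[OF bilin_d1_ext] by (rule d1_ext_linear_P)
  qed (intro clinear_scaled L)+
qed (simp_all add: clinear_add[OF clinear_tensor_lift[OF bilin_d1_ext]]
    clinear_scale[OF clinear_tensor_lift[OF bilin_d1_ext]])

lemma d1_alt: "d1 x = (\<lambda>\<alpha>. tensor_lift (\<lambda>P. tensor_lift (d1_ext P)) (x \<alpha>))"
  unfolding d1_def d1_ext_def[abs_def] ..

lemma clinear_d1: "clinear d1"
  by (rule clinearI) (simp_all add: d1_alt fun_eq_iff clinear_add[OF clinear_tensor_lift[OF bilin_d1]]
      clinear_scale[OF clinear_tensor_lift[OF bilin_d1]] scaleC_fun_def)

lemma sum_fun_apply: "sum f A x = (\<Sum>i\<in>A. f i x)"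
  by (induction A rule: infinite_finite_induct) simp_all

lemma d1_pure: "d1 (pure \<alpha> P ts \<omega> v) =
    (\<Sum>i<length ts. (- 1) ^ i *\<^sub>C pure \<alpha> (P * weyl_embed (ts ! i)) (drop_nth i ts) \<omega> v)"
proof
  fix \<gamma>
  show "d1 (pure \<alpha> P ts \<omega> v) \<gamma> =
    (\<Sum>i<length ts. (- 1) ^ i *\<^sub>C pure \<alpha> (P * weyl_embed (ts ! i)) (drop_nth i ts) \<omega> v) \<gamma>"
    by (cases "\<gamma> = \<alpha>") (simp_all add: d1_alt pure_def sum_fun_apply scaleC_fun_def
        tensor_lift_tensor[OF bilin_d1] tensor_lift_tensor[OF bilin_d1_ext] d1_ext_wedge
        clinear_0[OF clinear_tensor_lift[OF bilin_d1]])
qed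

lemma clinear_weyl_act: "clinear (weyl_act P)"
  by (rule clinearI) (simp_all add: weyl_act_def fun_eq_iff scaleC_fun_def
      clinear_add[OF clinear_tensor_map[OF clinear_weyl_times clinear_id']]
      clinear_scale[OF clinear_tensor_map[OF clinear_weyl_times clinear_id']])

lemma weyl_act_pure: "weyl_act P (pure \<alpha> Q ts \<omega> v) = pure \<alpha> (P * Q) ts \<omega> v"
  by (rule ext) (simp add: weyl_act_def pure_def tensor_map_tensor[OF clinear_weyl_times clinear_id']
      clinear_0[OF clinear_tensor_map[OF clinear_weyl_times clinear_id']])

lemma d1_weyl_act: "d1 (weyl_act P x) = weyl_act P (d1 x)"
proof
  fix \<alpha>
  let ?L = "tensor_lift (\<lambda>P. tensor_lift (d1_ext P))"
  let ?M = "tensor_map (\<lambda>Q. P * Q) (\<lambda>m. m)"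
  note L = clinear_tensor_lift[OF bilin_d1] and M = clinear_tensor_map[OF clinear_weyl_times clinear_id']
  note Lt = tensor_lift_tensor[OF bilin_d1] and Mt = tensor_map_tensor[OF clinear_weyl_times clinear_id']
  have "?L (?M y) = ?M (?L y)"
    for y :: "('a weyl, (((complex ^ 'a) \<times> 'a polyfn) ext, ((complex ^ 'a) list \<Rightarrow> complex, 'b) tensor) tensor) tensor"
  proof (rule tensor_eqI[of "\<lambda>y. ?L (?M y)" "\<lambda>y. ?M (?L y)"])
    fix Q and m :: "(((complex ^ 'a) \<times> 'a polyfn) ext, ((complex ^ 'a) list \<Rightarrow> complex, 'b) tensor) tensor"
    have "tensor_lift (d1_ext (P * Q)) m = ?M (tensor_lift (d1_ext Q) m)"
    proof (rule tensor_eqI[of "tensor_lift (d1_ext (P * Q))" "\<lambda>m. ?M (tensor_lift (d1_ext Q) m)"])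
      fix e and u :: "((complex, 'a) vec list \<Rightarrow> complex, 'b) tensor"
      have "d1_ext (P * Q) e u = ?M (d1_ext Q e u)"
        by (rule ext_eqI[of "\<lambda>e. d1_ext (P * Q) e u" "\<lambda>e. ?M (d1_ext Q e u)"])
          (simp_all add: clinear_d1_ext clinear_compose[OF M clinear_d1_ext] d1_ext_wedge
            clinear_sum[OF M] clinear_scale[OF M] Mt mult.assoc)
      then show "tensor_lift (d1_ext (P * Q)) (e \<otimes> u) = ?M (tensor_lift (d1_ext Q) (e \<otimes> u))"
        by (simp add: tensor_lift_tensor[OF bilin_d1_ext])
    qed (rule clinear_tensor_lift[OF bilin_d1_ext],
        rule clinear_compose[OF M clinear_tensor_lift[OF bilin_d1_ext]])
    then show "?L (?M (Q \<otimes> m)) = ?M (?L (Q \<otimes> m))" by (simp add: Lt Mt)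
  qed (rule clinear_compose[OF L M], rule clinear_compose[OF M L])
  then show "d1 (weyl_act P x) \<alpha> = weyl_act P (d1 x) \<alpha>" by (simp add: d1_alt weyl_act_def)
qed

subsection \<open>Flats\<close>

lemma scaleC_vec_fun: "scaleC = ((*s) :: complex \<Rightarrow> complex ^ 'n \<Rightarrow> complex ^ 'n)"
  by (rule ext)+ (rule scaleC_vec_eq)

lemma cspan_vec: "cspan = (vec.span :: (complex ^ 'n) set \<Rightarrow> (complex ^ 'n) set)"
  by (simp only: scaleC_vec_fun)

lemma csubspace_vec: "csubspace S \<longleftrightarrow> vec.subspace S" for S :: "(complex ^ 'n) set"
  by (simp only: scaleC_vec_fun)

definition dot :: "complex ^ 'n \<Rightarrow> complex ^ 'n \<Rightarrow> complex"
  where "dot a x = (\<Sum>i\<in>UNIV. a $ i * x $ i)"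

lemma dot_simps: "dot a (x + y) = dot a x + dot a y" "dot a (x - y) = dot a x - dot a y"
  "dot a (c *s x) = c * dot a x"
  by (simp_all add: dot_def sum.distrib sum_subtractf algebra_simps sum_distrib_left)

lemma flat_eqs:
  assumes "arrangement \<C>" "\<alpha> \<in> flats \<C>"
  shows "\<exists>L. \<forall>x. x \<in> \<alpha> \<longleftrightarrow> (\<forall>l\<in>L. dot (fst l) x = snd l)"
proof -
  obtain S where S: "S \<subseteq> \<C>" "\<alpha> = \<Inter>S" "\<alpha> \<noteq> {}" using assms(2) by (auto simp: flats_def)
  let ?L = "{l. {x. dot (fst l) x = snd l} \<in> S}"
  have "\<exists>a b. H = {x. dot a x = b}" if "H \<in> S" for H
    using assms(1) S(1) that unfolding arrangement_def hyperplane_def dot_def by blast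
  then have "x \<in> \<alpha> \<longleftrightarrow> (\<forall>l\<in>?L. dot (fst l) x = snd l)" for x unfolding S(2) by fastforce
  then show ?thesis by blast
qed

lemma flat_line:
  assumes "arrangement \<C>" "\<alpha> \<in> flats \<C>" "x \<in> \<alpha>" "y \<in> \<alpha>"
  shows "x + t *s (y - x) \<in> \<alpha>"
proof -
  obtain L where L: "\<And>x. x \<in> \<alpha> \<longleftrightarrow> (\<forall>l\<in>L. dot (fst l) x = snd l)"
    using flat_eqs[OF assms(1,2)] by metis
  show ?thesis using assms(3,4) unfolding L by (simp add: dot_simps)
qed

lemma tangent_iff:
  assumes "arrangement \<C>" "\<alpha> \<in> flats \<C>" "x \<in> \<alpha>"
  shows "v \<in> tangent \<alpha> \<longleftrightarrow> x + v \<in> \<alpha>"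
proof -
  obtain L where L: "\<And>x. x \<in> \<alpha> \<longleftrightarrow> (\<forall>l\<in>L. dot (fst l) x = snd l)"
    using flat_eqs[OF assms(1,2)] by metis
  show ?thesis using assms(3) unfolding tangent_def mem_Collect_eq Ball_def[of \<alpha>] L
    by (auto simp: dot_simps)
qed

lemma csubspace_tangent:
  assumes "arrangement \<C>" "\<alpha> \<in> flats \<C>"
  shows "csubspace (tangent \<alpha>)"
proof -
  obtain L where L: "\<And>x. x \<in> \<alpha> \<longleftrightarrow> (\<forall>l\<in>L. dot (fst l) x = snd l)"
    using flat_eqs[OF assms] by metis
  obtain x where x: "x \<in> \<alpha>" using assms(2) by (auto simp: flats_def)
  have v: "v \<in> tangent \<alpha> \<longleftrightarrow> (\<forall>l\<in>L. dot (fst l) v = 0)" for v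
    using x unfolding tangent_iff[OF assms x] L by (simp add: dot_simps)
  have "dot a 0 = 0" for a :: "complex ^ 'a" by (simp add: dot_def)
  then show ?thesis
    by (simp add: csubspace_vec vec.subspace_def v dot_simps)
qed

lemma tangent_mono:
  assumes "arrangement \<C>" "\<alpha> \<in> flats \<C>" "\<beta> \<in> flats \<C>" "\<beta> \<subseteq> \<alpha>"
  shows "tangent \<beta> \<subseteq> tangent \<alpha>"
proof
  fix v assume v: "v \<in> tangent \<beta>"
  obtain x where "x \<in> \<beta>" using assms(3) by (auto simp: flats_def)
  then have "x \<in> \<alpha>" "x + v \<in> \<alpha>" using v assms(4) by (auto simp: tangent_def)
  then show "v \<in> tangent \<alpha>" by (simp add: tangent_iff[OF assms(1,2)])
qed

lemma finite_flats: "arrangement \<C> \<Longrightarrow> finite (flats \<C>)"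
  by (simp add: arrangement_def flats_def full_SetCompr_eq setcompr_eq_image flip: Pow_def)

lemma flat_line_finite:
  assumes "arrangement \<C>" "\<gamma> \<in> flats \<C>" "x \<notin> \<gamma> \<or> y \<notin> \<gamma>"
  shows "finite {t. x + t *s (y - x) \<in> \<gamma>}"
proof (rule ccontr)
  let ?p = "\<lambda>t. x + t *s (y - x)"
  assume inf: "infinite {t. ?p t \<in> \<gamma>}"
  then obtain t where t: "?p t \<in> \<gamma>" by (metis (mono_tags) empty_Collect_eq finite.emptyI)
  have "infinite ({t. ?p t \<in> \<gamma>} - {t})" using inf by simp
  then obtain s where s: "?p s \<in> \<gamma>" "s \<noteq> t"
    by (metis (mono_tags, lifting) DiffE finite.emptyI insertCI mem_Collect_eq ex_in_conv)
  have "?p u \<in> \<gamma>" for u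
  proof -
    have "x + t *s w + ((u - t) / (s - t)) *s ((x + s *s w) - (x + t *s w)) = x + u *s w" for w
    proof -
      have "(u - t) / (s - t) * s * z - (u - t) / (s - t) * t * z = u * z - t * z" for z
      proof -
        have "(u - t) / (s - t) * (s - t) = u - t" using s(2) by simp
        then show ?thesis by (simp only: flip: left_diff_distrib right_diff_distrib)
      qed
      then show ?thesis by (simp add: vec_eq_iff del: times_divide_eq_left)
    qed
    then show ?thesis using flat_line[OF assms(1,2) t s(1)] by metis
  qed
  from this[of 0] this[of 1] assms(3) show False by simp
qed

lemma stratum_nonempty:
  assumes "arrangement \<C>" "\<alpha> \<in> flats \<C>"
  shows "stratum \<C> \<alpha> \<noteq> {}"
proof -
  have "\<exists>x\<in>\<alpha>. x \<notin> \<Union>F" if "finite F" "F \<subseteq> {\<beta> \<in> flats \<C>. \<beta> \<subset> \<alpha>}" for F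
    using that
  proof (induction F)
    case empty
    then show ?case using assms(2) by (auto simp: flats_def)
  next
    case (insert B F)
    then obtain x where x: "x \<in> \<alpha>" "x \<notin> \<Union>F" by auto
    obtain y where y: "y \<in> \<alpha>" "y \<notin> B" using insert by auto
    have "finite (\<Union>\<gamma>\<in>insert B F. {t. x + t *s (y - x) \<in> \<gamma>})"
      using insert x y by (intro finite_UN_I flat_line_finite[OF assms(1)]) auto
    then obtain t where "t \<notin> (\<Union>\<gamma>\<in>insert B F. {t. x + t *s (y - x) \<in> \<gamma>})"
      by (meson ex_new_if_finite infinite_UNIV_char_0)
    then show ?case using flat_line[OF assms x(1) y(1), of t] by blast
  qed
  from this[of "{\<beta> \<in> flats \<C>. \<beta> \<subset> \<alpha>}"] show ?thesis
    using finite_flats[OF assms(1)] by (auto simp: stratum_def)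
qed

lemma pairing_affine:
  assumes "affine_fn f"
  shows "peval f (x + v) = peval f x + pairing v f"
proof -
  obtain a c where f: "\<And>x. peval f x = dot a x + c"
    using assms by (auto simp: affine_fn_def dot_def)
  have "((\<lambda>t. peval f (0 + t *s v)) has_field_derivative dot a v) (at 0)"
    by (auto simp: f dot_simps intro!: derivative_eq_intros)
  then have "pairing v f = dot a v"
    unfolding pairing_def using DERIV_unique[OF peval_vderiv] by blast
  then show ?thesis by (simp add: f dot_simps)
qed

lemma vanishing_flat:
  assumes "arrangement \<C>" "\<alpha> \<in> flats \<C>" "f \<in> vanishing \<C> \<alpha>" "y \<in> \<alpha>"
  shows "peval f y = 0"
proof -
  obtain x where x: "x \<in> stratum \<C> \<alpha>" using stratum_nonempty[OF assms(1,2)] by blast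
  let ?p = "\<lambda>t. x + t *s (y - x)" and ?F = "{\<beta> \<in> flats \<C>. \<beta> \<subset> \<alpha>}"
  have "finite (insert 0 (\<Union>\<gamma>\<in>?F. {t. ?p t \<in> \<gamma>}))"
    using x finite_flats[OF assms(1)]
    by (intro finite.insertI finite_UN_I flat_line_finite[OF assms(1)]) (auto simp: stratum_def)
  then obtain t where t: "t \<notin> insert 0 (\<Union>\<gamma>\<in>?F. {t. ?p t \<in> \<gamma>})"
    by (meson ex_new_if_finite infinite_UNIV_char_0)
  have "?p t \<in> \<alpha>" using flat_line[OF assms(1,2) _ assms(4)] x by (auto simp: stratum_def)
  then have "?p t \<in> stratum \<C> \<alpha>" using t by (auto simp: stratum_def)
  then have "peval f (?p t) = 0" "peval f x = 0" "affine_fn f"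
    using assms(3) x by (auto simp: vanishing_def)
  then have "pairing (t *s (y - x)) f = 0" using pairing_affine by fastforce
  then have "t * pairing (y - x) f = 0"
    using clinear_scale[OF clinear_vderiv_dir, of t "y - x" f]
    by (simp add: pairing_def scaleC_vec_eq scaleC_polyfn.rep_eq)
  then have "pairing (y - x) f = 0" using t by simp
  then show ?thesis
    using pairing_affine[OF \<open>affine_fn f\<close>, of x "y - x"] \<open>peval f x = 0\<close> by simp
qed

lemma clinear_pairing: "clinear (\<lambda>\<xi>. pairing \<xi> f)" "clinear (pairing \<xi>)"
  by (rule clinearI; simp add: pairing_def clinear_add[OF clinear_vderiv_dir]
      clinear_scale[OF clinear_vderiv_dir] plus_polyfn.rep_eq scaleC_polyfn.rep_eq scaleC_complex_def
      clinear_add[OF clinear_vderiv] clinear_scale[OF clinear_vderiv])+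

lemma pairing_tangent:
  assumes "arrangement \<C>" "\<alpha> \<in> flats \<C>" "f \<in> vanishing \<C> \<alpha>" "\<xi> \<in> tangent \<alpha>"
  shows "pairing \<xi> f = 0"
proof -
  obtain x where x: "x \<in> \<alpha>" using assms(2) by (auto simp: flats_def)
  then have "x + \<xi> \<in> \<alpha>" using assms(4) by (auto simp: tangent_def)
  then show ?thesis
    using pairing_affine[of f x \<xi>] assms x vanishing_flat[OF assms(1-3)]
    by (auto simp: vanishing_def)
qed

lemma pairing_edge:
  assumes "arrangement \<C>" "\<alpha> \<in> flats \<C>" "\<beta> \<in> flats \<C>" "\<beta> \<subseteq> \<alpha>"
    and "f \<in> vanishing \<C> \<beta> - vanishing \<C> \<alpha>"
  obtains e where "e \<in> tangent \<alpha>" "pairing e f = 1"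
proof -
  have aff: "affine_fn f" using assms(5) by (auto simp: vanishing_def)
  obtain y where y: "y \<in> \<alpha>" "peval f y \<noteq> 0"
    using assms(5) by (auto simp: vanishing_def stratum_def)
  obtain x where x: "x \<in> \<beta>" using assms(3) by (auto simp: flats_def)
  have "peval f x = 0" using vanishing_flat[OF assms(1,3) _ x] assms(5) by blast
  then have nz: "pairing (y - x) f \<noteq> 0" using pairing_affine[OF aff, of x "y - x"] y by simp
  have "y - x \<in> tangent \<alpha>"
    using tangent_iff[OF assms(1,2), of x] x y assms(4) by auto
  then have "(1 / pairing (y - x) f) *\<^sub>C (y - x) \<in> tangent \<alpha>"
    using csubspace_tangent[OF assms(1,2)] by (simp add: complex_vector.subspace_scale)
  moreover have "pairing ((1 / pairing (y - x) f) *\<^sub>C (y - x)) f = 1"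
    using nz by (simp add: clinear_scale[OF clinear_pairing(1)] scaleC_complex_def)
  ultimately show ?thesis using that by blast
qed


subsection \<open>Top forms\<close>

lemma csubspace_forms: "csubspace (forms k S)"
  by (auto simp: complex_vector.subspace_def forms_def alternating_on_def clinear_on_def
      scaleC_fun_def scaleC_complex_def algebra_simps)

lemma alternating_vanish:
  fixes S :: "(complex ^ 'n) set"
  assumes h: "alternating_on S h" and S: "csubspace S"
    and vs: "set vs \<subseteq> S" "length vs > vec.dim S"
  shows "h vs = 0"
proof (cases "distinct vs")
  case False
  then show ?thesis using h vs unfolding alternating_on_def by blast
next
  case True
  have "vec.dependent (set vs)"
    using vec.independent_card_le_dim[OF vs(1)] vs(2) distinct_card[OF True] by fastforce
  then obtain v where v: "v \<in> set vs" "v \<in> cspan (set vs - {v})"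
    unfolding vec.dependent_def by (simp only: cspan_vec) blast
  then obtain us ws where uw: "vs = us @ v # ws" by (meson split_list)
  then have D: "set vs - {v} = set us \<union> set ws" using True by auto
  have lin: "clinear_on S (\<lambda>x. h (us @ x # ws))"
    using h vs(1) uw unfolding alternating_on_def by auto
  have "x \<in> S \<and> h (us @ x # ws) = 0" if "x \<in> cspan (set us \<union> set ws)" for x
    using that
  proof (induction rule: complex_vector.span_induct_alt)
    case base
    have "h (us @ (0 *\<^sub>C v) # ws) = 0 *\<^sub>C h (us @ v # ws)"
      using lin v vs unfolding clinear_on_def by blast
    then show ?case using S by (simp add: complex_vector.subspace_0)
  next
    case (step c x y)
    have x: "x \<in> S" "c *\<^sub>C x \<in> S" using step vs uw S
      by (auto simp: complex_vector.subspace_scale)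
    have "h (us @ x # ws) = 0"
    proof -
      have "\<not> distinct (us @ x # ws)" using step(1) by auto
      moreover have "set (us @ x # ws) \<subseteq> S" using x vs uw by auto
      ultimately show ?thesis using h unfolding alternating_on_def by blast
    qed
    moreover have "h (us @ (c *\<^sub>C x + y) # ws) = h (us @ (c *\<^sub>C x) # ws) + h (us @ y # ws)"
      "h (us @ (c *\<^sub>C x) # ws) = c *\<^sub>C h (us @ x # ws)"
      using lin x conjunct1[OF step(2)] unfolding clinear_on_def by simp_all
    ultimately show ?case
      using step(2) x complex_vector.subspace_add[OF S x(2)] by simp
  qed
  then show ?thesis using v D uw by auto
qed

lemma alt_sum_Cons: "alt_sum B (e # vs) = B e vs - alt_sum (\<lambda>v us. B v (e # us)) vs"
  by (simp add: alt_sum_def drop_nth_def sum.lessThan_Suc_shift scaleC_one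
      complex_vector.scale_minus_left sum_negf del: sum.lessThan_Suc)

lemma alt_sum_eq_0: "(\<And>i. i < length vs \<Longrightarrow> B (vs ! i) (drop_nth i vs) = 0) \<Longrightarrow> alt_sum B vs = 0"
  by (simp add: alt_sum_def)

lemma alt_sum_cong:
  "(\<And>i. i < length vs \<Longrightarrow> B (vs ! i) (drop_nth i vs) = C (vs ! i) (drop_nth i vs)) \<Longrightarrow>
    alt_sum B vs = alt_sum C vs"
  by (simp add: alt_sum_def)

lemma set_drop_nth: "set (drop_nth i vs) \<subseteq> set vs"
  by (auto simp: drop_nth_def dest: in_set_takeD in_set_dropD)

lemma length_drop_nth: "i < length vs \<Longrightarrow> length (drop_nth i vs) = length vs - 1"
  by (auto simp: drop_nth_def)

lemma alternating_wedge_functional: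
  fixes \<omega> :: "'a::complex_vector list \<Rightarrow> complex"
  assumes "csubspace S" "clinear lam" "alternating_on S \<omega>"
  shows "alternating_on S (alt_sum (\<lambda>v us. lam v * \<omega> us))"
proof (rule alternating_alt_sum[OF assms(1)])
  show "clinear_on S (\<lambda>x. lam x * \<omega> us)" for us
    by (simp add: clinear_on_def clinear_add[OF assms(2)] clinear_scale[OF assms(2)]
        scaleC_complex_def algebra_simps)
  show "alternating_on S (\<lambda>us. lam v * \<omega> us)" for v
    using assms(3) by (auto simp: alternating_on_def clinear_on_def scaleC_complex_def algebra_simps)
qed

lemma top_form_expand:
  fixes S :: "(complex ^ 'n) set"
  assumes "csubspace S" "\<omega> \<in> forms (vec.dim S) S" "clinear lam" "e \<in> S" "lam e = 1"
    and "set vs \<subseteq> S" "length vs = vec.dim S"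
  shows "\<omega> vs = alt_sum (\<lambda>v us. lam v * \<omega> (e # us)) vs"
proof -
  have "alt_sum (\<lambda>v us. lam v * \<omega> us) (e # vs) = 0"
    by (rule alternating_vanish[OF alternating_wedge_functional[OF assms(1,3)] assms(1)])
      (use assms in \<open>auto simp: forms_def\<close>)
  then show ?thesis by (simp add: alt_sum_Cons assms(5))
qed

lemma form_rel_down:
  assumes "arrangement \<C>" "edge_framing \<C> fr xi" "\<alpha> \<in> flats \<C>" "\<beta> \<in> flats \<C>" "\<alpha> \<succ> \<beta>"
  obtains e where "\<And>\<omega> \<omega>'. \<omega> \<in> top_forms \<alpha> \<Longrightarrow> form_rel fr xi \<beta> \<alpha> \<omega> \<omega>' \<longleftrightarrow>
    \<omega>' = (\<lambda>us. if set us \<subseteq> tangent \<beta> then \<omega> (e # us) else 0)"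
proof -
  let ?f = "fr \<beta> \<alpha>" and ?S = "tangent \<alpha>" and ?T = "tangent \<beta>"
  have sub: "\<beta> \<subseteq> \<alpha>" and dim: "vec.dim ?S = Suc (vec.dim ?T)" using assms(5) by (auto simp: covers_def)
  have f: "?f \<in> vanishing \<C> \<beta> - vanishing \<C> \<alpha>"
    using assms by (auto simp: edge_framing_def)
  obtain e where e: "e \<in> ?S" "pairing e ?f = 1" by (rule pairing_edge[OF assms(1,3,4) sub f])
  have S: "csubspace ?S" and T: "csubspace ?T" using csubspace_tangent assms by blast+
  have TS: "?T \<subseteq> ?S" by (rule tangent_mono[OF assms(1,3,4) sub])
  show ?thesis
  proof (rule that[of e])
    fix \<omega> \<omega>' assume \<omega>: "\<omega> \<in> top_forms \<alpha>"
    then have alt: "alternating_on ?S \<omega>" and \<omega>0: "\<And>vs. length vs \<noteq> vec.dim ?S \<Longrightarrow> \<omega> vs = 0"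
      "\<And>vs. \<not> set vs \<subseteq> ?S \<Longrightarrow> \<omega> vs = 0"
      by (auto simp: top_forms_def forms_def)
    have ealt: "alternating_on U (\<lambda>us. if set us \<subseteq> U then \<omega> (e # us) else 0)"
      if U: "U \<subseteq> ?S" "csubspace U" for U
      unfolding alternating_on_def
    proof (intro conjI allI impI; elim conjE)
      fix us ws assume uw: "set us \<subseteq> U" "set ws \<subseteq> U"
      have "set (e # us) \<subseteq> ?S" "set ws \<subseteq> ?S" using e(1) uw U(1) by auto
      then have "clinear_on ?S (\<lambda>x. \<omega> ((e # us) @ x # ws))"
        using alt unfolding alternating_on_def by blast
      moreover have "U \<subseteq> ?S" by (rule U(1))
      ultimately have "clinear_on U (\<lambda>x. \<omega> (e # us @ x # ws))"
        unfolding clinear_on_def append_Cons by (meson subsetD)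
      then show "clinear_on U (\<lambda>x. if set (us @ x # ws) \<subseteq> U then \<omega> (e # us @ x # ws) else 0)"
        using U(2) uw
        by (simp add: clinear_on_def complex_vector.subspace_add complex_vector.subspace_scale)
    next
      fix vs assume vs: "set vs \<subseteq> U" "\<not> distinct vs"
      then have "set (e # vs) \<subseteq> ?S" "\<not> distinct (e # vs)" using e(1) U(1) by auto
      then have "\<omega> (e # vs) = 0" using alt unfolding alternating_on_def by blast
      then show "(if set vs \<subseteq> U then \<omega> (e # vs) else 0) = 0" by simp
    qed
    let ?G = "\<lambda>us. if set us \<subseteq> ?T then \<omega> (e # us) else 0"
    let ?\<eta> = "\<lambda>us. if set us \<subseteq> ?S then \<omega> (e # us) else 0"
    have G: "?G \<in> top_forms \<beta>"
      using ealt[OF TS T] dim by (auto simp: top_forms_def forms_def \<omega>0)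
    have \<eta>: "?\<eta> \<in> forms (vec.dim ?T) ?S"
      using ealt[OF order_refl S] dim by (auto simp: forms_def \<omega>0)
    have "df_wedge ?S ?f ?\<eta> vs = \<omega> vs" for vs
    proof (cases "set vs \<subseteq> ?S \<and> length vs = vec.dim ?S")
      case True
      have "\<omega> vs = alt_sum (\<lambda>v us. pairing v ?f * \<omega> (e # us)) vs"
        by (rule top_form_expand[OF S _ clinear_pairing(1) e]) (use True \<omega> in \<open>auto simp: top_forms_def\<close>)
      also have "\<dots> = alt_sum (\<lambda>v us. pairing v ?f * ?\<eta> us) vs"
        by (rule alt_sum_cong) (use True set_drop_nth in fastforce)
      finally show ?thesis using True by (simp add: df_wedge_def)
    next
      case False
      then have "\<omega> vs = 0" using \<omega>0 by blast
      moreover have "alt_sum (\<lambda>v us. pairing v ?f * ?\<eta> us) vs = 0" if "set vs \<subseteq> ?S"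
      proof (rule alt_sum_eq_0)
        fix i assume "i < length vs"
        then have "length (e # drop_nth i vs) = length vs" by (simp add: length_drop_nth)
        then have "\<omega> (e # drop_nth i vs) = 0" using that False by (intro \<omega>0(1)) auto
        then show "pairing (vs ! i) ?f * ?\<eta> (drop_nth i vs) = 0" by simp
      qed
      ultimately show ?thesis by (simp add: df_wedge_def)
    qed
    then have rel: "form_rel fr xi \<beta> \<alpha> \<omega> ?G"
      unfolding form_rel_def using G \<eta> assms(5) TS by (auto intro!: bexI[OF _ \<eta>])
    show "form_rel fr xi \<beta> \<alpha> \<omega> \<omega>' \<longleftrightarrow> \<omega>' = ?G"
    proof
      assume "form_rel fr xi \<beta> \<alpha> \<omega> \<omega>'"
      then obtain \<eta> where \<omega>': "\<omega>' \<in> top_forms \<beta>" and \<eta>: "\<And>vs. set vs \<subseteq> ?T \<Longrightarrow> \<eta> vs = \<omega>' vs"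
        "df_wedge ?S ?f \<eta> = \<omega>"
        using assms(5) by (auto simp: form_rel_def)
      show "\<omega>' = ?G"
      proof
        fix us
        show "\<omega>' us = ?G us"
        proof (cases "set us \<subseteq> ?T")
          case True
          have "alt_sum (\<lambda>v vs. pairing v ?f * \<eta> (e # vs)) us = 0"
          proof (rule alt_sum_eq_0)
            fix i assume "i < length us"
            then have "us ! i \<in> ?T" using True by auto
            then show "pairing (us ! i) ?f * \<eta> (e # drop_nth i us) = 0"
              using pairing_tangent[OF assms(1,4)] f by auto
          qed
          moreover have "set (e # us) \<subseteq> ?S" using True TS e(1) by auto
          ultimately have "\<omega> (e # us) = \<eta> us"
            unfolding \<eta>(2)[symmetric] by (simp add: df_wedge_def alt_sum_Cons e(2))
          then show ?thesis using True \<eta>(1) by simp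
        next
          case False
          then show ?thesis using \<omega>' by (auto simp: top_forms_def forms_def)
        qed
      qed
    qed (use rel in simp)
  qed
qed

lemma form_rel_up:
  assumes "arrangement \<C>" "edge_framing \<C> fr xi" "\<alpha> \<in> flats \<C>" "\<beta> \<in> flats \<C>" "\<beta> \<succ> \<alpha>"
  obtains lam p where "\<And>\<omega> \<omega>'. \<omega> \<in> top_forms \<alpha> \<Longrightarrow> form_rel fr xi \<beta> \<alpha> \<omega> \<omega>' \<longleftrightarrow>
    \<omega>' = (\<lambda>us. if set us \<subseteq> tangent \<beta> then alt_sum (\<lambda>v us. lam v * \<omega> (map p us)) us else 0)"
proof -
  let ?x = "xi \<beta> \<alpha>" and ?S = "tangent \<beta>" and ?T = "tangent \<alpha>"
  have sub: "\<alpha> \<subseteq> \<beta>" and dim: "vec.dim ?S = Suc (vec.dim ?T)" using assms(5) by (auto simp: covers_def)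
  have not: "\<not> \<alpha> \<succ> \<beta>" using dim by (auto simp: covers_def)
  have x: "?x \<in> ?S" "?x \<notin> ?T" using assms by (auto simp: edge_framing_def)
  have S: "csubspace ?S" and T: "csubspace ?T" using csubspace_tangent assms by blast+
  have TS: "?T \<subseteq> ?S" by (rule tangent_mono[OF assms(1,4,3) sub])
  obtain B where B: "B \<subseteq> ?T" "vec.independent B" "?T \<subseteq> vec.span B" "card B = vec.dim ?T"
    using vec.basis_exists by blast
  have finB: "finite B" using B(2) vec.finiteI_independent by blast
  have spanB: "vec.span B = ?T"
    using B(1,3) T vec.span_minimal by (metis csubspace_vec subset_antisym)
  have xB: "?x \<notin> vec.span B" using x(2) spanB by simp
  then have ind: "vec.independent (insert ?x B)" using B(2) vec.independent_insert by (metis)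
  have "?x \<notin> B" using xB vec.span_base by blast
  then have card: "card (insert ?x B) = vec.dim ?S"
    using finB B(4) dim by simp
  have "insert ?x B \<subseteq> ?S" using x(1) B(1) TS by auto
  then have spanS: "?S = vec.span (insert ?x B)"
    using vec.card_ge_dim_independent[OF _ ind, of ?S] card
      vec.span_minimal[OF _ S[unfolded csubspace_vec]] by (intro subset_antisym) simp_all
  interpret vp: vector_space_pair "(*s) :: complex \<Rightarrow> complex ^ 'a \<Rightarrow> complex ^ 'a" "(*) :: complex \<Rightarrow> complex \<Rightarrow> complex"
    by unfold_locales (simp_all add: algebra_simps)
  obtain lam where lam: "Vector_Spaces.linear (*s) (*) lam" "\<And>b. b \<in> insert ?x B \<Longrightarrow> lam b = (if b = ?x then 1 else 0)"
    using vp.linear_independent_extend[OF ind, of "\<lambda>b. if b = ?x then 1 else 0"] by blast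
  have lamlin: "clinear lam"
    by (rule clinearI) (use lam(1) in \<open>simp_all add: vp.linear_add vp.linear_scale scaleC_vec_eq scaleC_complex_def\<close>)
  have lamx: "lam ?x = 1" using lam(2) by simp
  have lamT: "lam v = 0" if "v \<in> ?T" for v
  proof (rule cspan_kernel[OF lamlin, of B])
    show "v \<in> cspan B" using that spanB by (simp only: cspan_vec)
    show "lam b = 0" if "b \<in> B" for b using lam(2)[of b] that \<open>?x \<notin> B\<close> by auto
  qed
  define p where "p v = v - lam v *\<^sub>C ?x" for v
  have pT: "p v = v" if "v \<in> ?T" for v using lamT that by (simp add: p_def)
  have pS: "p v \<in> ?T" if v: "v \<in> ?S" for v
  proof -
    obtain k where k: "v - k *s ?x \<in> ?T"
      using v unfolding spanS vec.span_breakdown_eq spanB by blast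
    then have "lam v = k"
      using lamT[OF k] by (simp add: clinear_diff[OF lamlin] clinear_scale[OF lamlin] lamx scaleC_complex_def
          flip: scaleC_vec_eq)
    then show ?thesis using k by (simp add: p_def scaleC_vec_eq)
  qed
  have p_add: "p (u + v) = p u + p v" and p_scale: "p (c *\<^sub>C u) = c *\<^sub>C p u" for u v c
    by (simp_all add: p_def clinear_add[OF lamlin] clinear_scale[OF lamlin] scaleC_add_left
        complex_vector.scale_right_diff_distrib scaleC_scaleC scaleC_complex_def)
  show ?thesis
  proof (rule that[of lam p])
    fix \<omega> \<omega>' assume \<omega>: "\<omega> \<in> top_forms \<alpha>"
    then have alt: "alternating_on ?T \<omega>" and \<omega>0: "\<And>vs. length vs \<noteq> vec.dim ?T \<Longrightarrow> \<omega> vs = 0"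
      by (auto simp: top_forms_def forms_def)
    have mapS: "set (map p us) \<subseteq> ?T" if "set us \<subseteq> ?S" for us using that pS by auto
    have altp: "alternating_on ?S (\<lambda>us. \<omega> (map p us))"
      unfolding alternating_on_def
    proof (intro conjI allI impI; elim conjE)
      fix us ws assume uw: "set us \<subseteq> ?S" "set ws \<subseteq> ?S"
      have "clinear_on ?T (\<lambda>x. \<omega> (map p us @ x # map p ws))"
        using alt mapS[OF uw(1)] mapS[OF uw(2)] unfolding alternating_on_def by blast
      then show "clinear_on ?S (\<lambda>x. \<omega> (map p (us @ x # ws)))"
        by (simp add: clinear_on_def p_add p_scale pS)
    next
      fix vs assume "set vs \<subseteq> ?S" "\<not> distinct vs"
      then have "set (map p vs) \<subseteq> ?T" "\<not> distinct (map p vs)"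
        using mapS by (auto simp: distinct_map)
      then show "\<omega> (map p vs) = 0"
        using alt unfolding alternating_on_def by blast
    qed
    let ?H = "\<lambda>us. if set us \<subseteq> ?S then alt_sum (\<lambda>v us. lam v * \<omega> (map p us)) us else 0"
    note alt_H = alternating_wedge_functional[OF S lamlin altp]
    have "alternating_on ?S ?H"
      unfolding alternating_on_def
    proof (intro conjI allI impI; elim conjE)
      fix us ws assume uw: "set us \<subseteq> ?S" "set ws \<subseteq> ?S"
      then have "clinear_on ?S (\<lambda>x. alt_sum (\<lambda>v us. lam v * \<omega> (map p us)) (us @ x # ws))"
        using alt_H unfolding alternating_on_def by blast
      then show "clinear_on ?S (\<lambda>x. ?H (us @ x # ws))"
        using uw S by (simp add: clinear_on_def complex_vector.subspace_add complex_vector.subspace_scale)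
    qed (use alt_H in \<open>auto simp: alternating_on_def\<close>)
    moreover have H0: "alt_sum (\<lambda>v us. lam v * \<omega> (map p us)) vs = 0"
      if "length vs \<noteq> vec.dim ?S" for vs
    proof (rule alt_sum_eq_0)
      fix i assume "i < length vs"
      then have "length (map p (drop_nth i vs)) \<noteq> vec.dim ?T"
        using that dim by (simp add: length_drop_nth)
      then show "lam (vs ! i) * \<omega> (map p (drop_nth i vs)) = 0" by (simp add: \<omega>0)
    qed
    ultimately have H: "?H \<in> top_forms \<beta>"
      by (auto simp: top_forms_def forms_def H0)
    have "?H (?x # vs) = \<omega> vs" if vs: "set vs \<subseteq> ?T" for vs
    proof -
      have "alt_sum (\<lambda>v us. lam v * \<omega> (map p (?x # us))) vs = 0"
        by (rule alt_sum_eq_0) (use vs lamT in \<open>auto simp: subset_iff\<close>)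
      moreover have "map p vs = vs" using vs pT by (auto intro: map_idI)
      moreover have "set (?x # vs) \<subseteq> ?S" using vs TS x by auto
      ultimately show ?thesis by (simp add: alt_sum_Cons lamx)
    qed
    then have rel: "form_rel fr xi \<beta> \<alpha> \<omega> ?H"
      unfolding form_rel_def using H not by simp
    show "form_rel fr xi \<beta> \<alpha> \<omega> \<omega>' \<longleftrightarrow> \<omega>' = ?H"
    proof
      assume "form_rel fr xi \<beta> \<alpha> \<omega> \<omega>'"
      then have \<omega>': "\<omega>' \<in> top_forms \<beta>" and eq: "\<And>vs. set vs \<subseteq> ?T \<Longrightarrow> \<omega>' (?x # vs) = \<omega> vs"
        using not by (auto simp: form_rel_def)
      have alt': "alternating_on ?S \<omega>'" using \<omega>' by (auto simp: top_forms_def forms_def)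
      have proj: "\<omega>' (?x # ys @ us) = \<omega>' (?x # ys @ map p us)" if "set ys \<subseteq> ?S" "set us \<subseteq> ?S" for ys us
        using that
      proof (induction us arbitrary: ys)
        case (Cons u us)
        have u: "u = p u + lam u *\<^sub>C ?x" by (simp add: p_def)
        have pu: "p u \<in> ?S" "lam u *\<^sub>C ?x \<in> ?S"
          using Cons pS TS x S by (auto simp: complex_vector.subspace_scale)
        have S3: "set (?x # ys) \<subseteq> ?S" "set us \<subseteq> ?S" using Cons.prems x by auto
        have lin: "clinear_on ?S (\<lambda>v. \<omega>' ((?x # ys) @ v # us))"
          using alt' S3 unfolding alternating_on_def by blast
        have "set ((?x # ys) @ ?x # us) \<subseteq> ?S" "\<not> distinct ((?x # ys) @ ?x # us)"
          using S3 by auto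
        then have nd: "\<omega>' ((?x # ys) @ ?x # us) = 0"
          using alt' unfolding alternating_on_def by blast
        have "\<omega>' ((?x # ys) @ u # us) = \<omega>' ((?x # ys) @ p u # us) + lam u *\<^sub>C \<omega>' ((?x # ys) @ ?x # us)"
          using lin pu x(1) u unfolding clinear_on_def by metis
        also have "\<omega>' ((?x # ys) @ p u # us) = \<omega>' (?x # (ys @ [p u]) @ map p us)"
          using Cons.IH[of "ys @ [p u]"] Cons.prems pu by simp
        finally show ?case by (simp add: nd[simplified])
      qed simp
      show "\<omega>' = ?H"
      proof
        fix us
        show "\<omega>' us = ?H us"
        proof (cases "set us \<subseteq> ?S \<and> length us = vec.dim ?S")
          case True
          have "\<omega>' us = alt_sum (\<lambda>v us. lam v * \<omega>' (?x # us)) us"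
            by (rule top_form_expand[OF S _ lamlin x(1) lamx]) (use True \<omega>' in \<open>auto simp: top_forms_def\<close>)
          also have "\<dots> = alt_sum (\<lambda>v us. lam v * \<omega> (map p us)) us"
          proof (rule alt_sum_cong)
            fix i
            have "set (drop_nth i us) \<subseteq> ?S" using True set_drop_nth[of i us] by blast
            then show "lam (us ! i) * \<omega>' (?x # drop_nth i us) = lam (us ! i) * \<omega> (map p (drop_nth i us))"
              using proj[of "[]"] eq[OF mapS] by simp
          qed
          finally show ?thesis using True by simp
        next
          case False
          then have "\<omega>' us = 0" using \<omega>' by (auto simp: top_forms_def forms_def)
          moreover have "?H us = 0" using False H by (auto simp: top_forms_def forms_def)
          ultimately show ?thesis by simp
        qed
      qed
    qed (use rel in simp)
  qed
qed

lemma
  assumes "arrangement \<C>" "edge_framing \<C> fr xi" "\<alpha> \<in> flats \<C>" "\<beta> \<in> flats \<C>" "adjacent \<beta> \<alpha>"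
  shows form_map_iff: "\<omega> \<in> top_forms \<alpha> \<Longrightarrow> form_map fr xi \<beta> \<alpha> \<omega> = \<omega>' \<longleftrightarrow> form_rel fr xi \<beta> \<alpha> \<omega> \<omega>'"
    and clinear_on_form_map: "clinear_on (top_forms \<alpha>) (form_map fr xi \<beta> \<alpha>)"
proof -
  obtain G where G: "\<And>\<omega> \<omega>'. \<omega> \<in> top_forms \<alpha> \<Longrightarrow> form_rel fr xi \<beta> \<alpha> \<omega> \<omega>' \<longleftrightarrow> \<omega>' = G \<omega>"
    and lin: "clinear G"
  proof (cases "\<alpha> \<succ> \<beta>")
    case True
    obtain e where e: "\<And>\<omega> \<omega>'. \<omega> \<in> top_forms \<alpha> \<Longrightarrow> form_rel fr xi \<beta> \<alpha> \<omega> \<omega>' \<longleftrightarrow>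
      \<omega>' = (\<lambda>us. if set us \<subseteq> tangent \<beta> then \<omega> (e # us) else 0)"
      using form_rel_down[OF assms(1-4) True] by blast
    show ?thesis
      by (rule that[OF e], assumption) (rule clinearI; auto simp: fun_eq_iff scaleC_fun_def)
  next
    case False
    then have "\<beta> \<succ> \<alpha>" using assms(5) by (auto simp: adjacent_def)
    from form_rel_up[OF assms(1-4) this] obtain lam p where e: "\<And>\<omega> \<omega>'. \<omega> \<in> top_forms \<alpha> \<Longrightarrow>
      form_rel fr xi \<beta> \<alpha> \<omega> \<omega>' \<longleftrightarrow>
      \<omega>' = (\<lambda>us. if set us \<subseteq> tangent \<beta> then alt_sum (\<lambda>v us. lam v * \<omega> (map p us)) us else 0)"
      by blast
    show ?thesis
      by (rule that[OF e], assumption) (rule clinearI; auto simp: fun_eq_iff scaleC_fun_def alt_sum_def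
        scaleC_complex_def algebra_simps sum.distrib sum_distrib_left)
  qed
  have eq: "form_map fr xi \<beta> \<alpha> \<omega> = G \<omega>" if "\<omega> \<in> top_forms \<alpha>" for \<omega>
    unfolding form_map_def by (rule the_equality) (simp_all add: G[OF that])
  show "\<omega> \<in> top_forms \<alpha> \<Longrightarrow> form_map fr xi \<beta> \<alpha> \<omega> = \<omega>' \<longleftrightarrow> form_rel fr xi \<beta> \<alpha> \<omega> \<omega>'"
    using G eq by auto
  show "clinear_on (top_forms \<alpha>) (form_map fr xi \<beta> \<alpha>)"
    using csubspace_forms[of "vec.dim (tangent \<alpha>)" "tangent \<alpha>"]
    by (auto simp: clinear_on_def eq clinear_add[OF lin] clinear_scale[OF lin] top_forms_def
        complex_vector.subspace_add complex_vector.subspace_scale)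
qed

lemma csubspace_quiver:
  assumes "quiver \<C> V A" "\<alpha> \<in> flats \<C>"
  shows "csubspace (V \<alpha>)"
proof -
  have "\<forall>\<alpha>\<in>flats \<C>. \<exists>B. finite B \<and> V \<alpha> = cspan B"
    using assms(1) unfolding quiver_def by (rule conjunct1)
  then obtain B where "V \<alpha> = cspan B" using assms(2) by blast
  then show ?thesis by simp
qed

lemma csubspace_top_forms: "csubspace (top_forms \<alpha>)"
  unfolding top_forms_def by (rule csubspace_forms)

lemma form_map_top:
  assumes "arrangement \<C>" "edge_framing \<C> fr xi" "\<alpha> \<in> flats \<C>" "\<beta> \<in> flats \<C>" "adjacent \<beta> \<alpha>"
    and "\<omega> \<in> top_forms \<alpha>"
  shows "form_map fr xi \<beta> \<alpha> \<omega> \<in> top_forms \<beta>"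
  using form_map_iff[OF assms, THEN iffD1, OF refl] unfolding form_rel_def by (rule conjunct1)

subsection \<open>The differential on generators\<close>

lemma clinear_edge_fun: "clinear (edge_fun fr xi \<beta> \<alpha>)"
  by (rule clinearI)
    (simp_all add: edge_fun_def scaleC_prod_def clinear_add[OF clinear_pairing(1)]
      clinear_add[OF clinear_pairing(2)] clinear_scale[OF clinear_pairing(1)]
      clinear_scale[OF clinear_pairing(2)])

context
  fixes \<C> :: "(complex ^ 'n) set set" and V :: "(complex ^ 'n) set \<Rightarrow> 'v::complex_vector set"
    and A fr xi \<alpha> \<beta> \<omega> v
  assumes arr: "arrangement \<C>" and qui: "quiver \<C> V A" and fram: "edge_framing \<C> fr xi"
    and flat: "\<alpha> \<in> flats \<C>" "\<beta> \<in> flats \<C>" and adj: "adjacent \<beta> \<alpha>"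
    and elts: "\<omega> \<in> top_forms \<alpha>" "v \<in> V \<alpha>"
begin

lemma lin_ext_quiver: "clinear (lin_ext (V \<alpha>) (A \<beta> \<alpha>))" "lin_ext (V \<alpha>) (A \<beta> \<alpha>) v = A \<beta> \<alpha> v"
proof -
  have "\<forall>\<alpha>\<in>flats \<C>. \<forall>\<beta>\<in>flats \<C>. clinear_on (V \<beta>) (A \<alpha> \<beta>) \<and> A \<alpha> \<beta> ` V \<beta> \<subseteq> V \<alpha>"
    using qui unfolding quiver_def by (elim conjE)
  then have "clinear_on (V \<alpha>) (A \<beta> \<alpha>)" using flat by blast
  then show "clinear (lin_ext (V \<alpha>) (A \<beta> \<alpha>))" "lin_ext (V \<alpha>) (A \<beta> \<alpha>) v = A \<beta> \<alpha> v"
    using csubspace_quiver[OF qui flat(1)] elts by (simp_all add: clinear_lin_ext lin_ext_eq)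
qed

lemma lin_ext_form_map:
  "clinear (lin_ext (top_forms \<alpha>) (form_map fr xi \<beta> \<alpha>))"
  "lin_ext (top_forms \<alpha>) (form_map fr xi \<beta> \<alpha>) \<omega> = form_map fr xi \<beta> \<alpha> \<omega>"
  using csubspace_top_forms[of \<alpha>] clinear_on_form_map[OF arr fram flat adj] elts
  by (simp_all add: clinear_lin_ext lin_ext_eq)

lemma clinear_edge_op: "clinear (edge_op V A fr xi \<beta> \<alpha>)"
  unfolding edge_op_def
  by (intro clinear_tensor_map clinear_contract clinear_edge_fun lin_ext_quiver(1) lin_ext_form_map(1))

lemma edge_op_wedge: "edge_op V A fr xi \<beta> \<alpha> (wedge ts \<otimes> \<omega> \<otimes> v) =
    contract (edge_fun fr xi \<beta> \<alpha>) (wedge ts) \<otimes> form_map fr xi \<beta> \<alpha> \<omega> \<otimes> A \<beta> \<alpha> v"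
  by (simp add: edge_op_def tensor_map_tensor clinear_tensor_map clinear_contract clinear_edge_fun
      lin_ext_quiver lin_ext_form_map)

lemma contract_Cons: "clinear \<phi> \<Longrightarrow> contract \<phi> (wedge (t # ts)) =
    \<phi> t *\<^sub>C wedge ts - (\<Sum>i<length ts. (- 1) ^ i *\<^sub>C \<phi> (ts ! i) *\<^sub>C wedge (t # drop_nth i ts))"
  using alt_sum_Cons[of "\<lambda>t us. \<phi> t *\<^sub>C wedge us" t ts] by (simp add: contract_wedge alt_sum_def)

lemma contract_append:
  fixes us ts :: "'w::complex_vector list"
  assumes \<phi>: "clinear \<phi>" and us: "\<And>t. t \<in> set us \<Longrightarrow> \<phi> t = 0" and ts: "\<And>t. t \<in> set ts \<Longrightarrow> \<phi> t = 0"
  shows "contract \<phi> (wedge (us @ t # ts)) = (- 1) ^ length us *\<^sub>C \<phi> t *\<^sub>C wedge (us @ ts)"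
proof -
  have z: "\<phi> ((us @ t # ts) ! i) = 0" if "i < Suc (length us + length ts)" "i \<noteq> length us" for i
    using that us ts by (cases "i < length us") (auto simp: nth_append nth_Cons')
  have "contract \<phi> (wedge (us @ t # ts)) =
    (\<Sum>i\<in>{length us}. (- 1) ^ i *\<^sub>C \<phi> ((us @ t # ts) ! i) *\<^sub>C wedge (drop_nth i (us @ t # ts)))"
    unfolding contract_wedge[OF \<phi>] by (rule sum.mono_neutral_right) (auto simp: z)
  then show ?thesis by (simp add: drop_nth_def)
qed

lemma contract_eq_0:
  assumes "clinear \<phi>" "\<And>t. t \<in> set ts \<Longrightarrow> \<phi> t = 0"
  shows "contract \<phi> (wedge ts) = 0"
  unfolding contract_wedge[OF assms(1)] by (rule sum.neutral) (simp add: assms(2))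

lemma edge_op_wedge_down:
  assumes "\<alpha> \<succ> \<beta>" "\<xi> \<in> tangent \<alpha>" "set \<xi>s \<subseteq> tangent \<beta>"
  shows "edge_op V A fr xi \<beta> \<alpha> (wedge ((\<xi>, 0) # map (\<lambda>\<eta>. (\<eta>, 0)) \<xi>s @ map (\<lambda>f. (0, f)) fs) \<otimes> \<omega> \<otimes> v) =
      pairing \<xi> (fr \<beta> \<alpha>) *\<^sub>C
        (wedge (map (\<lambda>\<eta>. (\<eta>, 0)) \<xi>s @ map (\<lambda>f. (0, f)) fs) \<otimes> form_map fr xi \<beta> \<alpha> \<omega> \<otimes> A \<beta> \<alpha> v)"
    and "edge_op V A fr xi \<beta> \<alpha> (wedge (map (\<lambda>f. (0, f)) fs) \<otimes> \<omega> \<otimes> v) = 0"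
proof -
  let ?ts = "map (\<lambda>\<eta>. (\<eta>, 0)) \<xi>s @ map (\<lambda>f. (0, f)) fs"
  have f: "fr \<beta> \<alpha> \<in> vanishing \<C> \<beta>" using fram flat assms(1) by (auto simp: edge_framing_def)
  have z: "edge_fun fr xi \<beta> \<alpha> t = 0" if "t \<in> set ?ts" for t
    using that assms(1,3) pairing_tangent[OF arr flat(2) f] clinear_0[OF clinear_pairing(1)]
    by (auto simp: edge_fun_def)
  have "contract (edge_fun fr xi \<beta> \<alpha>) (wedge ([] @ (\<xi>, 0) # ?ts)) = pairing \<xi> (fr \<beta> \<alpha>) *\<^sub>C wedge ?ts"
    by (subst contract_append[OF clinear_edge_fun])
      (use z assms(1) in \<open>auto simp: edge_fun_def scaleC_one\<close>)
  then show "edge_op V A fr xi \<beta> \<alpha> (wedge ((\<xi>, 0) # ?ts) \<otimes> \<omega> \<otimes> v) =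
      pairing \<xi> (fr \<beta> \<alpha>) *\<^sub>C (wedge ?ts \<otimes> form_map fr xi \<beta> \<alpha> \<omega> \<otimes> A \<beta> \<alpha> v)"
    by (simp add: edge_op_wedge tensor_bilinear)
  show "edge_op V A fr xi \<beta> \<alpha> (wedge (map (\<lambda>f. (0, f)) fs) \<otimes> \<omega> \<otimes> v) = 0"
    unfolding edge_op_wedge
    by (subst contract_eq_0[OF clinear_edge_fun]) (use z in \<open>auto simp: tensor_zero\<close>)
qed

lemma edge_op_wedge_up:
  assumes "\<beta> \<succ> \<alpha>" "f \<in> vanishing \<C> \<alpha>" "set fs \<subseteq> vanishing \<C> \<beta>"
  shows "edge_op V A fr xi \<beta> \<alpha> (wedge (map (\<lambda>\<eta>. (\<eta>, 0)) \<xi>s @ (0, f) # map (\<lambda>f. (0, f)) fs) \<otimes> \<omega> \<otimes> v) =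
      ((- 1) ^ length \<xi>s * pairing (xi \<beta> \<alpha>) f) *\<^sub>C
        (wedge (map (\<lambda>\<eta>. (\<eta>, 0)) \<xi>s @ map (\<lambda>f. (0, f)) fs) \<otimes> form_map fr xi \<beta> \<alpha> \<omega> \<otimes> A \<beta> \<alpha> v)"
    and "edge_op V A fr xi \<beta> \<alpha> (wedge (map (\<lambda>\<eta>. (\<eta>, 0)) \<xi>s) \<otimes> \<omega> \<otimes> v) = 0"
proof -
  let ?us = "map (\<lambda>\<eta>. (\<eta>, 0)) \<xi>s" and ?ts = "map (\<lambda>f. (0, f)) fs"
  have nd: "\<not> \<alpha> \<succ> \<beta>" using assms(1) by (auto simp: covers_def)
  have x: "xi \<beta> \<alpha> \<in> tangent \<beta>" using fram flat assms(1) by (auto simp: edge_framing_def)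
  have z: "edge_fun fr xi \<beta> \<alpha> t = 0" if "t \<in> set ?us \<or> t \<in> set ?ts" for t
    using that nd assms(3) pairing_tangent[OF arr flat(2) _ x] clinear_0[OF clinear_pairing(2)]
    by (auto simp: edge_fun_def)
  have "contract (edge_fun fr xi \<beta> \<alpha>) (wedge (?us @ (0, f) # ?ts)) =
      (- 1) ^ length \<xi>s *\<^sub>C pairing (xi \<beta> \<alpha>) f *\<^sub>C wedge (?us @ ?ts)"
    by (subst contract_append[OF clinear_edge_fun]) (use z nd in \<open>auto simp: edge_fun_def\<close>)
  then show "edge_op V A fr xi \<beta> \<alpha> (wedge (?us @ (0, f) # ?ts) \<otimes> \<omega> \<otimes> v) =
      ((- 1) ^ length \<xi>s * pairing (xi \<beta> \<alpha>) f) *\<^sub>C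
        (wedge (?us @ ?ts) \<otimes> form_map fr xi \<beta> \<alpha> \<omega> \<otimes> A \<beta> \<alpha> v)"
    by (simp add: edge_op_wedge tensor_bilinear scaleC_scaleC)
  show "edge_op V A fr xi \<beta> \<alpha> (wedge ?us \<otimes> \<omega> \<otimes> v) = 0"
    unfolding edge_op_wedge
    by (subst contract_eq_0[OF clinear_edge_fun]) (use z in \<open>auto simp: tensor_zero\<close>)
qed

end

lemma d0_pure:
  assumes "arrangement \<C>" "quiver \<C> V A" "edge_framing \<C> fr xi"
    and "\<alpha> \<in> flats \<C>" "\<omega> \<in> top_forms \<alpha>" "v \<in> V \<alpha>"
  shows "d0 \<C> V A fr xi (pure \<alpha> P ts \<omega> v) =
    (\<lambda>\<beta>. if \<beta> \<in> flats \<C> \<and> adjacent \<beta> \<alpha>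
      then P \<otimes> edge_op V A fr xi \<beta> \<alpha> (wedge ts \<otimes> \<omega> \<otimes> v) else 0)"
proof
  fix \<beta>
  note lin = clinear_edge_op[OF assms(1-3)]
  have "(\<Sum>\<gamma> | \<gamma> \<in> flats \<C> \<and> adjacent \<beta> \<gamma>.
      tensor_map (\<lambda>P. P) (edge_op V A fr xi \<beta> \<gamma>) (pure \<alpha> P ts \<omega> v \<gamma>)) =
    (\<Sum>\<gamma> | \<gamma> \<in> flats \<C> \<and> adjacent \<beta> \<gamma>.
      if \<gamma> = \<alpha> then P \<otimes> edge_op V A fr xi \<beta> \<alpha> (wedge ts \<otimes> \<omega> \<otimes> v) else 0)" if b: "\<beta> \<in> flats \<C>"
  proof (rule sum.cong[OF refl])
    fix \<gamma> assume g: "\<gamma> \<in> {\<gamma> \<in> flats \<C>. adjacent \<beta> \<gamma>}"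
    have "0 \<in> top_forms \<gamma>" "0 \<in> V \<gamma>"
      using g by (auto intro: complex_vector.subspace_0 csubspace_top_forms csubspace_quiver[OF assms(2)])
    then have l: "clinear (edge_op V A fr xi \<beta> \<gamma>)" using lin b g by blast
    show "tensor_map (\<lambda>P. P) (edge_op V A fr xi \<beta> \<gamma>) (pure \<alpha> P ts \<omega> v \<gamma>) =
      (if \<gamma> = \<alpha> then P \<otimes> edge_op V A fr xi \<beta> \<alpha> (wedge ts \<otimes> \<omega> \<otimes> v) else 0)"
    proof (cases "\<gamma> = \<alpha>")
      case True
      then show ?thesis by (simp add: pure_def tensor_map_tensor[OF clinear_id' l[unfolded True]])
    next
      case False
      then show ?thesis by (simp add: pure_def clinear_0[OF clinear_tensor_map[OF clinear_id' l]])
    qed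
  qed
  then show "d0 \<C> V A fr xi (pure \<alpha> P ts \<omega> v) \<beta> =
    (if \<beta> \<in> flats \<C> \<and> adjacent \<beta> \<alpha>
      then P \<otimes> edge_op V A fr xi \<beta> \<alpha> (wedge ts \<otimes> \<omega> \<otimes> v) else 0)"
    using finite_flats[OF assms(1)] assms(4) by (simp add: d0_def sum.delta)
qed

lemma d0_weyl_act:
  assumes "arrangement \<C>" "quiver \<C> V A" "edge_framing \<C> fr xi"
  shows "d0 \<C> V A fr xi (weyl_act P x) = weyl_act P (d0 \<C> V A fr xi x)"
proof
  fix \<beta>
  let ?M = "tensor_map (\<lambda>Q. P * Q) (\<lambda>m. m)"
  note M = clinear_tensor_map[OF clinear_weyl_times clinear_id']
  note Mt = tensor_map_tensor[OF clinear_weyl_times clinear_id']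
  have *: "tensor_map (\<lambda>P. P) (edge_op V A fr xi \<beta> \<gamma>) (?M y) =
      ?M (tensor_map (\<lambda>P. P) (edge_op V A fr xi \<beta> \<gamma>) y)"
    if "\<beta> \<in> flats \<C>" "\<gamma> \<in> flats \<C>" "adjacent \<beta> \<gamma>"
    for \<gamma> and y
  proof -
    have "0 \<in> top_forms \<gamma>" "0 \<in> V \<gamma>"
      using that by (auto intro: complex_vector.subspace_0 csubspace_top_forms csubspace_quiver[OF assms(2)])
    then have l: "clinear (edge_op V A fr xi \<beta> \<gamma>)" using clinear_edge_op[OF assms] that by blast
    note E = clinear_tensor_map[OF clinear_id' l] and Et = tensor_map_tensor[OF clinear_id' l]
    show ?thesis
      by (rule tensor_eqI[OF clinear_compose[OF E M] clinear_compose[OF M E]]) (simp add: Et Mt)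
  qed
  show "d0 \<C> V A fr xi (weyl_act P x) \<beta> = weyl_act P (d0 \<C> V A fr xi x) \<beta>"
  proof (cases "\<beta> \<in> flats \<C>")
    case True
    show ?thesis
      unfolding d0_def weyl_act_def if_P[OF True] clinear_sum[OF M]
      by (rule sum.cong[OF refl], rule *) (use True in simp_all)
  next
    case False
    then show ?thesis by (simp add: d0_def weyl_act_def clinear_0[OF M])
  qed
qed

end

theory Submission
  imports Defs
begin

text \<open>The maps \<open>d\<^sub>1\<close> are Koszul differentials: \<open>D\<^sub>X\<close> is free over the commutative algebra generated by the Lagrangian
  subspace \<open>\<T>\<^sub>\<alpha>\<close>. With dual coordinates \<open>s\<^sub>i\<close> to a basis \<open>t\<^sub>i\<close> of \<open>\<T>\<^sub>\<alpha>\<close>, the commutators \<open>[P, s\<^sub>i]\<close> are the partial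
  derivatives along \<open>t\<^sub>i\<close>, so \<open>h (P \<otimes> e) = \<Sum>\<^sub>i [P, s\<^sub>i] \<otimes> (t\<^sub>i \<and> e)\<close> satisfies \<open>d\<^sub>1 h + h d\<^sub>1 = E + r\<close>, where \<open>E\<close> counts
  the factors from \<open>\<T>\<^sub>\<alpha>\<close> of a normally ordered monomial. The perturbation \<open>d\<^sub>0 h + h d\<^sub>0\<close> lowers the Bernstein degree,
  so \<open>d h + h d\<close> is triangular with eigenvalues \<open>\<ge> r > 0\<close> on a filtration common to all \<open>\<alpha>\<close>, and it is homotopic
  to \<open>0\<close>; hence every cycle of degree \<open>r > 0\<close> is a boundary.

  For \<open>d\<^sub>0\<^sup>2 = 0\<close>, the coefficient of a path \<open>\<alpha> \<rightarrow> \<beta> \<rightarrow> \<gamma>\<close> together with its form part either vanishes or is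
  independent of \<open>\<beta>\<close>, because \<open>df \<and> \<theta> = 0\<close> for every top form \<open>\<theta>\<close>; then the quiver relations apply.\<close>

section \<open>Alternating sums and interior products\<close>

text \<open>The number of factors from the Lagrangian subspace cannot itself filter the complex,
  because d_0 carries a chain from one flat to another, where the subspace is a different one. The
  total degree of an operator means the same at every flat: d_0 leaves operators alone and h deletes
  a letter. On operators of one total degree l, however, E still has several eigenvalues, so l is
  refined by the number k of Lagrangian letters to the rank l^2 + k. Since k <= l, ranks of
  different degrees do not overlap, and each rank carries a single eigenvalue that can be divided
  out. The homotopy h is complex linear but not linear over the Weyl algebra; this suffices, as
  exactness only compares a kernel with an image.

  The quiver relations do not cover every pair \<alpha>, \<gamma> joined by a path: they are silent
  for \<alpha> = \<gamma> and for flats of equal dimension without a common flat of codimension one,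
  and there the coefficients themselves have to vanish. Where a relation applies, it sums over flats
  above and below alike, so the two kinds of paths must carry the same form.\<close>

lemma eq_neg_self_imp_0: "x = - x \<Longrightarrow> x = 0" for x :: "'a::complex_vector"
proof -
  assume "x = - x"
  then have "x + x = 0" by (metis add.right_inverse)
  then have "(2 :: complex) *\<^sub>C x = 0"
    using scaleC_add_left[of 1 1 x] by (simp add: scaleC_one)
  then show "x = 0" by simp
qed

lemma alt_sum_Nil [simp]: "alt_sum B [] = 0"
  by (simp add: alt_sum_def)

lemma alt_sum_add: "alt_sum (\<lambda>t us. B t us + C t us) ts = alt_sum B ts + alt_sum C ts"
  by (simp add: alt_sum_def scaleC_add_right sum.distrib)

lemma clinear_alt_sum: "clinear f \<Longrightarrow> f (alt_sum B ts) = alt_sum (\<lambda>t us. f (B t us)) ts"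
  by (simp add: alt_sum_def clinear_sum clinear_scale)

lemma alt_sum_scale: "alt_sum (\<lambda>t us. c *\<^sub>C B t us) ts = c *\<^sub>C alt_sum B ts"
  by (simp add: alt_sum_def complex_vector.scale_sum_right scaleC_scaleC mult.commute)

lemma alt_sum_minus: "alt_sum (\<lambda>t us. - B t us) ts = - alt_sum B ts"
  by (simp add: alt_sum_def sum_negf)

lemma alt_sum_diff: "alt_sum (\<lambda>t us. B t us - C t us) ts = alt_sum B ts - alt_sum C ts"
  using alt_sum_add[of B "\<lambda>t us. - C t us" ts] by (simp add: alt_sum_minus)

lemma alt_sum_sum: "alt_sum (\<lambda>t us. \<Sum>i\<in>I. B i t us) ts = (\<Sum>i\<in>I. alt_sum (B i) ts)"
  by (simp add: alt_sum_def complex_vector.scale_sum_right) (rule sum.swap)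

lemma alt_sum_cong_set:
  assumes "\<And>t us. t \<in> set ts \<Longrightarrow> set us \<subseteq> set ts \<Longrightarrow> Suc (length us) = length ts \<Longrightarrow> B t us = C t us"
  shows "alt_sum B ts = alt_sum C ts"
  by (rule alt_sum_cong, rule assms) (auto simp: length_drop_nth dest: set_drop_nth[THEN subsetD])

lemma alt_sum_in_subspace:
  assumes "csubspace M"
    and "\<And>t us. t \<in> set ts \<Longrightarrow> set us \<subseteq> set ts \<Longrightarrow> Suc (length us) = length ts \<Longrightarrow> B t us \<in> M"
  shows "alt_sum B ts \<in> M"
  unfolding alt_sum_def
  by (intro complex_vector.subspace_sum complex_vector.subspace_scale assms)
    (auto simp: length_drop_nth dest: set_drop_nth[THEN subsetD])

text \<open>When two entries are deleted one after the other, reversing the order shifts the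
  position of exactly one of them by one; hence the sign. The squares and the anticommutator of
  contractions, \<open>d1\<close> and \<open>D0\<close> all reduce to this rule.\<close>

lemma alt_sum_swap:
  "alt_sum (\<lambda>t. alt_sum (B t)) ts = - alt_sum (\<lambda>t. alt_sum (\<lambda>s. B s t)) ts"
proof (induction ts arbitrary: B)
  case (Cons e ts)
  show ?case
    using Cons.IH[of "\<lambda>t s us. B t s (e # us)"]
    by (simp add: alt_sum_Cons alt_sum_diff algebra_simps)
qed simp

text \<open>Symmetry is asked only for entries of \<open>ts\<close>, because operators commute when
  taken from one Lagrangian subspace but not in general.\<close>

lemma alt_sum_symmetric_eq_0:
  assumes "\<And>t s us. t \<in> set ts \<Longrightarrow> s \<in> set ts \<Longrightarrow> set us \<subseteq> set ts \<Longrightarrow>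
    Suc (Suc (length us)) = length ts \<Longrightarrow> B t s us = B s t us"
  shows "alt_sum (\<lambda>t. alt_sum (B t)) ts = 0"
proof (rule eq_neg_self_imp_0)
  have "alt_sum (\<lambda>t. alt_sum (\<lambda>s. B s t)) ts = alt_sum (\<lambda>t. alt_sum (B t)) ts"
    by (intro alt_sum_cong_set assms) auto
  then show "alt_sum (\<lambda>t. alt_sum (B t)) ts = - alt_sum (\<lambda>t. alt_sum (B t)) ts"
    using alt_sum_swap[of B ts] by simp
qed

section \<open>Exterior multiplication, contraction and projection along a vector\<close>

definition lwedge :: "'w::complex_vector \<Rightarrow> 'w ext \<Rightarrow> 'w ext"
  where "lwedge t = ext_lift (\<lambda>ts. wedge (t # ts))"

lemma
  shows clinear_lwedge: "clinear (lwedge t)"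
    and lwedge_wedge: "lwedge t (wedge ts) = wedge (t # ts)"
proof -
  have "alternating_on UNIV (\<lambda>ts. wedge (t # ts))"
    using wedge_add[of "t # us" for us] wedge_scale[of "t # us" for us]
    by (auto simp: alternating_on_def clinear_on_def wedge_eq_0)
  then show "clinear (lwedge t)" "lwedge t (wedge ts) = wedge (t # ts)"
    by (simp_all add: lwedge_def clinear_ext_lift ext_lift_wedge)
qed

lemma wedge_Cons_linear:
  "wedge ((x + y) # ts) = wedge (x # ts) + wedge (y # ts)"
  "wedge ((c *\<^sub>C x) # ts) = c *\<^sub>C wedge (x # ts)"
  using wedge_add[of "[]"] wedge_scale[of "[]"] by simp_all

lemma clinear_wedge_Cons: "clinear (\<lambda>t. wedge (t # ts))"
  by (rule clinearI) (simp_all add: wedge_Cons_linear)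

lemma clinear_lwedge_left: "clinear (\<lambda>t. lwedge t x)"
proof (rule clinearI)
  fix s t :: 'a and c
  show "lwedge (s + t) x = lwedge s x + lwedge t x"
    by (rule ext_eqI[of _ "\<lambda>x. lwedge s x + lwedge t x"])
      (simp_all add: clinear_lwedge clinear_plus lwedge_wedge wedge_Cons_linear)
  show "lwedge (c *\<^sub>C t) x = c *\<^sub>C lwedge t x"
    by (rule ext_eqI[of _ "\<lambda>x. c *\<^sub>C lwedge t x"])
      (simp_all add: clinear_lwedge clinear_scaled lwedge_wedge wedge_Cons_linear)
qed

lemma wedge_swap: "wedge (s # t # ts) = - wedge (t # s # ts)"
  using alternating_swap[OF alternating_wedge, of "[]"] by simp

lemma lwedge_swap: "lwedge s (lwedge t x) = - lwedge t (lwedge s x)"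
proof (rule ext_eqI[of _ "\<lambda>x. - lwedge t (lwedge s x)"])
  show "clinear (\<lambda>x. - lwedge t (lwedge s x))"
    using clinear_scaled[OF clinear_compose[OF clinear_lwedge[of t] clinear_lwedge[of s]], of "- 1"]
    by (simp add: complex_vector.scale_minus_left scaleC_one)
qed (simp_all add: clinear_compose[OF clinear_lwedge clinear_lwedge] lwedge_wedge wedge_swap[of s])

lemma contract_wedge_alt: "clinear \<phi> \<Longrightarrow> contract \<phi> (wedge ts) = alt_sum (\<lambda>t us. \<phi> t *\<^sub>C wedge us) ts"
  by (simp add: contract_wedge alt_sum_def)

lemma contract_contract: "clinear \<phi> \<Longrightarrow> contract \<phi> (contract \<phi> x) = 0"
proof -
  assume \<phi>: "clinear \<phi>"
  note c = clinear_contract[OF \<phi>]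
  have *: "contract \<phi> (contract \<phi> (wedge ts)) = 0" for ts
  proof -
    have "contract \<phi> (contract \<phi> (wedge ts)) =
        alt_sum (\<lambda>t. alt_sum (\<lambda>s us. \<phi> t *\<^sub>C \<phi> s *\<^sub>C wedge us)) ts"
      by (simp only: contract_wedge_alt[OF \<phi>] clinear_alt_sum[OF c] clinear_scale[OF c] alt_sum_scale[symmetric])
    also have "\<dots> = 0"
      by (rule alt_sum_symmetric_eq_0) (simp only: scaleC_scaleC mult.commute)
    finally show ?thesis .
  qed
  show ?thesis
    by (rule cspan_kernel[OF clinear_compose[OF c c] _ ext_span]) (use * in auto)
qed

text \<open>The Clifford relation: deleting \<open>t\<close> leaves the scalar
  \<open>\<phi> t\<close>, and every other factor stands one place further to the right, which
  reverses its sign.\<close>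

lemma contract_lwedge:
  assumes "clinear \<phi>"
  shows "contract \<phi> (lwedge t x) = \<phi> t *\<^sub>C x - lwedge t (contract \<phi> x)"
proof (rule ext_eqI[of _ "\<lambda>x. \<phi> t *\<^sub>C x - lwedge t (contract \<phi> x)"])
  note c = clinear_contract[OF assms]
  show "clinear (\<lambda>x. contract \<phi> (lwedge t x))" by (rule clinear_compose[OF c clinear_lwedge])
  show "clinear (\<lambda>x. \<phi> t *\<^sub>C x - lwedge t (contract \<phi> x))"
    by (rule clinearI) (simp_all add: clinear_add[OF c] clinear_scale[OF c] clinear_add[OF clinear_lwedge]
        clinear_scale[OF clinear_lwedge] algebra_simps scaleC_scaleC scaleC_add_right
        complex_vector.scale_right_diff_distrib)
  show "contract \<phi> (lwedge t (wedge ts)) = \<phi> t *\<^sub>C wedge ts - lwedge t (contract \<phi> (wedge ts))" for ts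
    by (simp add: lwedge_wedge contract_wedge_alt[OF assms] alt_sum_Cons clinear_alt_sum[OF clinear_lwedge]
        clinear_scale[OF clinear_lwedge])
qed

text \<open>\<open>p\<close> is the projection onto the kernel of \<open>\<phi>\<close>; it acts on the exterior algebra as \<open>1 - e \<and> \<iota>\<^sub>\<phi>\<close>, which
  fixes the range of \<open>\<iota>\<^sub>\<phi>\<close>.\<close>

lemma contract_wedge_proj:
  assumes \<phi>: "clinear \<phi>" and e: "\<phi> e = 1"
  defines "p \<equiv> \<lambda>t. t - \<phi> t *\<^sub>C e"
  shows "contract \<phi> (wedge ts) = alt_sum (\<lambda>t us. \<phi> t *\<^sub>C wedge (map p us)) ts"
proof -
  note c = clinear_contract[OF \<phi>] and l = clinear_lwedge
  have p: "lwedge (p t) x = lwedge t x - \<phi> t *\<^sub>C lwedge e x" for t and x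
    by (simp add: p_def clinear_diff[OF clinear_lwedge_left] clinear_scale[OF clinear_lwedge_left])
  have ee: "lwedge e (lwedge e x) = 0" for x
    using lwedge_swap[of e e x] by (rule eq_neg_self_imp_0)
  have map: "wedge (map p us) = wedge us - lwedge e (contract \<phi> (wedge us))" for us
  proof (induction us)
    case Nil
    show ?case by (simp add: contract_wedge_alt[OF \<phi>] clinear_0[OF l])
  next
    case (Cons t us)
    have "wedge (map p (t # us)) = lwedge (p t) (wedge us - lwedge e (contract \<phi> (wedge us)))"
      by (simp add: lwedge_wedge Cons.IH[symmetric])
    also have "\<dots> = lwedge t (wedge us) - lwedge e (\<phi> t *\<^sub>C wedge us - lwedge t (contract \<phi> (wedge us)))"
      by (simp add: p clinear_diff[OF l] clinear_scale[OF l] ee lwedge_swap[of t e])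
    also have "\<dots> = wedge (t # us) - lwedge e (contract \<phi> (wedge (t # us)))"
      by (simp add: contract_lwedge[OF \<phi>] flip: lwedge_wedge)
    finally show ?case .
  qed
  have "alt_sum (\<lambda>t us. \<phi> t *\<^sub>C wedge (map p us)) ts
      = contract \<phi> (wedge ts) - lwedge e (contract \<phi> (contract \<phi> (wedge ts)))"
    by (simp add: map contract_wedge_alt[OF \<phi>] clinear_alt_sum[OF c] clinear_alt_sum[OF l] clinear_diff[OF l]
        clinear_scale[OF l] clinear_scale[OF c] complex_vector.scale_right_diff_distrib flip: alt_sum_diff)
  then show ?thesis by (simp add: contract_contract[OF \<phi>] clinear_0[OF l])
qed

text \<open>Moving the extracted factor from the front back to position i costs the sign that the
  alternating sum attaches to i, so all terms agree. This produces the summand r of the Koszul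
  identity.\<close>

lemma alt_sum_wedge_Cons: "alt_sum (\<lambda>t us. wedge (t # us)) ts = of_nat (length ts) *\<^sub>C wedge ts"
proof -
  have "(- 1) ^ i *\<^sub>C wedge (ts ! i # drop_nth i ts) = wedge ts" if "i < length ts" for i
  proof -
    have "wedge (ts ! i # drop_nth i ts) = (- 1) ^ i *\<^sub>C wedge (take i ts @ ts ! i # drop (Suc i) ts)"
      using alternating_move[OF alternating_wedge, of "[]" "ts ! i" "take i ts" "drop (Suc i) ts"] that
      by (simp add: drop_nth_def)
    moreover have "take i ts @ ts ! i # drop (Suc i) ts = ts" using that by (rule id_take_nth_drop[symmetric])
    ultimately show ?thesis by (simp add: scaleC_scaleC scaleC_one flip: power_mult_distrib)
  qed
  then show ?thesis by (simp add: alt_sum_def complex_vector.sum_constant_scale)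
qed

section \<open>Generators of exterior powers and of tensor products of subspaces\<close>

lemma cspan_image_induct:
  assumes "clinear f" "csubspace M" "\<And>x. x \<in> S \<Longrightarrow> f x \<in> M" "x \<in> cspan S"
  shows "f x \<in> M"
  using assms(4)
  by (induction rule: complex_vector.span_induct_alt)
    (auto simp: clinear_0[OF assms(1)] clinear_add[OF assms(1)] clinear_scale[OF assms(1)]
      complex_vector.subspace_0[OF assms(2)]
      intro!: complex_vector.subspace_add[OF assms(2)] complex_vector.subspace_scale[OF assms(2)] assms(3))

text \<open>A wedge is expanded one factor at a time: \<open>lwedge\<close> is linear in both
  arguments, so head and tail are reduced to generators separately.\<close>

lemma ext_power_cspan: "ext_power r (cspan T) = cspan {wedge ts | ts. length ts = r \<and> set ts \<subseteq> T}"
proof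
  let ?S = "\<lambda>r. cspan {wedge ts | ts. length ts = r \<and> set ts \<subseteq> T}"
  have "wedge ts \<in> ?S (length ts)" if "set ts \<subseteq> cspan T" for ts
    using that
  proof (induction ts)
    case Nil
    show ?case by (rule complex_vector.span_base) auto
  next
    case (Cons t ts)
    have s: "lwedge u (wedge us) \<in> ?S (Suc (length ts))"
      if "u \<in> T" "length us = length ts" "set us \<subseteq> T" for u us
      unfolding lwedge_wedge using that
      by (intro complex_vector.span_base CollectI exI[of _ "u # us"]) auto
    have ts: "wedge ts \<in> ?S (length ts)" and t: "t \<in> cspan T" using Cons by auto
    have "lwedge u (wedge ts) \<in> ?S (Suc (length ts))" if "u \<in> T" for u
      by (rule cspan_image_induct[OF clinear_lwedge complex_vector.subspace_span _ ts])
        (use s[OF that] in auto)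
    then have "lwedge t (wedge ts) \<in> ?S (Suc (length ts))"
      by (rule cspan_image_induct[OF clinear_lwedge_left complex_vector.subspace_span _ t])
    then show ?case by (simp add: lwedge_wedge)
  qed
  then show "ext_power r (cspan T) \<subseteq> ?S r"
    unfolding ext_power_def by (intro complex_vector.span_minimal) auto
  show "?S r \<subseteq> ext_power r (cspan T)"
    unfolding ext_power_def
    by (intro complex_vector.span_mono) (use complex_vector.span_superset[of T] in blast)
qed

text \<open>Pigeonhole on the generators. This bounds the length of the complex in
  \<open>chains_above_dimension\<close>.\<close>

lemma wedge_eq_0_of_card:
  assumes "finite T" "card T < length ts" "set ts \<subseteq> cspan T"
  shows "wedge ts = 0"
proof -
  have *: "wedge us = 0" if "length us = length ts" "set us \<subseteq> T" for us
  proof (rule wedge_eq_0)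
    show "\<not> distinct us"
      using that(1) assms(2) card_mono[OF assms(1) that(2)] distinct_card[of us] by linarith
  qed
  have "wedge ts \<in> ext_power (length ts) (cspan T)"
    unfolding ext_power_def by (rule complex_vector.span_base) (use assms(3) in auto)
  then show ?thesis unfolding ext_power_cspan by (rule cspan_kernel[OF clinear_id', rotated]) (use * in auto)
qed

lemma clinear_tensor: "clinear (\<lambda>a. a \<otimes> b)" "clinear (\<lambda>b. a \<otimes> b)"
  by (rule clinearI; simp add: tensor_bilinear)+

lemma tensor_sub_cspan: "cspan S \<otimes>\<^sub>s cspan U = cspan {a \<otimes> b | a b. a \<in> S \<and> b \<in> U}"
proof
  let ?M = "cspan {a \<otimes> b | a b. a \<in> S \<and> b \<in> U}"
  have M: "csubspace ?M" by simp
  have *: "a \<otimes> b \<in> ?M" if "a \<in> cspan S" "b \<in> cspan U" for a b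
  proof (rule cspan_image_induct[OF clinear_tensor(1) M _ that(1)])
    fix a assume "a \<in> S"
    then have "a \<otimes> u \<in> ?M" if "u \<in> U" for u
      using that by (intro complex_vector.span_base) auto
    then show "a \<otimes> b \<in> ?M"
      by (rule cspan_image_induct[OF clinear_tensor(2) M _ that(2)])
  qed
  have "{a \<otimes> b | a b. a \<in> cspan S \<and> b \<in> cspan U} \<subseteq> ?M"
    by (intro subsetI, elim CollectE exE conjE) (simp only: *)
  then show "cspan S \<otimes>\<^sub>s cspan U \<subseteq> ?M"
    unfolding tensor_sub_def by (rule complex_vector.span_minimal[OF _ M])
  have "{a \<otimes> b | a b. a \<in> S \<and> b \<in> U} \<subseteq> {a \<otimes> b | a b. a \<in> cspan S \<and> b \<in> cspan U}"
    using complex_vector.span_base[of _ S] complex_vector.span_base[of _ U] by fast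
  then show "?M \<subseteq> cspan S \<otimes>\<^sub>s cspan U"
    unfolding tensor_sub_def by (rule complex_vector.span_mono)
qed

section \<open>The Weyl algebra\<close>

lemma polyfn_induct [case_names const coord add mult]:
  fixes p :: "'n::finite polyfn"
  assumes "\<And>c. Q (c *\<^sub>C 1)" "\<And>i. Q (Abs_polyfn (\<lambda>x. x $ i))"
    and "\<And>p q. Q p \<Longrightarrow> Q q \<Longrightarrow> Q (p + q)" "\<And>p q. Q p \<Longrightarrow> Q q \<Longrightarrow> Q (p * q)"
  shows "Q p"
proof -
  have "Q (Abs_polyfn g)" if "g \<in> polyfuns" for g :: "complex ^ 'n \<Rightarrow> complex"
    using that
  proof (induction rule: polyfuns.induct)
    case (const c)
    have "Abs_polyfn (\<lambda>x :: complex ^ 'n. c) = c *\<^sub>C 1"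
      by (simp add: polyfuns.const Abs_polyfn_inverse scaleC_polyfn.rep_eq one_polyfn.rep_eq flip: peval_inject)
    then show ?case using assms(1) by simp
  next
    case (coord i)
    show ?case by (rule assms(2))
  next
    case (add p q)
    have "Abs_polyfn (\<lambda>x. p x + q x) = Abs_polyfn p + Abs_polyfn q"
      using add.hyps by (simp add: polyfuns.add Abs_polyfn_inverse plus_polyfn.rep_eq flip: peval_inject)
    then show ?case using assms(3) add.IH by simp
  next
    case (mult p q)
    have "Abs_polyfn (\<lambda>x. p x * q x) = Abs_polyfn p * Abs_polyfn q"
      using mult.hyps by (simp add: polyfuns.mult Abs_polyfn_inverse times_polyfn.rep_eq flip: peval_inject)
    then show ?case using assms(4) mult.IH by simp
  qed
  then show ?thesis using peval[of p] by (metis peval_inverse)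
qed

lemma vderiv_mult: "vderiv \<xi> (p * q) = vderiv \<xi> p * q + p * vderiv \<xi> q"
proof (rule vderiv_unique)
  fix x
  show "((\<lambda>t. peval (p * q) (x + t *s \<xi>)) has_field_derivative
      peval (vderiv \<xi> p * q + p * vderiv \<xi> q) x) (at 0)"
    using DERIV_mult[OF peval_vderiv[of p x \<xi>] peval_vderiv[of q x \<xi>]]
    by (simp add: times_polyfn.rep_eq plus_polyfn.rep_eq algebra_simps)
qed

lemma vderiv_affine:
  assumes "affine_fn f"
  shows "vderiv \<xi> f = pairing \<xi> f *\<^sub>C 1"
proof (rule vderiv_unique)
  fix x
  have "pairing (t *s \<xi>) f = t * pairing \<xi> f" for t
    using clinear_scale[OF clinear_pairing(1), of t \<xi> f] by (simp add: scaleC_vec_eq scaleC_complex_def)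
  then show "((\<lambda>t. peval f (x + t *s \<xi>)) has_field_derivative peval (pairing \<xi> f *\<^sub>C 1) x) (at 0)"
    unfolding pairing_affine[OF assms] scaleC_polyfn.rep_eq one_polyfn.rep_eq
    by (auto intro!: derivative_eq_intros)
qed

lemma affine_fn_const: "affine_fn (c *\<^sub>C 1)"
  unfolding affine_fn_def scaleC_polyfn.rep_eq one_polyfn.rep_eq
  by (rule exI[of _ 0], rule exI[of _ c]) simp

lemma peval_coord: "peval (Abs_polyfn (\<lambda>x. x $ i)) x = x $ i"
  by (simp add: Abs_polyfn_inverse polyfuns.coord)

lemma affine_fn_coord: "affine_fn (Abs_polyfn (\<lambda>x. x $ i))"
proof -
  have "x $ i = (\<Sum>j\<in>UNIV. axis i 1 $ j * x $ j) + 0" for x :: "complex ^ 'a"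
    by (simp add: axis_def if_distrib[of "\<lambda>u. u * _"] cong: if_cong)
  then show ?thesis unfolding affine_fn_def peval_coord by blast
qed

lemma affine_fn_add:
  assumes "affine_fn f" "affine_fn g"
  shows "affine_fn (f + g)"
proof -
  obtain a b c d where "\<And>x. peval f x = dot a x + c" "\<And>x. peval g x = dot b x + d"
    using assms by (auto simp: affine_fn_def dot_def)
  then have "peval (f + g) x = dot (a + b) x + (c + d)" for x
    by (simp add: plus_polyfn.rep_eq dot_def algebra_simps sum.distrib)
  then show ?thesis unfolding affine_fn_def dot_def by blast
qed

lemma affine_fn_scale:
  assumes "affine_fn f"
  shows "affine_fn (k *\<^sub>C f)"
proof -
  obtain a c where "\<And>x. peval f x = dot a x + c"
    using assms by (auto simp: affine_fn_def dot_def)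
  then have "peval (k *\<^sub>C f) x = dot (k *\<^sub>C a) x + k * c" for x
    by (simp add: scaleC_polyfn.rep_eq dot_def scaleC_vec_eq algebra_simps sum_distrib_left)
  then show ?thesis unfolding affine_fn_def dot_def by blast
qed

lemma pairing_const: "pairing \<xi> (c *\<^sub>C 1) = 0"
  using pairing_affine[OF affine_fn_const, of c 0 \<xi>] by (simp add: scaleC_polyfn.rep_eq one_polyfn.rep_eq)

lemma vderiv_const: "vderiv \<xi> (c *\<^sub>C 1) = 0"
  by (simp add: vderiv_affine[OF affine_fn_const] pairing_const)

text \<open>Induction over polynomials: first derivatives of coordinates are constants, and for a
  product the two orders of differentiation yield the same terms.\<close>

lemma vderiv_commute: "vderiv \<xi> (vderiv \<zeta> p) = vderiv \<zeta> (vderiv \<xi> p)"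
proof (induction p rule: polyfn_induct)
  case (const c)
  show ?case by (simp add: vderiv_const clinear_0[OF clinear_vderiv])
next
  case (coord i)
  show ?case by (simp add: vderiv_affine[OF affine_fn_coord] vderiv_const)
next
  case (add p q)
  then show ?case by (simp add: clinear_add[OF clinear_vderiv])
next
  case (mult p q)
  then show ?case by (simp add: vderiv_mult clinear_add[OF clinear_vderiv] algebra_simps)
qed

text \<open>The standard symplectic form on linear symbols, extended to affine functions with the
  constants in its radical. By \<open>weyl_commutator\<close> it is the commutator in the Weyl
  algebra, and each \<open>lagrangian \<C> \<alpha>\<close> is isotropic for it.\<close>

definition symp :: "(complex ^ 'n) \<times> 'n::finite polyfn \<Rightarrow> (complex ^ 'n) \<times> 'n polyfn \<Rightarrow> complex"
  where "symp t s = pairing (fst t) (snd s) - pairing (fst s) (snd t)"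

abbreviation affine_ops :: "((complex ^ 'n) \<times> 'n::finite polyfn) set"
  where "affine_ops \<equiv> UNIV \<times> Collect affine_fn"

text \<open>The derivations commute, and so do the multiplications. What remains of the Leibniz rule
  are derivatives of affine functions, which are scalars.\<close>

lemma weyl_commutator:
  assumes "t \<in> affine_ops" "s \<in> affine_ops"
  shows "weyl_embed t * weyl_embed s = weyl_embed s * weyl_embed t + symp t s *\<^sub>C 1"
proof -
  obtain \<xi> f \<zeta> g where ts: "t = (\<xi>, f)" "s = (\<zeta>, g)" by fastforce
  then have d: "vderiv \<zeta> f = pairing \<zeta> f *\<^sub>C 1" "vderiv \<xi> g = pairing \<xi> g *\<^sub>C 1"
    using assms by (auto simp: vderiv_affine)
  show ?thesis
  proof (rule weyl_apply_inject[THEN iffD1], rule ext)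
    fix p
    have "weyl_apply (weyl_embed t * weyl_embed s) p =
        vderiv \<xi> (vderiv \<zeta> p) + (vderiv \<xi> g * p + g * vderiv \<xi> p) + f * vderiv \<zeta> p + f * (g * p)"
      by (simp add: ts weyl_embed_def times_weyl.rep_eq plus_weyl.rep_eq weyl_deriv.rep_eq
          weyl_mult.rep_eq clinear_add[OF clinear_vderiv] vderiv_mult distrib_left add_ac)
    moreover have "weyl_apply (weyl_embed s * weyl_embed t) p =
        vderiv \<zeta> (vderiv \<xi> p) + (vderiv \<zeta> f * p + f * vderiv \<zeta> p) + g * vderiv \<xi> p + g * (f * p)"
      by (simp add: ts weyl_embed_def times_weyl.rep_eq plus_weyl.rep_eq weyl_deriv.rep_eq
          weyl_mult.rep_eq clinear_add[OF clinear_vderiv] vderiv_mult distrib_left add_ac)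
    moreover have "weyl_apply (symp t s *\<^sub>C 1) p = vderiv \<xi> g * p - vderiv \<zeta> f * p"
      by (simp add: scaleC_weyl.rep_eq one_weyl.rep_eq minus_weyl.rep_eq symp_def ts d polyfn_scale_mult
          complex_vector.scale_left_diff_distrib)
    ultimately show "weyl_apply (weyl_embed t * weyl_embed s) p =
        weyl_apply (weyl_embed s * weyl_embed t + symp t s *\<^sub>C 1) p"
      by (simp add: plus_weyl.rep_eq vderiv_commute[of \<xi> \<zeta>] mult.left_commute algebra_simps)
  qed
qed

section \<open>Words and the Bernstein filtration\<close>

definition word :: "((complex ^ 'n) \<times> 'n polyfn) list \<Rightarrow> 'n::finite weyl"
  where "word ws = prod_list (map weyl_embed ws)"

lemma word_simps [simp]:
  "word [] = 1" "word (w # ws) = weyl_embed w * word ws" "word (us @ ws) = word us * word ws"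
  by (simp_all add: word_def)

text \<open>The Bernstein filtration, indexed so that \<open>words q\<close> has degree less than \<open>q\<close> and \<open>words 0\<close> is \<open>0\<close>.\<close>

definition words :: "nat \<Rightarrow> 'n::finite weyl set"
  where "words q = cspan {word ws | ws. set ws \<subseteq> affine_ops \<and> length ws < q}"

lemma csubspace_words: "csubspace (words q)"
  by (simp add: words_def)

lemma word_in_words: "set ws \<subseteq> affine_ops \<Longrightarrow> length ws < q \<Longrightarrow> word ws \<in> words q"
  unfolding words_def by (rule complex_vector.span_base) blast

lemma words_mono: "q \<le> q' \<Longrightarrow> words q \<subseteq> words q'"
  unfolding words_def by (rule complex_vector.span_mono) fastforce

lemma clinear_weyl_times_right: "clinear (\<lambda>Q. Q * P)" for P :: "'n::finite weyl"
  by (rule clinearI) (simp_all add: distrib_right weyl_scale_mult)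

lemma clinear_commutator: "clinear (\<lambda>P. P * Q - Q * P)" for Q :: "'n::finite weyl"
  by (rule clinearI)
    (simp_all add: distrib_right distrib_left weyl_scale_mult complex_vector.scale_right_diff_distrib)

lemma words_times:
  assumes "P \<in> words q" "Q \<in> words q'"
  shows "P * Q \<in> words (q + q')"
proof (rule cspan_image_induct[OF clinear_weyl_times_right csubspace_words _ assms(1)[unfolded words_def]])
  fix P :: "'a weyl" assume "P \<in> {word ws | ws. set ws \<subseteq> affine_ops \<and> length ws < q}"
  then obtain us where us: "P = word us" "set us \<subseteq> affine_ops" "length us < q" by blast
  show "P * Q \<in> words (q + q')"
  proof (rule cspan_image_induct[OF clinear_weyl_times csubspace_words _ assms(2)[unfolded words_def]])
    fix Q :: "'a weyl" assume "Q \<in> {word ws | ws. set ws \<subseteq> affine_ops \<and> length ws < q'}"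
    then obtain ws where ws: "Q = word ws" "set ws \<subseteq> affine_ops" "length ws < q'" by blast
    have "word (us @ ws) \<in> words (q + q')"
      by (rule word_in_words) (use us(2,3) ws(2,3) in auto)
    then show "P * Q \<in> words (q + q')" by (simp add: us(1) ws(1))
  qed
qed

text \<open>The filtration is exhaustive, so that a descent on degree can start at any chain. The
  induction follows the generation of polynomials, then that of differential operators.\<close>

lemma ex_words: "\<exists>q. P \<in> words q" for P :: "'n::finite weyl"
proof -
  have ex_add: "\<exists>q. P + Q \<in> words q" if "\<exists>q. P \<in> words q" "\<exists>q. Q \<in> words q" for P Q :: "'n weyl"
  proof -
    note ex = that
    obtain p q where "P \<in> words p" "Q \<in> words q" using ex by blast
    then have "P \<in> words (max p q)" "Q \<in> words (max p q)"
      using words_mono[of p "max p q"] words_mono[of q "max p q"] by auto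
    then show ?thesis using complex_vector.subspace_add[OF csubspace_words] by blast
  qed
  have m: "\<exists>q. weyl_mult p \<in> words q" for p :: "'n polyfn"
  proof (induction p rule: polyfn_induct)
    case (const c)
    have "weyl_mult (c *\<^sub>C 1) = c *\<^sub>C word ([] :: ((complex ^ 'n) \<times> 'n polyfn) list)"
      by (rule weyl_apply_inject[THEN iffD1])
        (simp add: weyl_mult.rep_eq scaleC_weyl.rep_eq one_weyl.rep_eq polyfn_scale_mult fun_eq_iff)
    moreover have "c *\<^sub>C word ([] :: ((complex ^ 'n) \<times> 'n polyfn) list) \<in> words 1"
      by (intro complex_vector.subspace_scale[OF csubspace_words] word_in_words) auto
    ultimately show ?case by metis
  next
    case (coord i)
    let ?w = "(0, Abs_polyfn (\<lambda>x. x $ i))"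
    have "weyl_deriv (0 :: complex ^ 'n) = 0"
      using weyl_deriv_linear(2)[of 0 "0 :: complex ^ 'n"] by simp
    then have "weyl_mult (Abs_polyfn (\<lambda>x :: complex ^ 'n. x $ i)) = word [?w]"
      by (simp add: weyl_embed_def)
    moreover have "word [?w] \<in> words 2"
      by (rule word_in_words) (auto simp: affine_fn_coord)
    ultimately show ?case by metis
  next
    case (add p q)
    then show ?case by (simp add: weyl_mult_linear ex_add)
  next
    case (mult p q)
    have "weyl_mult (p * q) = weyl_mult p * weyl_mult q"
      by (rule weyl_apply_inject[THEN iffD1]) (simp add: weyl_mult.rep_eq times_weyl.rep_eq fun_eq_iff mult.assoc)
    then show ?case using mult words_times by metis
  qed
  have d: "\<exists>q. weyl_deriv \<xi> \<in> words q" for \<xi> :: "complex ^ 'n"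
  proof -
    have "weyl_mult (0 :: 'n polyfn) = 0"
      using weyl_mult_linear(2)[of 0 "0 :: 'n polyfn"] by simp
    then have "weyl_deriv \<xi> = word [(\<xi>, 0)]" by (simp add: weyl_embed_def)
    moreover have "word [(\<xi>, 0 :: 'n polyfn)] \<in> words 2"
      by (rule word_in_words) (use affine_fn_const[of 0] in auto)
    ultimately show ?thesis by metis
  qed
  have "\<exists>q. Abs_weyl g \<in> words q" if "g \<in> diffops" for g :: "'n polyfn \<Rightarrow> 'n polyfn"
    using that
  proof (induction rule: diffops.induct)
    case (mult p)
    then show ?case using m[of p] by (simp add: weyl_mult_def)
  next
    case (deriv \<xi>)
    then show ?case using d[of \<xi>] by (simp add: weyl_deriv_def)
  next
    case (add P Q)
    have "Abs_weyl (\<lambda>g. P g + Q g) = Abs_weyl P + Abs_weyl Q"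
      using add.hyps by (simp add: diffops.add Abs_weyl_inverse plus_weyl.rep_eq flip: weyl_apply_inject)
    then show ?case using ex_add add.IH by simp
  next
    case (comp P Q)
    have "Abs_weyl (\<lambda>g. P (Q g)) = Abs_weyl P * Abs_weyl Q"
      using comp.hyps by (simp add: diffops.comp Abs_weyl_inverse times_weyl.rep_eq flip: weyl_apply_inject)
    then show ?case using comp.IH words_times by metis
  qed
  then show ?thesis using weyl_apply[of P] by (metis weyl_apply_inverse)
qed

text \<open>The commutator with \<open>s\<close> is a derivation sending every letter to a scalar,
  so each term loses one letter. The alphabet \<open>S\<close> is carried along because the rule is
  applied both to words in a Lagrangian subspace and to arbitrary words.\<close>

lemma word_commutator:
  assumes "set ws \<subseteq> S" "S \<subseteq> affine_ops" "s \<in> affine_ops"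
  shows "word ws * weyl_embed s - weyl_embed s * word ws
    \<in> cspan {word us | us. set us \<subseteq> S \<and> Suc (length us) = length ws}"
  using assms(1)
proof (induction ws)
  case Nil
  show ?case by (simp add: complex_vector.span_zero)
next
  case (Cons w ws)
  let ?M = "cspan {word us | us. set us \<subseteq> S \<and> Suc (length us) = length (w # ws)}"
  have "weyl_embed w * weyl_embed s = weyl_embed s * weyl_embed w + symp w s *\<^sub>C 1"
    using Cons.prems assms(2,3) by (intro weyl_commutator) auto
  then have "word (w # ws) * weyl_embed s - weyl_embed s * word (w # ws) =
      weyl_embed w * (word ws * weyl_embed s - weyl_embed s * word ws) + symp w s *\<^sub>C word ws"
    by (simp add: right_diff_distrib mult.assoc weyl_scale_mult distrib_right flip: mult.assoc)
  moreover have "word ws \<in> ?M" using Cons.prems by (intro complex_vector.span_base) auto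
  moreover have "weyl_embed w * P \<in> ?M"
    if P: "P \<in> cspan {word us | us. set us \<subseteq> S \<and> Suc (length us) = length ws}" for P
  proof (rule cspan_image_induct[OF clinear_weyl_times complex_vector.subspace_span _ P])
    fix P assume "P \<in> {word us | us. set us \<subseteq> S \<and> Suc (length us) = length ws}"
    then obtain us where us: "P = word us" "set us \<subseteq> S" "Suc (length us) = length ws" by blast
    show "weyl_embed w * P \<in> ?M"
      by (rule complex_vector.span_base) (use us Cons.prems in \<open>auto intro!: exI[of _ "w # us"]\<close>)
  qed
  ultimately show ?case
    using Cons by (auto intro!: complex_vector.span_add complex_vector.span_scale)
qed

lemma words_commutator:
  assumes "P \<in> words (Suc q)" "s \<in> affine_ops"
  shows "P * weyl_embed s - weyl_embed s * P \<in> words q"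
proof (rule cspan_image_induct[OF clinear_commutator csubspace_words _ assms(1)[unfolded words_def]])
  fix P :: "'a weyl" assume "P \<in> {word ws | ws. set ws \<subseteq> affine_ops \<and> length ws < Suc q}"
  then obtain ws where ws: "P = word ws" "set ws \<subseteq> affine_ops" "length ws < Suc q" by blast
  have "{word us | us. set us \<subseteq> affine_ops \<and> Suc (length us) = length ws}
      \<subseteq> {word us | us. set us \<subseteq> affine_ops \<and> length us < q}"
    using ws(3) by fastforce
  then show "P * weyl_embed s - weyl_embed s * P \<in> words q"
    using word_commutator[OF ws(2) order_refl assms(2)] complex_vector.span_mono
    unfolding ws(1) words_def by blast
qed

section \<open>Darboux bases, normal ordering and the Euler operator\<close>

locale darboux_basis =
  fixes L :: "((complex ^ 'n) \<times> 'n::finite polyfn) set"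
    and t s :: "'n \<Rightarrow> (complex ^ 'n) \<times> 'n polyfn"
  assumes L_affine: "L \<subseteq> affine_ops"
    and t_in: "t i \<in> L" and s_in: "s i \<in> affine_ops"
    and L_isotropic: "u \<in> L \<Longrightarrow> w \<in> L \<Longrightarrow> symp u w = 0"
    and s_isotropic: "symp (s i) (s j) = 0"
    and t_basis: "u \<in> L \<Longrightarrow> u = (\<Sum>i\<in>UNIV. symp u (s i) *\<^sub>C t i)"
    and generate: "w \<in> affine_ops \<Longrightarrow> weyl_embed w \<in> cspan (insert 1 (weyl_embed ` (L \<union> range s)))"
begin

text \<open>Letters from \<open>L\<close> stand on the right, the side on which \<open>d1\<close>
  and \<open>euler\<close> multiply. They may be arbitrary elements of \<open>L\<close>, not only
  the basis vectors \<open>t i\<close>.\<close>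

definition normal_words :: "nat \<Rightarrow> 'n weyl set"
  where "normal_words q = {word us * word ts | us ts.
    set us \<subseteq> range s \<and> set ts \<subseteq> L \<and> length us + length ts < q}"

text \<open>By \<open>generate\<close> the new letter may be taken as \<open>1\<close>, an element
  of \<open>L\<close> or some \<open>s i\<close>. Only the last disturbs the order: it is moved to
  the left past the word in \<open>L\<close>, and the commutator merely deletes a letter of that
  word, so the correction is again normally ordered.\<close>

lemma normal_words_times:
  assumes P: "P \<in> cspan (normal_words q)" and w: "w \<in> affine_ops"
  shows "P * weyl_embed w \<in> cspan (normal_words (Suc q))"
proof (rule cspan_image_induct[OF clinear_weyl_times_right complex_vector.subspace_span _ P])
  fix P assume "P \<in> normal_words q"
  then obtain us ts where P: "P = word us * word ts" "set us \<subseteq> range s" "set ts \<subseteq> L" "length us + length ts < q"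
    unfolding normal_words_def by blast
  let ?M = "cspan (normal_words (Suc q))"
  have base: "word us' * word ts' \<in> ?M"
    if "set us' \<subseteq> range s" "set ts' \<subseteq> L" "length us' + length ts' < Suc q" for us' ts'
    using that by (intro complex_vector.span_base) (auto simp: normal_words_def)
  show "P * weyl_embed w \<in> ?M"
  proof (rule cspan_image_induct[OF clinear_weyl_times complex_vector.subspace_span _ generate[OF w]])
    fix Q assume "Q \<in> insert 1 (weyl_embed ` (L \<union> range s))"
    then consider "Q = 1" | u where "u \<in> L" "Q = weyl_embed u" | i where "Q = weyl_embed (s i)" by blast
    then show "P * Q \<in> ?M"
    proof cases
      case 1
      then show ?thesis using base[of us ts] P by simp
    next
      case 2
      then show ?thesis using base[of us "ts @ [u]"] P by (simp add: mult.assoc)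
    next
      case 3
      let ?D = "word ts * weyl_embed (s i) - weyl_embed (s i) * word ts"
      have eq: "P * Q = word (us @ [s i]) * word ts + word us * ?D"
        by (simp add: P(1) 3 mult.assoc right_diff_distrib)
      have "word us * ?D \<in> ?M"
      proof (rule cspan_image_induct[OF clinear_weyl_times complex_vector.subspace_span _
            word_commutator[OF P(3) L_affine s_in]])
        fix D assume "D \<in> {word us |us. set us \<subseteq> L \<and> Suc (length us) = length ts}"
        then obtain ts' where "D = word ts'" "set ts' \<subseteq> L" "Suc (length ts') = length ts" by blast
        then show "word us * D \<in> ?M" using base[of us ts'] P by simp
      qed
      moreover have "word (us @ [s i]) * word ts \<in> ?M" by (rule base) (use P in auto)
      ultimately show ?thesis unfolding eq by (intro complex_vector.span_add)
    qed
  qed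
qed

text \<open>The spanning half of a Poincare-Birkhoff-Witt theorem, with the bound on the degree
  preserved.\<close>

lemma words_normal: "words q \<subseteq> cspan (normal_words q)"
proof -
  have w: "word ws \<in> cspan (normal_words (Suc (length ws)))" if "set ws \<subseteq> affine_ops" for ws
    using that
  proof (induction ws rule: rev_induct)
    case Nil
    have "word [] * word [] \<in> normal_words (Suc 0)" unfolding normal_words_def by force
    then show ?case by (simp add: complex_vector.span_base)
  next
    case (snoc w ws)
    then show ?case using normal_words_times[of "word ws" "Suc (length ws)" w] by simp
  qed
  have mono: "normal_words p \<subseteq> normal_words q" if "p \<le> q" for p
    using that unfolding normal_words_def by fastforce
  have "word ws \<in> cspan (normal_words q)" if "set ws \<subseteq> affine_ops" "length ws < q" for ws
    using w[OF that(1)] complex_vector.span_mono[OF mono[of "Suc (length ws)"]] that(2) by auto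
  then have "{word ws | ws. set ws \<subseteq> affine_ops \<and> length ws < q} \<subseteq> cspan (normal_words q)" by blast
  then show ?thesis unfolding words_def by (rule complex_vector.span_minimal) simp
qed

text \<open>The Euler field of the variables \<open>t i\<close>, with the commutator in the place of
  the partial derivative. Being written with commutators, it does not depend on how \<open>P\<close>
  is expressed by normally ordered monomials.\<close>

definition euler :: "'n weyl \<Rightarrow> 'n weyl"
  where "euler P = (\<Sum>i\<in>UNIV. (P * weyl_embed (s i) - weyl_embed (s i) * P) * weyl_embed (t i))"

text \<open>Leibniz rule: \<open>u\<close> commutes with every \<open>t i\<close> because
  \<open>L\<close> is isotropic, and the extra terms \<open>symp u (s i)\<close> are the coordinates
  of \<open>u\<close>, which add up to one further copy of \<open>P * weyl_embed u\<close>.\<close>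

lemma euler_times:
  assumes "u \<in> L"
  shows "euler (P * weyl_embed u) = euler P * weyl_embed u + P * weyl_embed u"
proof -
  let ?e = weyl_embed
  have us: "?e u * ?e (s i) = ?e (s i) * ?e u + symp u (s i) *\<^sub>C 1" for i
    using assms L_affine s_in by (intro weyl_commutator) auto
  have ut: "?e u * ?e (t i) = ?e (t i) * ?e u" for i
    using weyl_commutator[of u "t i"] L_isotropic[OF assms t_in] assms t_in L_affine by auto
  have s: "(P * ?e u * ?e (s i) - ?e (s i) * (P * ?e u)) * ?e (t i) =
      (P * ?e (s i) - ?e (s i) * P) * ?e (t i) * ?e u + P * (symp u (s i) *\<^sub>C ?e (t i))" for i
  proof -
    have "P * ?e u * ?e (s i) - ?e (s i) * (P * ?e u) =
        (P * ?e (s i) - ?e (s i) * P) * ?e u + symp u (s i) *\<^sub>C P"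
      by (simp add: mult.assoc us distrib_left left_diff_distrib weyl_scale_mult)
    then show ?thesis by (simp add: distrib_right mult.assoc ut weyl_scale_mult)
  qed
  have "?e u = (\<Sum>i\<in>UNIV. symp u (s i) *\<^sub>C ?e (t i))"
    using arg_cong[OF t_basis[OF assms], of ?e]
    by (simp add: clinear_sum[OF clinear_weyl_embed] clinear_scale[OF clinear_weyl_embed])
  then have "P * ?e u = (\<Sum>i\<in>UNIV. P * (symp u (s i) *\<^sub>C ?e (t i)))"
    by (simp only: sum_distrib_left)
  then show ?thesis
    unfolding euler_def s sum.distrib sum_distrib_right by simp
qed

text \<open>A word in the \<open>s i\<close> commutes with every \<open>s i\<close> and is killed;
  each letter from \<open>L\<close> then adds one by \<open>euler_times\<close>.\<close>

lemma euler_normal: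
  assumes "set us \<subseteq> range s" "set ts \<subseteq> L"
  shows "euler (word us * word ts) = of_nat (length ts) *\<^sub>C (word us * word ts)"
  using assms(2)
proof (induction ts rule: rev_induct)
  case Nil
  have "word us * weyl_embed (s i) = weyl_embed (s i) * word us" for i
    using assms(1)
  proof (induction us)
    case (Cons u us)
    then obtain j where j: "u = s j" by auto
    have "weyl_embed u * weyl_embed (s i) = weyl_embed (s i) * weyl_embed u"
      using weyl_commutator[of u "s i"] s_in[of j] s_in[of i] s_isotropic by (simp add: j)
    then show ?case using Cons by (simp add: mult.assoc) (simp flip: mult.assoc)
  qed simp
  then show ?case by (simp add: euler_def)
next
  case (snoc u ts)
  then show ?case
    using euler_times[of u "word us * word ts"]
    by (simp add: mult.assoc weyl_scale_mult scaleC_add_left scaleC_one add.commute flip: mult.assoc)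
qed

end

section \<open>Top forms along an edge\<close>

locale quiver_complex =
  fixes \<C> :: "(complex ^ 'n) set set"
    and V :: "(complex ^ 'n) set \<Rightarrow> 'v::complex_vector set"
    and A :: "(complex ^ 'n) set \<Rightarrow> (complex ^ 'n) set \<Rightarrow> 'v \<Rightarrow> 'v"
    and fr :: "(complex ^ 'n) set \<Rightarrow> (complex ^ 'n) set \<Rightarrow> 'n::finite polyfn"
    and xi :: "(complex ^ 'n) set \<Rightarrow> (complex ^ 'n) set \<Rightarrow> complex ^ 'n"
  assumes arr: "arrangement \<C>" and qui: "quiver \<C> V A" and fram: "edge_framing \<C> fr xi"
begin

abbreviation edge where "edge \<equiv> edge_fun fr xi"
abbreviation fmap where "fmap \<equiv> form_map fr xi"
abbreviation lagr where "lagr \<equiv> lagrangian \<C>"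

section \<open>Tangent spaces and affine functions along an edge\<close>

lemma fr_in:
  assumes "\<alpha> \<in> flats \<C>" "\<beta> \<in> flats \<C>" "\<alpha> \<succ> \<beta>"
  shows "fr \<beta> \<alpha> \<in> vanishing \<C> \<beta> - vanishing \<C> \<alpha>"
  using fram assms by (auto simp: edge_framing_def)

lemma xi_in:
  assumes "\<alpha> \<in> flats \<C>" "\<beta> \<in> flats \<C>" "\<alpha> \<succ> \<beta>"
  shows "xi \<alpha> \<beta> \<in> tangent \<alpha>" "xi \<alpha> \<beta> \<notin> tangent \<beta>"
  using fram assms by (auto simp: edge_framing_def)

lemma covers_subset: "\<alpha> \<succ> \<beta> \<Longrightarrow> \<beta> \<subseteq> \<alpha>"
  by (simp add: covers_def)

lemma tangent_covers: "\<alpha> \<in> flats \<C> \<Longrightarrow> \<beta> \<in> flats \<C> \<Longrightarrow> \<alpha> \<succ> \<beta> \<Longrightarrow> tangent \<beta> \<subseteq> tangent \<alpha>"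
  by (intro tangent_mono[OF arr] covers_subset)

lemma vanishing_covers:
  assumes "\<alpha> \<in> flats \<C>" "\<alpha> \<succ> \<beta>"
  shows "vanishing \<C> \<alpha> \<subseteq> vanishing \<C> \<beta>"
proof
  fix f assume f: "f \<in> vanishing \<C> \<alpha>"
  then have "peval f x = 0" if "x \<in> stratum \<C> \<beta>" for x
    using that vanishing_flat[OF arr assms(1) f] covers_subset[OF assms(2)] by (auto simp: stratum_def)
  then show "f \<in> vanishing \<C> \<beta>" using f by (simp add: vanishing_def)
qed

lemma tangent_breakdown:
  assumes "\<alpha> \<in> flats \<C>" "\<beta> \<in> flats \<C>" "\<alpha> \<succ> \<beta>"
    and x: "x \<in> tangent \<alpha>" "x \<notin> tangent \<beta>" and v: "v \<in> tangent \<alpha>"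
  obtains k where "v - k *\<^sub>C x \<in> tangent \<beta>"
proof -
  have S: "vec.subspace (tangent \<alpha>)" and T: "vec.subspace (tangent \<beta>)"
    using csubspace_tangent[OF arr] assms(1,2) by (simp_all add: csubspace_vec)
  then have spT: "vec.span (tangent \<beta>) = tangent \<beta>" by (simp only: vec.span_eq_iff)
  have sub: "vec.span (insert x (tangent \<beta>)) \<subseteq> tangent \<alpha>"
    by (rule vec.span_minimal[OF _ S]) (use x tangent_covers[OF assms(1-3)] in auto)
  moreover have "vec.dim (vec.span (insert x (tangent \<beta>))) \<ge> vec.dim (tangent \<alpha>)"
    using x(2) assms(3) by (simp add: vec.dim_span vec.dim_insert spT covers_def)
  ultimately have "vec.span (insert x (tangent \<beta>)) = tangent \<alpha>"
    using vec.subspace_dim_equal[OF vec.subspace_span S] by blast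
  then obtain k where "v - k *s x \<in> vec.span (tangent \<beta>)"
    using v vec.span_breakdown_eq by blast
  then show ?thesis using that by (simp add: spT scaleC_vec_eq)
qed

text \<open>A vector outside \<open>tangent \<beta>\<close> spans \<open>tangent \<alpha>\<close>
  modulo \<open>tangent \<beta>\<close>. If df killed it, df would vanish on all of
  \<open>tangent \<alpha>\<close>, contrary to \<open>pairing_edge\<close>.\<close>

lemma pairing_fr_eq_0:
  assumes "\<alpha> \<in> flats \<C>" "\<beta> \<in> flats \<C>" "\<alpha> \<succ> \<beta>" "v \<in> tangent \<alpha>" "pairing v (fr \<beta> \<alpha>) = 0"
  shows "v \<in> tangent \<beta>"
proof (rule ccontr)
  assume nv: "v \<notin> tangent \<beta>"
  obtain e where e: "e \<in> tangent \<alpha>" "pairing e (fr \<beta> \<alpha>) = 1"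
    using pairing_edge[OF arr assms(1,2) covers_subset[OF assms(3)] fr_in[OF assms(1-3)]] by blast
  obtain k where k: "e - k *\<^sub>C v \<in> tangent \<beta>"
    using tangent_breakdown[OF assms(1-4) nv e(1)] by blast
  have "pairing (e - k *\<^sub>C v) (fr \<beta> \<alpha>) = 0"
    using pairing_tangent[OF arr assms(2) _ k] fr_in[OF assms(1-3)] by blast
  then show False
    using e(2) assms(5) by (simp add: clinear_diff[OF clinear_pairing(1)] clinear_scale[OF clinear_pairing(1)])
qed

text \<open>\<open>f\<close> is zero on \<alpha> and constant along
  \<open>xi \<beta> \<alpha>\<close>, which spans the tangent space of \<beta> modulo that of
  \<alpha>. This is the dual of \<open>pairing_fr_eq_0\<close>; both enter
  \<open>edge_kernel\<close>.\<close>

lemma vanishing_of_pairing_xi: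
  assumes "\<alpha> \<in> flats \<C>" "\<beta> \<in> flats \<C>" "\<beta> \<succ> \<alpha>" "f \<in> vanishing \<C> \<alpha>" "pairing (xi \<beta> \<alpha>) f = 0"
  shows "f \<in> vanishing \<C> \<beta>"
proof -
  obtain x where x: "x \<in> \<alpha>" using assms(1) by (auto simp: flats_def)
  have aff: "affine_fn f" using assms(4) by (simp add: vanishing_def)
  have "peval f y = 0" if y: "y \<in> \<beta>" for y
  proof -
    have "y - x \<in> tangent \<beta>"
      using tangent_iff[OF arr assms(2), of x "y - x"] x y covers_subset[OF assms(3)] by auto
    then obtain k where k: "y - x - k *\<^sub>C xi \<beta> \<alpha> \<in> tangent \<alpha>"
      using tangent_breakdown[OF assms(2,1,3) xi_in[OF assms(2,1,3)]] by blast
    have "pairing (y - x - k *\<^sub>C xi \<beta> \<alpha>) f = 0" by (rule pairing_tangent[OF arr assms(1,4) k])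
    then have "pairing (y - x) f = 0"
      using assms(5) by (simp add: clinear_diff[OF clinear_pairing(1), of "y - x"] clinear_scale[OF clinear_pairing(1)])
    then show ?thesis
      using pairing_affine[OF aff, of x "y - x"] vanishing_flat[OF arr assms(1,4) x] by simp
  qed
  then show ?thesis using aff by (auto simp: vanishing_def stratum_def)
qed

section \<open>Exchange rules for top forms\<close>

lemma top_formD:
  assumes "\<omega> \<in> top_forms \<alpha>"
  shows "alternating_on (tangent \<alpha>) \<omega>" "length vs \<noteq> vec.dim (tangent \<alpha>) \<Longrightarrow> \<omega> vs = 0"
    "\<not> set vs \<subseteq> tangent \<alpha> \<Longrightarrow> \<omega> vs = 0"
  using assms by (auto simp: top_forms_def forms_def)

text \<open>The wedge of df with a top form has degree one more than the dimension. On lists of any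
  other length each term already contains a vanishing value of \<open>\<omega>\<close>.\<close>

lemma df_top_form_eq_0:
  assumes "\<alpha> \<in> flats \<C>" "\<omega> \<in> top_forms \<alpha>" "set vs \<subseteq> tangent \<alpha>"
  shows "alt_sum (\<lambda>v us. pairing v f * \<omega> us) vs = 0"
proof (cases "length vs = Suc (vec.dim (tangent \<alpha>))")
  case True
  show ?thesis
    by (rule alternating_vanish[OF alternating_wedge_functional[OF csubspace_tangent[OF arr assms(1)]
            clinear_pairing(1) top_formD(1)[OF assms(2)]] csubspace_tangent[OF arr assms(1)] assms(3)])
      (use True in simp)
next
  case False
  show ?thesis
    by (rule alt_sum_eq_0) (use False in \<open>auto simp: length_drop_nth intro!: top_formD(2)[OF assms(2)]\<close>)
qed

text \<open>Both rules evaluate the zero form df \<and> \<omega> on a list whose tail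
  \<open>us\<close> is killed by \<open>f\<close>, so that only the first two or three terms
  survive.\<close>

lemma
  assumes "\<alpha> \<in> flats \<C>" "\<omega> \<in> top_forms \<alpha>" "set us \<subseteq> tangent \<alpha>" "\<And>u. u \<in> set us \<Longrightarrow> pairing u f = 0"
    and "x \<in> tangent \<alpha>" "y \<in> tangent \<alpha>"
  shows top_form_exchange: "pairing x f * \<omega> (y # us) = pairing y f * \<omega> (x # us)"
    and top_form_exchange3: "z \<in> tangent \<alpha> \<Longrightarrow>
      pairing x f * \<omega> (y # z # us) - pairing y f * \<omega> (x # z # us) + pairing z f * \<omega> (x # y # us) = 0"
proof -
  have z: "alt_sum (\<lambda>v ws. pairing v f * h ws) us = 0" for h :: "(complex ^ 'n) list \<Rightarrow> complex"
    by (rule alt_sum_eq_0) (simp add: assms(4))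
  show "pairing x f * \<omega> (y # us) = pairing y f * \<omega> (x # us)"
    using df_top_form_eq_0[OF assms(1,2), of "x # y # us" f] assms(3,5,6) by (simp add: alt_sum_Cons z)
  show "pairing x f * \<omega> (y # z # us) - pairing y f * \<omega> (x # z # us) + pairing z f * \<omega> (x # y # us) = 0"
    if "z \<in> tangent \<alpha>"
    using df_top_form_eq_0[OF assms(1,2), of "x # y # z # us" f] assms(3,5,6) that
    by (simp add: alt_sum_Cons z)
qed

text \<open>With \<open>us\<close> fixed, the values of \<open>\<omega>\<close> are proportional to
  the 2 by 2 minors of \<open>f\<close> and \<open>g\<close>. The three-term rule for
  \<open>f\<close> first splits off \<open>x'\<close> and \<open>y'\<close>; the one for
  \<open>g\<close> then gathers \<open>x\<close> and \<open>y\<close>.\<close>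

lemma top_form_exchange2:
  assumes "\<alpha> \<in> flats \<C>" "\<omega> \<in> top_forms \<alpha>" "set us \<subseteq> tangent \<alpha>"
    and f: "\<And>u. u \<in> set us \<Longrightarrow> pairing u f = 0" and g: "\<And>u. u \<in> set us \<Longrightarrow> pairing u g = 0"
    and xy: "x \<in> tangent \<alpha>" "y \<in> tangent \<alpha>" "x' \<in> tangent \<alpha>" "y' \<in> tangent \<alpha>"
  shows "(pairing x f * pairing y g - pairing y f * pairing x g) * \<omega> (x' # y' # us) =
    (pairing x' f * pairing y' g - pairing y' f * pairing x' g) * \<omega> (x # y # us)"
proof -
  note F = top_form_exchange3[OF assms(1-3) f] and G = top_form_exchange3[OF assms(1-3) g]
  have "pairing x f * \<omega> (x' # y' # us) = pairing x' f * \<omega> (x # y' # us) - pairing y' f * \<omega> (x # x' # us)"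
    "pairing y f * \<omega> (x' # y' # us) = pairing x' f * \<omega> (y # y' # us) - pairing y' f * \<omega> (y # x' # us)"
    using F[of x x' y'] F[of y x' y'] xy by (simp_all add: algebra_simps)
  moreover have "pairing y g * \<omega> (x # y' # us) - pairing x g * \<omega> (y # y' # us) = pairing y' g * \<omega> (x # y # us)"
    "pairing y g * \<omega> (x # x' # us) - pairing x g * \<omega> (y # x' # us) = pairing x' g * \<omega> (x # y # us)"
    using G[of x y y'] G[of x y x'] xy by (simp_all add: algebra_simps)
  ultimately show ?thesis by algebra
qed

section \<open>The form maps in terms of values on vectors\<close>

lemma fmap_top:
  assumes "\<alpha> \<in> flats \<C>" "\<beta> \<in> flats \<C>" "adjacent \<beta> \<alpha>" "\<omega> \<in> top_forms \<alpha>"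
  shows "fmap \<beta> \<alpha> \<omega> \<in> top_forms \<beta>"
  by (rule form_map_top[OF arr fram assms])

text \<open>Evaluate df \<and> \<eta> = \<omega> on \<open>x # us\<close>: as df vanishes on
  \<open>tangent \<beta>\<close>, only the first term survives, and the extension \<eta> is then
  needed on \<open>tangent \<beta>\<close> only, where it equals the image form.\<close>

lemma fmap_down:
  assumes "\<alpha> \<in> flats \<C>" "\<beta> \<in> flats \<C>" "\<alpha> \<succ> \<beta>" "\<omega> \<in> top_forms \<alpha>"
    and x: "x \<in> tangent \<alpha>" and us: "set us \<subseteq> tangent \<beta>"
  shows "pairing x (fr \<beta> \<alpha>) * fmap \<beta> \<alpha> \<omega> us = \<omega> (x # us)"
proof -
  have "form_rel fr xi \<beta> \<alpha> \<omega> (fmap \<beta> \<alpha> \<omega>)"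
    using form_map_iff[OF arr fram assms(1,2) _ assms(4)] assms(3) by (auto simp: adjacent_def)
  then obtain \<eta> where \<eta>: "\<And>vs. set vs \<subseteq> tangent \<beta> \<Longrightarrow> \<eta> vs = fmap \<beta> \<alpha> \<omega> vs"
    "df_wedge (tangent \<alpha>) (fr \<beta> \<alpha>) \<eta> = \<omega>"
    using assms(3) by (auto simp: form_rel_def)
  have "alt_sum (\<lambda>v ws. pairing v (fr \<beta> \<alpha>) * \<eta> (x # ws)) us = 0"
  proof (rule alt_sum_eq_0)
    fix i assume "i < length us"
    then have "us ! i \<in> tangent \<beta>" using us by auto
    then have "pairing (us ! i) (fr \<beta> \<alpha>) = 0"
      using pairing_tangent[OF arr assms(2)] fr_in[OF assms(1-3)] by blast
    then show "pairing (us ! i) (fr \<beta> \<alpha>) * \<eta> (x # drop_nth i us) = 0" by simp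
  qed
  moreover have "set (x # us) \<subseteq> tangent \<alpha>" using x us tangent_covers[OF assms(1-3)] by auto
  ultimately have "df_wedge (tangent \<alpha>) (fr \<beta> \<alpha>) \<eta> (x # us) = pairing x (fr \<beta> \<alpha>) * \<eta> us"
    by (simp add: df_wedge_def alt_sum_Cons)
  then show ?thesis by (simp only: \<eta>(1)[OF us] \<eta>(2))
qed

lemma fmap_up_xi:
  assumes "\<alpha> \<in> flats \<C>" "\<beta> \<in> flats \<C>" "\<beta> \<succ> \<alpha>" "\<omega> \<in> top_forms \<alpha>" "set us \<subseteq> tangent \<alpha>"
  shows "fmap \<beta> \<alpha> \<omega> (xi \<beta> \<alpha> # us) = \<omega> us"
proof -
  have "form_rel fr xi \<beta> \<alpha> \<omega> (fmap \<beta> \<alpha> \<omega>)"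
    using form_map_iff[OF arr fram assms(1,2) _ assms(4)] assms(3) by (auto simp: adjacent_def)
  moreover have "\<not> \<alpha> \<succ> \<beta>" using assms(3) by (auto simp: covers_def)
  ultimately show ?thesis using assms(5) by (simp add: form_rel_def)
qed

text \<open>The definition fixes the image form on lists that start with
  \<open>xi \<beta> \<alpha>\<close>. Exchanging this vector for any \<open>x\<close> costs the
  pairings with \<open>f\<close>, and in this shape the framing cancels in the path
  computations.\<close>

lemma fmap_up:
  assumes "\<alpha> \<in> flats \<C>" "\<beta> \<in> flats \<C>" "\<beta> \<succ> \<alpha>" "\<omega> \<in> top_forms \<alpha>" "set us \<subseteq> tangent \<alpha>"
    and f: "f \<in> vanishing \<C> \<alpha>" and x: "x \<in> tangent \<beta>"
  shows "pairing (xi \<beta> \<alpha>) f * fmap \<beta> \<alpha> \<omega> (x # us) = pairing x f * \<omega> us"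
proof -
  have "pairing x f * fmap \<beta> \<alpha> \<omega> (xi \<beta> \<alpha> # us) = pairing (xi \<beta> \<alpha>) f * fmap \<beta> \<alpha> \<omega> (x # us)"
  proof (rule top_form_exchange[OF assms(2)])
    show "fmap \<beta> \<alpha> \<omega> \<in> top_forms \<beta>" using assms by (intro fmap_top) (auto simp: adjacent_def)
    show "pairing u f = 0" if "u \<in> set us" for u
      using that assms(5) pairing_tangent[OF arr assms(1) f] by auto
  qed (use assms x tangent_covers[OF assms(2,1,3)] xi_in[OF assms(2,1,3)] in auto)
  then show ?thesis by (simp add: fmap_up_xi[OF assms(1-5)])
qed

text \<open>\<open>\<theta>\<close> and \<open>0\<close> are both images of the zero form under the
  form map going up, and that image is unique.\<close>

lemma top_form_eq_0:
  assumes "\<beta> \<in> flats \<C>" "\<alpha> \<in> flats \<C>" "\<beta> \<succ> \<alpha>" "\<theta> \<in> top_forms \<beta>"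
    and "\<And>us. set us \<subseteq> tangent \<alpha> \<Longrightarrow> \<theta> (xi \<beta> \<alpha> # us) = 0"
  shows "\<theta> = 0"
proof -
  have n: "\<not> \<alpha> \<succ> \<beta>" and adj: "adjacent \<beta> \<alpha>" using assms(3) by (auto simp: covers_def adjacent_def)
  have 0: "0 \<in> top_forms \<alpha>" "0 \<in> top_forms \<beta>"
    using csubspace_top_forms by (auto intro: complex_vector.subspace_0)
  note iff = form_map_iff[OF arr fram assms(2,1) adj 0(1), THEN iffD2]
  have "fmap \<beta> \<alpha> 0 = \<theta>"
    by (rule iff) (simp add: form_rel_def n assms(4,5))
  moreover have "fmap \<beta> \<alpha> 0 = 0"
    by (rule iff) (simp add: form_rel_def n 0(2))
  ultimately show ?thesis by simp
qed

lemma top_form_contract: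
  assumes "\<beta> \<in> flats \<C>" "\<alpha> \<in> flats \<C>" "\<beta> \<succ> \<alpha>" "\<theta> \<in> top_forms \<beta>" "x \<in> tangent \<beta>"
  shows "(\<lambda>us. if set us \<subseteq> tangent \<alpha> then \<theta> (x # us) else 0) \<in> top_forms \<alpha>"
proof -
  let ?S = "tangent \<beta>" and ?T = "tangent \<alpha>"
  have TS: "?T \<subseteq> ?S" by (rule tangent_covers[OF assms(1-3)])
  have T: "csubspace ?T" by (rule csubspace_tangent[OF arr assms(2)])
  note alt = top_formD(1)[OF assms(4)]
  have "alternating_on ?T (\<lambda>us. if set us \<subseteq> ?T then \<theta> (x # us) else 0)"
    unfolding alternating_on_def
  proof (intro conjI allI impI; elim conjE)
    fix us ws assume uw: "set us \<subseteq> ?T" "set ws \<subseteq> ?T"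
    then have "set (x # us) \<subseteq> ?S" "set ws \<subseteq> ?S" using TS assms(5) by auto
    then have "clinear_on ?S (\<lambda>y. \<theta> ((x # us) @ y # ws))"
      using alt unfolding alternating_on_def by blast
    then have lin: "clinear_on ?T (\<lambda>y. \<theta> (x # us @ y # ws))"
      using TS unfolding clinear_on_def append_Cons by (meson subsetD)
    show "clinear_on ?T (\<lambda>y. if set (us @ y # ws) \<subseteq> ?T then \<theta> (x # us @ y # ws) else 0)"
      using lin T uw
      by (simp add: clinear_on_def complex_vector.subspace_add complex_vector.subspace_scale)
  next
    fix vs assume vs: "set vs \<subseteq> ?T" "\<not> distinct vs"
    then have "set (x # vs) \<subseteq> ?S" "\<not> distinct (x # vs)" using TS assms(5) by auto
    then have "\<theta> (x # vs) = 0" using alt unfolding alternating_on_def by blast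
    then show "(if set vs \<subseteq> ?T then \<theta> (x # vs) else 0) = 0" by simp
  qed
  moreover have "\<theta> (x # vs) = 0" if "length vs \<noteq> vec.dim ?T" for vs
    using that assms(3) by (intro top_formD(2)[OF assms(4)]) (simp add: covers_def)
  ultimately show ?thesis by (auto simp: top_forms_def forms_def)
qed

text \<open>The test of \<open>top_form_eq_0\<close> applied twice, the second time to the
  contraction of \<open>\<theta>\<close> with \<open>xi \<gamma> \<beta>\<close>.\<close>

lemma top_form_eq_0_2:
  assumes "\<gamma> \<in> flats \<C>" "\<beta> \<in> flats \<C>" "\<alpha> \<in> flats \<C>" "\<gamma> \<succ> \<beta>" "\<beta> \<succ> \<alpha>" "\<theta> \<in> top_forms \<gamma>"
    and 0: "\<And>x y us. x \<in> tangent \<gamma> \<Longrightarrow> y \<in> tangent \<gamma> \<Longrightarrow> set us \<subseteq> tangent \<alpha> \<Longrightarrow> \<theta> (x # y # us) = 0"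
  shows "\<theta> = 0"
proof (rule top_form_eq_0[OF assms(1,2,4,6)])
  let ?h = "\<lambda>us. if set us \<subseteq> tangent \<beta> then \<theta> (xi \<gamma> \<beta> # us) else 0"
  have h: "?h = 0"
  proof (rule top_form_eq_0[OF assms(2,3,5) top_form_contract[OF assms(1,2,4,6)]])
    fix us assume "set us \<subseteq> tangent \<alpha>"
    then show "?h (xi \<beta> \<alpha> # us) = 0"
      using 0[of "xi \<gamma> \<beta>" "xi \<beta> \<alpha>" us] xi_in[OF assms(1,2,4)] xi_in[OF assms(2,3,5)]
        tangent_covers[OF assms(1,2,4)] by auto
  qed (rule xi_in[OF assms(1,2,4)])
  show "\<theta> (xi \<gamma> \<beta> # us) = 0" if "set us \<subseteq> tangent \<beta>" for us
    using fun_cong[OF h, of us] that by simp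
qed

end

section \<open>Paths of length two\<close>

context quiver_complex
begin

text \<open>The coefficient of the path \<open>\<alpha> \<rightarrow> \<beta> \<rightarrow> \<gamma>\<close> in \<open>d\<^sub>0\<^sup>2\<close> on \<open>t \<and> s \<and> \<dots>\<close>, with its form part.\<close>

definition coef where
  "coef \<gamma> \<beta> \<alpha> t s = edge \<beta> \<alpha> t * edge \<gamma> \<beta> s - edge \<beta> \<alpha> s * edge \<gamma> \<beta> t"

definition path_form where
  "path_form \<gamma> \<beta> \<alpha> \<omega> t s = coef \<gamma> \<beta> \<alpha> t s *\<^sub>C fmap \<gamma> \<beta> (fmap \<beta> \<alpha> \<omega>)"

section \<open>Values of the path forms\<close>

lemma not_covers_sym: "\<alpha> \<succ> \<beta> \<Longrightarrow> \<not> \<beta> \<succ> \<alpha>"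
  by (simp add: covers_def)

lemma path_form_top:
  assumes "\<alpha> \<in> flats \<C>" "\<beta> \<in> flats \<C>" "\<gamma> \<in> flats \<C>" "adjacent \<beta> \<alpha>" "adjacent \<gamma> \<beta>"
    and "\<omega> \<in> top_forms \<alpha>"
  shows "path_form \<gamma> \<beta> \<alpha> \<omega> t s \<in> top_forms \<gamma>"
  unfolding path_form_def
  by (intro complex_vector.subspace_scale[OF csubspace_top_forms] fmap_top assms)

text \<open>Formally \<omega> is df \<and> dg \<and> \<omega>'' for the composite image \<omega>''.
  Both f and g are constant along \<open>us\<close>, so the value of \<omega> on
  \<open>fst t # fst s # us\<close> is the minor \<open>coef\<close> times \<omega>''. The result no
  longer mentions \<beta>.\<close>

lemma path_form_down_down:
  assumes fl: "\<alpha> \<in> flats \<C>" "\<beta> \<in> flats \<C>" "\<gamma> \<in> flats \<C>" and ab: "\<alpha> \<succ> \<beta>" "\<beta> \<succ> \<gamma>"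
    and \<omega>: "\<omega> \<in> top_forms \<alpha>" and ts: "t \<in> lagr \<alpha>" "s \<in> lagr \<alpha>"
  shows "path_form \<gamma> \<beta> \<alpha> \<omega> t s = (\<lambda>us. if set us \<subseteq> tangent \<gamma> then \<omega> (fst t # fst s # us) else 0)"
proof
  fix us
  let ?f = "fr \<beta> \<alpha>" and ?g = "fr \<gamma> \<beta>" and ?\<omega>' = "fmap \<beta> \<alpha> \<omega>"
  let ?\<omega>'' = "fmap \<gamma> \<beta> ?\<omega>'"
  have adj: "adjacent \<beta> \<alpha>" "adjacent \<gamma> \<beta>" using ab by (auto simp: adjacent_def)
  have top: "?\<omega>' \<in> top_forms \<beta>" "?\<omega>'' \<in> top_forms \<gamma>" using fl adj \<omega> by (auto intro: fmap_top)
  show "path_form \<gamma> \<beta> \<alpha> \<omega> t s us = (if set us \<subseteq> tangent \<gamma> then \<omega> (fst t # fst s # us) else 0)"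
  proof (cases "set us \<subseteq> tangent \<gamma>")
    case us: True
    define u w where "u = fst t" and "w = fst s"
    have uw: "u \<in> tangent \<alpha>" "w \<in> tangent \<alpha>" using ts by (auto simp: lagrangian_def u_def w_def)
    obtain e where e: "e \<in> tangent \<alpha>" "pairing e ?f = 1"
      using pairing_edge[OF arr fl(1,2) covers_subset[OF ab(1)] fr_in[OF fl(1,2) ab(1)]] by blast
    have T: "csubspace (tangent \<alpha>)" by (rule csubspace_tangent[OF arr fl(1)])
    have us': "set us \<subseteq> tangent \<beta>" "set us \<subseteq> tangent \<alpha>"
      using us tangent_covers[OF fl(2,3) ab(2)] tangent_covers[OF fl(1,2) ab(1)] by auto
    have alt: "clinear_on (tangent \<alpha>) (\<lambda>x. \<omega> ([e] @ x # us))" "\<omega> (e # e # us) = 0"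
    proof -
      have "set [e] \<subseteq> tangent \<alpha>" "set (e # e # us) \<subseteq> tangent \<alpha>" "\<not> distinct (e # e # us)"
        using e us' by auto
      then show "clinear_on (tangent \<alpha>) (\<lambda>x. \<omega> ([e] @ x # us))" "\<omega> (e # e # us) = 0"
        using us' top_formD(1)[OF \<omega>] unfolding alternating_on_def by blast+
    qed
    have key: "(pairing x ?g - pairing x ?f * pairing e ?g) * ?\<omega>'' us = \<omega> (e # x # us)"
      if x: "x \<in> tangent \<alpha>" for x
    proof -
      \<comment> \<open>The projection of \<open>x\<close> along \<open>e\<close> to
        \<open>tangent \<beta>\<close>, the only place where the second form map can be evaluated;
        \<open>\<omega>\<close> does not notice it after \<open>e\<close>.\<close>
      define x' where "x' = x - pairing x ?f *\<^sub>C e"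
      define m where "m = (- pairing x ?f) *\<^sub>C e"
      have m: "m \<in> tangent \<alpha>" unfolding m_def by (rule complex_vector.subspace_scale[OF T e(1)])
      have x': "x' = x + m" by (simp add: x'_def m_def)
      have "x' \<in> tangent \<beta>"
      proof (rule pairing_fr_eq_0[OF fl(1,2) ab(1)])
        show "x' \<in> tangent \<alpha>" unfolding x' by (rule complex_vector.subspace_add[OF T x m])
        show "pairing x' ?f = 0"
          by (simp add: x'_def clinear_diff[OF clinear_pairing(1)] clinear_scale[OF clinear_pairing(1)]
            e(2) scaleC_complex_def)
      qed
      have "\<omega> ([e] @ x' # us) = \<omega> ([e] @ x # us) + \<omega> ([e] @ m # us)"
        using alt(1) x m unfolding clinear_on_def x' by blast
      moreover have "\<omega> ([e] @ m # us) = (- pairing x ?f) *\<^sub>C \<omega> ([e] @ e # us)"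
        using alt(1) e(1) unfolding clinear_on_def m_def by blast
      ultimately have "\<omega> (e # x' # us) = \<omega> (e # x # us)" using alt(2) by simp
      moreover have "pairing e ?f * ?\<omega>' (x' # us) = \<omega> (e # x' # us)"
        by (rule fmap_down[OF fl(1,2) ab(1) \<omega> e(1)]) (use us' \<open>x' \<in> tangent \<beta>\<close> in simp)
      moreover have "pairing x' ?g * ?\<omega>'' us = ?\<omega>' (x' # us)"
        by (rule fmap_down[OF fl(2,3) ab(2) top(1) \<open>x' \<in> tangent \<beta>\<close> us])
      ultimately show ?thesis
        by (simp add: e(2) x'_def clinear_diff[OF clinear_pairing(1)] clinear_scale[OF clinear_pairing(1)]
            scaleC_complex_def)
    qed
    have "pairing v ?f = 0" if "v \<in> set us" for v
      using that us'(1) fr_in[OF fl(1,2) ab(1)] pairing_tangent[OF arr fl(2)] by blast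
    from top_form_exchange3[OF fl(1) \<omega> us'(2) this e(1) uw]
    have "\<omega> (u # w # us) = pairing u ?f * \<omega> (e # w # us) - pairing w ?f * \<omega> (e # u # us)"
      by (simp add: e(2) algebra_simps)
    also have "\<dots> = (pairing u ?f * pairing w ?g - pairing w ?f * pairing u ?g) * ?\<omega>'' us"
      by (simp add: algebra_simps flip: key[OF uw(1)] key[OF uw(2)])
    finally show ?thesis
      using us ab by (simp add: path_form_def coef_def edge_fun_def scaleC_fun_def scaleC_complex_def u_def w_def)
  next
    case False
    then show ?thesis
      by (simp add: path_form_def scaleC_fun_def top_formD(3)[OF top(2)])
  qed
qed

text \<open>On the two framing vectors followed by \<open>us\<close> the composite form takes the
  value \<open>\<omega> us\<close>. \<open>top_form_exchange2\<close> carries this value over to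
  \<open>x\<close> and \<open>y\<close>, and both the framing and \<beta> disappear.\<close>

lemma path_form_up_up:
  assumes fl: "\<alpha> \<in> flats \<C>" "\<beta> \<in> flats \<C>" "\<gamma> \<in> flats \<C>" and ab: "\<beta> \<succ> \<alpha>" "\<gamma> \<succ> \<beta>"
    and \<omega>: "\<omega> \<in> top_forms \<alpha>" and ts: "t \<in> lagr \<alpha>" "s \<in> lagr \<alpha>"
    and xy: "x \<in> tangent \<gamma>" "y \<in> tangent \<gamma>" and us: "set us \<subseteq> tangent \<alpha>"
  shows "path_form \<gamma> \<beta> \<alpha> \<omega> t s (x # y # us) =
    (pairing y (snd t) * pairing x (snd s) - pairing x (snd t) * pairing y (snd s)) * \<omega> us"
proof -
  let ?\<omega>' = "fmap \<beta> \<alpha> \<omega>"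
  let ?\<omega>'' = "fmap \<gamma> \<beta> ?\<omega>'"
  have adj: "adjacent \<beta> \<alpha>" "adjacent \<gamma> \<beta>" using ab by (auto simp: adjacent_def)
  have top: "?\<omega>' \<in> top_forms \<beta>" "?\<omega>'' \<in> top_forms \<gamma>" using fl adj \<omega> by (auto intro: fmap_top)
  have T: "tangent \<alpha> \<subseteq> tangent \<beta>" "tangent \<beta> \<subseteq> tangent \<gamma>"
    using tangent_covers fl ab by auto
  have xi: "xi \<beta> \<alpha> \<in> tangent \<beta>" "xi \<gamma> \<beta> \<in> tangent \<gamma>" using xi_in fl ab by auto
  have v: "snd t \<in> vanishing \<C> \<alpha>" "snd s \<in> vanishing \<C> \<alpha>" using ts by (auto simp: lagrangian_def)
  have "?\<omega>'' (xi \<gamma> \<beta> # xi \<beta> \<alpha> # us) = \<omega> us"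
    using fmap_up_xi[OF fl(2,3) ab(2) top(1), of "xi \<beta> \<alpha> # us"] fmap_up_xi[OF fl(1,2) ab(1) \<omega> us] xi us T
    by auto
  moreover have "(pairing x (snd t) * pairing y (snd s) - pairing y (snd t) * pairing x (snd s)) *
      ?\<omega>'' (xi \<gamma> \<beta> # xi \<beta> \<alpha> # us) =
    (pairing (xi \<gamma> \<beta>) (snd t) * pairing (xi \<beta> \<alpha>) (snd s) -
      pairing (xi \<beta> \<alpha>) (snd t) * pairing (xi \<gamma> \<beta>) (snd s)) * ?\<omega>'' (x # y # us)"
    by (rule top_form_exchange2[OF fl(3) top(2)])
      (use us T xi xy pairing_tangent[OF arr fl(1)] v in auto)
  ultimately show ?thesis
    using not_covers_sym[OF ab(1)] not_covers_sym[OF ab(2)]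
    by (simp add: path_form_def coef_def edge_fun_def scaleC_fun_def scaleC_complex_def algebra_simps)
qed

text \<open>In each product of \<open>coef\<close>, one factor is absorbed by
  \<open>fmap_down\<close> and the other by \<open>fmap_up\<close>, so no framing is left.\<close>

lemma path_form_down_up:
  assumes fl: "\<alpha> \<in> flats \<C>" "\<beta> \<in> flats \<C>" "\<gamma> \<in> flats \<C>" and ab: "\<alpha> \<succ> \<beta>" "\<gamma> \<succ> \<beta>"
    and \<omega>: "\<omega> \<in> top_forms \<alpha>" and ts: "t \<in> lagr \<alpha>" "s \<in> lagr \<alpha>"
    and x: "x \<in> tangent \<gamma>" and us: "set us \<subseteq> tangent \<beta>"
  shows "path_form \<gamma> \<beta> \<alpha> \<omega> t s (x # us) =
    pairing x (snd s) * \<omega> (fst t # us) - pairing x (snd t) * \<omega> (fst s # us)"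
proof -
  let ?\<omega>' = "fmap \<beta> \<alpha> \<omega>"
  have top: "?\<omega>' \<in> top_forms \<beta>" using fl ab \<omega> by (auto intro: fmap_top simp: adjacent_def)
  have v: "snd t \<in> vanishing \<C> \<beta>" "snd s \<in> vanishing \<C> \<beta>" and w: "fst t \<in> tangent \<alpha>" "fst s \<in> tangent \<alpha>"
    using ts vanishing_covers[OF fl(1) ab(1)] by (auto simp: lagrangian_def)
  note D = fmap_down[OF fl(1,2) ab(1) \<omega> _ us] and U = fmap_up[OF fl(2,3) ab(2) top us _ x]
  show ?thesis
    using ab(1) not_covers_sym[OF ab(2)]
    by (simp add: path_form_def coef_def edge_fun_def scaleC_fun_def scaleC_complex_def left_diff_distrib
        mult.assoc U[OF v(1)] U[OF v(2)])
      (simp add: mult.left_commute[of "pairing _ (fr \<beta> \<alpha>)"] D[OF w(1)] D[OF w(2)])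
qed

text \<open>The value agrees with \<open>path_form_down_up\<close>: going up first inserts the two
  vectors in the opposite order, and the sign of their exchange matches the opposite order of the
  functionals in \<open>coef\<close>. Hence flats above and below contribute with a common
  factor.\<close>

lemma path_form_up_down:
  assumes fl: "\<alpha> \<in> flats \<C>" "\<beta> \<in> flats \<C>" "\<gamma> \<in> flats \<C>" and ab: "\<beta> \<succ> \<alpha>" "\<beta> \<succ> \<gamma>"
    and \<omega>: "\<omega> \<in> top_forms \<alpha>" and ts: "t \<in> lagr \<alpha>" "s \<in> lagr \<alpha>"
    and x: "x \<in> tangent \<gamma>" and us: "set us \<subseteq> tangent \<alpha>" "set us \<subseteq> tangent \<gamma>"
  shows "path_form \<gamma> \<beta> \<alpha> \<omega> t s (x # us) =
    pairing x (snd s) * \<omega> (fst t # us) - pairing x (snd t) * \<omega> (fst s # us)"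
proof -
  let ?\<omega>' = "fmap \<beta> \<alpha> \<omega>"
  let ?\<omega>'' = "fmap \<gamma> \<beta> ?\<omega>'"
  have top: "?\<omega>' \<in> top_forms \<beta>" using fl ab \<omega> by (auto intro: fmap_top simp: adjacent_def)
  have v: "snd t \<in> vanishing \<C> \<alpha>" "snd s \<in> vanishing \<C> \<alpha>" and w: "fst t \<in> tangent \<alpha>" "fst s \<in> tangent \<alpha>"
    using ts by (auto simp: lagrangian_def)
  have T: "tangent \<alpha> \<subseteq> tangent \<beta>" "tangent \<gamma> \<subseteq> tangent \<beta>" using tangent_covers fl ab by auto
  have D: "pairing y (fr \<gamma> \<beta>) * ?\<omega>'' (x # us) = - ?\<omega>' (x # y # us)" if "y \<in> tangent \<alpha>" for y
  proof -
    have "?\<omega>' (y # x # us) = - ?\<omega>' (x # y # us)"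
      using alternating_swap[OF top_formD(1)[OF top] csubspace_tangent[OF arr fl(2)], of "[]" y x us]
        that x us T by auto
    moreover have "pairing y (fr \<gamma> \<beta>) * ?\<omega>'' (x # us) = ?\<omega>' (y # x # us)"
      by (rule fmap_down[OF fl(2,3) ab(2) top]) (use that x us T in auto)
    ultimately show ?thesis by simp
  qed
  have U: "pairing (xi \<beta> \<alpha>) f * ?\<omega>' (x # y # us) = pairing x f * \<omega> (y # us)"
    if "y \<in> tangent \<alpha>" "f \<in> vanishing \<C> \<alpha>" for y f
    by (rule fmap_up[OF fl(1,2) ab(1) \<omega>]) (use that x us T in auto)
  show ?thesis
    using ab(2) not_covers_sym[OF ab(1)]
    by (simp add: path_form_def coef_def edge_fun_def scaleC_fun_def scaleC_complex_def left_diff_distrib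
        mult.assoc D[OF w(1)] D[OF w(2)] U[OF w(1) v(2)] U[OF w(2) v(1)])
qed

text \<open>The functional of the returning edge vanishes on \<open>lagr \<alpha>\<close>: a vector
  tangent to \<alpha> kills functions vanishing on \<alpha>, and conversely. The quiver relations
  say nothing about such loops.\<close>

lemma coef_diag:
  assumes "\<alpha> \<in> flats \<C>" "\<beta> \<in> flats \<C>" "adjacent \<beta> \<alpha>" "t \<in> lagr \<alpha>" "s \<in> lagr \<alpha>"
  shows "coef \<alpha> \<beta> \<alpha> t s = 0"
proof (cases "\<alpha> \<succ> \<beta>")
  case True
  have "pairing (xi \<alpha> \<beta>) (snd t) = 0" "pairing (xi \<alpha> \<beta>) (snd s) = 0"
    using pairing_tangent[OF arr assms(1) _ xi_in(1)[OF assms(1,2) True]] assms(4,5)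
    by (auto simp: lagrangian_def)
  then show ?thesis using True not_covers_sym[OF True] by (simp add: coef_def edge_fun_def)
next
  case False
  then have ba: "\<beta> \<succ> \<alpha>" using assms(3) by (auto simp: adjacent_def)
  have "pairing (fst t) (fr \<alpha> \<beta>) = 0" "pairing (fst s) (fr \<alpha> \<beta>) = 0"
    using pairing_tangent[OF arr assms(1)] fr_in[OF assms(2,1) ba] assms(4,5)
    by (auto simp: lagrangian_def)
  then show ?thesis using ba False by (simp add: coef_def edge_fun_def)
qed

section \<open>Two flats of equal dimension\<close>

lemma flat_eq_of_tangent_eq:
  assumes "\<alpha> \<in> flats \<C>" "\<gamma> \<in> flats \<C>" "tangent \<alpha> = tangent \<gamma>" "x \<in> \<alpha>" "x \<in> \<gamma>"
  shows "\<alpha> = \<gamma>"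
proof -
  have "y \<in> \<alpha> \<longleftrightarrow> y \<in> \<gamma>" for y
    using tangent_iff[OF arr assms(1,4), of "y - x"] tangent_iff[OF arr assms(2,5), of "y - x"] assms(3)
    by simp
  then show ?thesis by blast
qed

text \<open>A common tangent vector outside \<open>tangent \<delta>\<close> would span both tangent
  spaces modulo \<open>tangent \<delta>\<close>. They would then coincide, and the flats, which
  share a point of \<delta>, would be equal.\<close>

lemma tangent_meet:
  assumes fl: "\<alpha> \<in> flats \<C>" "\<gamma> \<in> flats \<C>" "\<delta> \<in> flats \<C>" and d: "\<alpha> \<succ> \<delta>" "\<gamma> \<succ> \<delta>" "\<alpha> \<noteq> \<gamma>"
  shows "tangent \<delta> = tangent \<alpha> \<inter> tangent \<gamma>"
proof
  show "tangent \<delta> \<subseteq> tangent \<alpha> \<inter> tangent \<gamma>" using tangent_covers fl d by auto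
  show "tangent \<alpha> \<inter> tangent \<gamma> \<subseteq> tangent \<delta>"
  proof (rule ccontr)
    assume "\<not> tangent \<alpha> \<inter> tangent \<gamma> \<subseteq> tangent \<delta>"
    then obtain x where x: "x \<in> tangent \<alpha>" "x \<in> tangent \<gamma>" "x \<notin> tangent \<delta>" by blast
    have sub: "tangent \<mu> \<subseteq> tangent \<nu>"
      if h: "\<mu> \<in> flats \<C>" "\<nu> \<in> flats \<C>" "\<mu> \<succ> \<delta>" "\<nu> \<succ> \<delta>" "x \<in> tangent \<mu>" "x \<in> tangent \<nu>" for \<mu> \<nu>
    proof
      fix v assume "v \<in> tangent \<mu>"
      then obtain k where "v - k *\<^sub>C x \<in> tangent \<delta>"
        using tangent_breakdown[OF h(1) fl(3) h(3,5) x(3)] by blast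
      then have "v - k *\<^sub>C x \<in> tangent \<nu>" "k *\<^sub>C x \<in> tangent \<nu>"
        using tangent_covers[OF h(2) fl(3) h(4)] h(6) csubspace_tangent[OF arr h(2)]
        by (auto simp: complex_vector.subspace_scale)
      then have "(v - k *\<^sub>C x) + k *\<^sub>C x \<in> tangent \<nu>"
        using csubspace_tangent[OF arr h(2)] complex_vector.subspace_add by blast
      then show "v \<in> tangent \<nu>" by simp
    qed
    have "tangent \<alpha> = tangent \<gamma>" using sub[of \<alpha> \<gamma>] sub[of \<gamma> \<alpha>] fl d x by auto
    moreover obtain p where "p \<in> \<delta>" using fl(3) by (auto simp: flats_def)
    ultimately show False
      using flat_eq_of_tangent_eq[OF fl(1,2), of p] d covers_subset by auto
  qed
qed

text \<open>Inside \<beta> both flats are hyperplanes. If they are not parallel they intersect, and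
  the intersection is a flat of codimension one in each, which is the excluded \<delta>.\<close>

lemma parallel_or_meet:
  assumes fl: "\<alpha> \<in> flats \<C>" "\<gamma> \<in> flats \<C>" "\<beta> \<in> flats \<C>" and b: "\<beta> \<succ> \<alpha>" "\<beta> \<succ> \<gamma>"
    and nd: "\<not> (\<exists>\<delta>\<in>flats \<C>. \<alpha> \<succ> \<delta> \<and> \<gamma> \<succ> \<delta>)"
  shows "tangent \<alpha> \<subseteq> tangent \<gamma>"
proof (rule ccontr)
  assume "\<not> tangent \<alpha> \<subseteq> tangent \<gamma>"
  then obtain w where w: "w \<in> tangent \<alpha>" "w \<notin> tangent \<gamma>" by blast
  have wb: "w \<in> tangent \<beta>" using w tangent_covers[OF fl(3,1) b(1)] by auto
  note break = tangent_breakdown[OF fl(3,2) b(2) wb w(2)]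
  obtain x y where xy: "x \<in> \<alpha>" "y \<in> \<gamma>" using fl(1,2) by (auto simp: flats_def)
  have Ta: "csubspace (tangent \<alpha>)" and Tc: "csubspace (tangent \<gamma>)"
    using csubspace_tangent[OF arr] fl by blast+
  have "y - x \<in> tangent \<beta>"
    using tangent_iff[OF arr fl(3), of x "y - x"] xy covers_subset[OF b(1)] covers_subset[OF b(2)] by auto
  then obtain k where k: "y - x - k *\<^sub>C w \<in> tangent \<gamma>" using break by blast
  \<comment> \<open>From a point of \<alpha> one moves along \<open>w\<close>, which is tangent to
    \<alpha> but transversal to \<gamma>, until \<gamma> is reached.\<close>
  have "x + k *\<^sub>C w \<in> \<alpha>"
    using tangent_iff[OF arr fl(1) xy(1)] complex_vector.subspace_scale[OF Ta w(1)] by blast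
  moreover have "x + k *\<^sub>C w \<in> \<gamma>"
  proof -
    have "- (y - x - k *\<^sub>C w) \<in> tangent \<gamma>" using complex_vector.subspace_neg[OF Tc k] .
    then have "y + - (y - x - k *\<^sub>C w) \<in> \<gamma>" using tangent_iff[OF arr fl(2) xy(2)] by blast
    then show ?thesis by (simp add: algebra_simps)
  qed
  ultimately obtain z where z: "z \<in> \<alpha> \<inter> \<gamma>" by blast
  obtain S S' where S: "S \<subseteq> \<C>" "\<alpha> = \<Inter>S" "S' \<subseteq> \<C>" "\<gamma> = \<Inter>S'"
    using fl by (auto simp: flats_def)
  have "\<alpha> \<inter> \<gamma> = \<Inter>(S \<union> S')" "S \<union> S' \<subseteq> \<C>" using S by auto
  then have d: "\<alpha> \<inter> \<gamma> \<in> flats \<C>" using z unfolding flats_def by blast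
  have Td: "v \<in> tangent (\<alpha> \<inter> \<gamma>) \<longleftrightarrow> v \<in> tangent \<alpha> \<and> v \<in> tangent \<gamma>" for v
    using tangent_iff[OF arr d z] tangent_iff[OF arr fl(1), of z] tangent_iff[OF arr fl(2), of z] z by auto
  have "tangent \<alpha> \<subseteq> vec.span (insert w (tangent (\<alpha> \<inter> \<gamma>)))"
  proof
    fix v assume v: "v \<in> tangent \<alpha>"
    then have "v \<in> tangent \<beta>" using tangent_covers[OF fl(3,1) b(1)] by auto
    then obtain k where "v - k *\<^sub>C w \<in> tangent \<gamma>" using break by blast
    moreover have "v - k *\<^sub>C w \<in> tangent \<alpha>"
      using v w(1) Ta by (simp add: complex_vector.subspace_diff complex_vector.subspace_scale)
    ultimately have "v - k *s w \<in> vec.span (tangent (\<alpha> \<inter> \<gamma>))"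
      using Td by (intro vec.span_base) (simp add: scaleC_vec_eq)
    then show "v \<in> vec.span (insert w (tangent (\<alpha> \<inter> \<gamma>)))"
      using vec.span_breakdown_eq by blast
  qed
  moreover have "vec.span (insert w (tangent (\<alpha> \<inter> \<gamma>))) \<subseteq> tangent \<alpha>"
    using Ta w(1) Td unfolding csubspace_vec by (intro vec.span_minimal) auto
  ultimately have "vec.dim (tangent \<alpha>) = vec.dim (insert w (tangent (\<alpha> \<inter> \<gamma>)))"
    by (metis subset_antisym vec.dim_span)
  moreover have "vec.span (tangent (\<alpha> \<inter> \<gamma>)) = tangent (\<alpha> \<inter> \<gamma>)"
    using csubspace_tangent[OF arr d] by (simp only: csubspace_vec vec.span_eq_iff)
  moreover have "w \<notin> tangent (\<alpha> \<inter> \<gamma>)" using w(2) Td by simp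
  ultimately have "vec.dim (tangent \<alpha>) = vec.dim (tangent (\<alpha> \<inter> \<gamma>)) + 1"
    by (simp add: vec.dim_insert)
  moreover have "vec.dim (tangent \<gamma>) = vec.dim (tangent \<alpha>)" using b by (simp add: covers_def)
  ultimately show False using nd d by (auto simp: covers_def)
qed

definition middle where
  "middle \<gamma> \<alpha> = {\<beta> \<in> flats \<C>. adjacent \<beta> \<alpha> \<and> adjacent \<gamma> \<beta>}"

text \<open>The first alternative takes care of the pairs without a quiver relation: \<alpha> =
  \<gamma>, where loops have coefficient zero, and parallel flats, where the functional of the
  second edge vanishes on \<open>lagr \<alpha>\<close>. In the second, a relation holds and the
  common form can be factored out of the sum over \<beta>.\<close>

lemma path_cases:
  assumes fl: "\<alpha> \<in> flats \<C>" "\<gamma> \<in> flats \<C>" and \<omega>: "\<omega> \<in> top_forms \<alpha>"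
  shows "(\<forall>\<beta>\<in>middle \<gamma> \<alpha>. \<forall>t\<in>lagr \<alpha>. \<forall>s\<in>lagr \<alpha>. coef \<gamma> \<beta> \<alpha> t s = 0) \<or>
    ((\<forall>v\<in>V \<alpha>. (\<Sum>\<beta>\<in>flats \<C>. A \<gamma> \<beta> (A \<beta> \<alpha> v)) = 0) \<and>
     (\<forall>\<beta>\<in>middle \<gamma> \<alpha>. \<forall>\<beta>'\<in>middle \<gamma> \<alpha>. \<forall>t\<in>lagr \<alpha>. \<forall>s\<in>lagr \<alpha>.
        path_form \<gamma> \<beta> \<alpha> \<omega> t s = path_form \<gamma> \<beta>' \<alpha> \<omega> t s))"
    (is "?zero \<or> ?rel \<and> ?indep")
proof (cases "middle \<gamma> \<alpha> = {}")
  case True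
  then show ?thesis by simp
next
  case False
  let ?d = "\<lambda>\<alpha>. vec.dim (tangent \<alpha>)"
  have mid: "\<beta> \<in> flats \<C>" "adjacent \<beta> \<alpha>" "adjacent \<gamma> \<beta>" if "\<beta> \<in> middle \<gamma> \<alpha>" for \<beta>
    using that by (auto simp: middle_def)
  have dims: "?d \<beta> = ?d \<alpha> + 1 \<and> \<beta> \<succ> \<alpha> \<or> ?d \<alpha> = ?d \<beta> + 1 \<and> \<alpha> \<succ> \<beta>" if "adjacent \<beta> \<alpha>" for \<alpha> \<beta>
    using that by (auto simp: adjacent_def covers_def)
  have q2: "?rel" if "\<bar>level \<gamma> - level \<alpha>\<bar> = 2"
    using qui that fl unfolding quiver_def by blast
  have q3: "?rel" if "level \<gamma> = level \<alpha>" "\<gamma> \<noteq> \<alpha>" "\<exists>\<delta>\<in>flats \<C>. \<gamma> \<succ> \<delta> \<and> \<alpha> \<succ> \<delta>"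
    using qui that fl unfolding quiver_def by blast
  have diff: "path_form \<gamma> \<beta> \<alpha> \<omega> t s - path_form \<gamma> \<beta>' \<alpha> \<omega> t s \<in> top_forms \<gamma>"
    if "\<beta> \<in> middle \<gamma> \<alpha>" "\<beta>' \<in> middle \<gamma> \<alpha>" for \<beta> \<beta>' t s
    by (intro complex_vector.subspace_diff[OF csubspace_top_forms] path_form_top \<omega> fl mid that)
  obtain \<beta>0 where \<beta>0: "\<beta>0 \<in> middle \<gamma> \<alpha>" using False by blast
  consider "\<alpha> = \<gamma>" | "\<alpha> \<noteq> \<gamma>" "?d \<gamma> = ?d \<alpha>" | "?d \<alpha> = ?d \<gamma> + 2" | "?d \<gamma> = ?d \<alpha> + 2"
    using dims[OF mid(2)[OF \<beta>0]] dims[OF mid(3)[OF \<beta>0]] by linarith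
  then show ?thesis
  proof cases
    case 1
    then have ?zero using mid coef_diag[OF fl(1)] by auto
    then show ?thesis ..
  next
    case 2
    have updown: "\<beta> \<succ> \<alpha> \<and> \<beta> \<succ> \<gamma> \<or> \<alpha> \<succ> \<beta> \<and> \<gamma> \<succ> \<beta>" if "\<beta> \<in> middle \<gamma> \<alpha>" for \<beta>
      using dims[OF mid(2)[OF that]] dims[OF mid(3)[OF that]] 2(2)
      by (elim disjE conjE; (linarith | blast))
    show ?thesis
    proof (cases "\<exists>\<delta>\<in>flats \<C>. \<alpha> \<succ> \<delta> \<and> \<gamma> \<succ> \<delta>")
      case True
      then obtain \<delta> where \<delta>: "\<delta> \<in> flats \<C>" "\<alpha> \<succ> \<delta>" "\<gamma> \<succ> \<delta>" by blast
      note Td = tangent_meet[OF fl \<delta> 2(1)]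
      have val: "path_form \<gamma> \<beta> \<alpha> \<omega> t s (x # us) =
          pairing x (snd s) * \<omega> (fst t # us) - pairing x (snd t) * \<omega> (fst s # us)"
        if "\<beta> \<in> middle \<gamma> \<alpha>" "t \<in> lagr \<alpha>" "s \<in> lagr \<alpha>" "x \<in> tangent \<gamma>" "set us \<subseteq> tangent \<delta>" for \<beta> t s x us
        using updown[OF that(1)]
      proof
        assume b: "\<beta> \<succ> \<alpha> \<and> \<beta> \<succ> \<gamma>"
        show ?thesis
          by (rule path_form_up_down[OF fl(1) mid(1)[OF that(1)] fl(2) _ _ \<omega> that(2-4)])
            (use b that(5) Td in auto)
      next
        assume b: "\<alpha> \<succ> \<beta> \<and> \<gamma> \<succ> \<beta>"
        then have "tangent \<beta> = tangent \<delta>"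
          using tangent_meet[OF fl mid(1)[OF that(1)] _ _ 2(1)] Td by auto
        then show ?thesis
          by (intro path_form_down_up[OF fl(1) mid(1)[OF that(1)] fl(2) _ _ \<omega> that(2-4)])
            (use b that(5) in auto)
      qed
      have ?indep
      proof (intro ballI)
        fix \<beta> \<beta>' t s
        assume b: "\<beta> \<in> middle \<gamma> \<alpha>" "\<beta>' \<in> middle \<gamma> \<alpha>" and ts: "t \<in> lagr \<alpha>" "s \<in> lagr \<alpha>"
        \<comment> \<open>Testing on lists with tail in \<open>tangent \<delta>\<close> determines a
          top form of \<gamma>, and on such tails the formulas for paths through upper and lower
          flats are both available.\<close>
        have "path_form \<gamma> \<beta> \<alpha> \<omega> t s - path_form \<gamma> \<beta>' \<alpha> \<omega> t s = 0"
          by (rule top_form_eq_0[OF fl(2) \<delta>(1,3) diff[OF b]])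
            (simp add: val[OF b(1) ts] val[OF b(2) ts] xi_in[OF fl(2) \<delta>(1,3)])
        then show "path_form \<gamma> \<beta> \<alpha> \<omega> t s = path_form \<gamma> \<beta>' \<alpha> \<omega> t s" by simp
      qed
      moreover have ?rel by (rule q3) (use 2 \<delta> in \<open>auto simp: level_def\<close>)
      ultimately show ?thesis by blast
    next
      case nd: False
      have "coef \<gamma> \<beta> \<alpha> t s = 0" if b: "\<beta> \<in> middle \<gamma> \<alpha>" and ts: "t \<in> lagr \<alpha>" "s \<in> lagr \<alpha>" for \<beta> t s
      proof -
        have up: "\<beta> \<succ> \<alpha>" "\<beta> \<succ> \<gamma>" using updown[OF b] nd mid(1)[OF b] by auto
        have "tangent \<alpha> \<subseteq> tangent \<gamma>" by (rule parallel_or_meet[OF fl mid(1)[OF b] up nd])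
        then have "pairing (fst t) (fr \<gamma> \<beta>) = 0" "pairing (fst s) (fr \<gamma> \<beta>) = 0"
          using ts pairing_tangent[OF arr fl(2)] fr_in[OF mid(1)[OF b] fl(2) up(2)]
          by (auto simp: lagrangian_def)
        then show ?thesis using up by (simp add: coef_def edge_fun_def)
      qed
      then show ?thesis by blast
    qed
  next
    case 3
    have dd: "\<alpha> \<succ> \<beta> \<and> \<beta> \<succ> \<gamma>" if "\<beta> \<in> middle \<gamma> \<alpha>" for \<beta>
      using dims[OF mid(2)[OF that]] dims[OF mid(3)[OF that]] 3
      by (elim disjE conjE; (linarith | blast))
    have ?indep
      using path_form_down_down[OF fl(1) mid(1) fl(2) _ _ \<omega>] dd by simp
    moreover have ?rel by (rule q2) (use 3 in \<open>simp add: level_def\<close>)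
    ultimately show ?thesis by blast
  next
    case 4
    have "\<beta> \<succ> \<alpha> \<and> \<gamma> \<succ> \<beta>" if "\<beta> \<in> middle \<gamma> \<alpha>" for \<beta>
      using dims[OF mid(2)[OF that]] dims[OF mid(3)[OF that]] 4
      by (elim disjE conjE; (linarith | blast))
    then have uu: "\<beta> \<succ> \<alpha>" "\<gamma> \<succ> \<beta>" if "\<beta> \<in> middle \<gamma> \<alpha>" for \<beta>
      using that by blast+
    have ?indep
    proof (intro ballI)
      fix \<beta> \<beta>' t s
      assume b: "\<beta> \<in> middle \<gamma> \<alpha>" "\<beta>' \<in> middle \<gamma> \<alpha>" and ts: "t \<in> lagr \<alpha>" "s \<in> lagr \<alpha>"
      note val = path_form_up_up[OF fl(1) mid(1) fl(2) uu \<omega> ts]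
      have "path_form \<gamma> \<beta> \<alpha> \<omega> t s - path_form \<gamma> \<beta>' \<alpha> \<omega> t s = 0"
        by (rule top_form_eq_0_2[OF fl(2) mid(1)[OF b(1)] fl(1) uu(2,1)[OF b(1)] diff[OF b]])
          (simp add: val[OF b(1) b(1) b(1)] val[OF b(2) b(2) b(2)])
      then show "path_form \<gamma> \<beta> \<alpha> \<omega> t s = path_form \<gamma> \<beta>' \<alpha> \<omega> t s" by simp
    qed
    moreover have ?rel by (rule q2) (use 4 in \<open>simp add: level_def\<close>)
    ultimately show ?thesis by blast
  qed
qed

end

section \<open>The square of the differential\<close>

definition summand :: "(complex ^ 'n) set \<Rightarrow> ('n::finite, 'v::complex_vector) summand \<Rightarrow> ('n, 'v) chain"
  where "summand \<alpha> x = (\<lambda>\<gamma>. if \<gamma> = \<alpha> then x else 0)"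

lemma clinear_summand: "clinear (summand \<alpha>)"
  by (rule clinearI) (auto simp: summand_def fun_eq_iff scaleC_fun_def)

lemma pure_summand: "pure \<alpha> P ts \<omega> v = summand \<alpha> (P \<otimes> wedge ts \<otimes> \<omega> \<otimes> v)"
  by (simp add: pure_def summand_def)

lemma clinear_pure_op: "clinear (\<lambda>P. pure \<alpha> P ts \<omega> v)"
  unfolding pure_summand by (rule clinear_compose[OF clinear_summand clinear_tensor(1)])

lemma clinear_summand_ext: "clinear (\<lambda>e. summand \<alpha> (P \<otimes> e \<otimes> \<omega> \<otimes> v))"
  by (intro clinear_compose[OF clinear_summand] clinear_compose[OF clinear_tensor(2)] clinear_tensor(1))

lemma clinear_pure_form: "clinear (\<lambda>\<omega>. pure \<alpha> P ts \<omega> v)"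
  unfolding pure_summand
  by (intro clinear_compose[OF clinear_summand] clinear_compose[OF clinear_tensor(2)] clinear_tensor(1))

lemma clinear_pure_vec: "clinear (\<lambda>v. pure \<alpha> P ts \<omega> v)"
  unfolding pure_summand
  by (intro clinear_compose[OF clinear_summand] clinear_compose[OF clinear_tensor(2)] clinear_tensor(2))

lemma clinear_pure_Cons: "clinear (\<lambda>t. pure \<alpha> P (t # ts) \<omega> v)"
  unfolding pure_summand by (rule clinear_compose[OF clinear_summand_ext clinear_wedge_Cons])

lemma d1_pure_alt: "d1 (pure \<alpha> P ts \<omega> v) = alt_sum (\<lambda>t us. pure \<alpha> (P * weyl_embed t) us \<omega> v) ts"
  by (simp add: d1_pure alt_sum_def)

lemma summand_contract:
  assumes "clinear \<phi>"
  shows "summand \<alpha> (P \<otimes> contract \<phi> (wedge ts) \<otimes> \<omega> \<otimes> v) = alt_sum (\<lambda>t us. \<phi> t *\<^sub>C pure \<alpha> P us \<omega> v) ts"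
  by (simp only: contract_wedge_alt[OF assms] clinear_alt_sum[OF clinear_summand_ext]
      clinear_scale[OF clinear_summand_ext] pure_summand)

lemma alt_sum2_diff: "alt_sum (\<lambda>t. alt_sum (\<lambda>s us. B t s us - C t s us)) ts =
    alt_sum (\<lambda>t. alt_sum (B t)) ts - alt_sum (\<lambda>t. alt_sum (C t)) ts"
proof -
  have "(\<lambda>t. alt_sum (\<lambda>s us. B t s us - C t s us)) = (\<lambda>t us. alt_sum (B t) us - alt_sum (C t) us)"
    by (intro ext alt_sum_diff)
  then show ?thesis by (simp only: alt_sum_diff)
qed

lemma alt_sum2_sum: "alt_sum (\<lambda>t. alt_sum (\<lambda>s us. \<Sum>i\<in>I. B i t s us)) ts =
    (\<Sum>i\<in>I. alt_sum (\<lambda>t. alt_sum (B i t)) ts)"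
proof -
  have "(\<lambda>t. alt_sum (\<lambda>s us. \<Sum>i\<in>I. B i t s us)) = (\<lambda>t us. \<Sum>i\<in>I. alt_sum (B i t) us)"
    by (intro ext alt_sum_sum)
  then show ?thesis by (simp only: alt_sum_sum)
qed

lemma clinear_fun_diff: "clinear f \<Longrightarrow> clinear g \<Longrightarrow> clinear (\<lambda>x. f x - g x)"
  by (rule clinearI) (simp_all add: clinear_add[of f] clinear_add[of g] clinear_scale[of f]
      clinear_scale[of g] complex_vector.scale_right_diff_distrib)

context quiver_complex
begin

section \<open>Generators of the chain spaces\<close>

abbreviation D0 where "D0 \<equiv> d0 \<C> V A fr xi"
abbreviation D where "D \<equiv> differential \<C> V A fr xi"

text \<open>\<open>B\<close> restricts the coefficient operator: \<open>UNIV\<close> gives the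
  chains, \<open>words q\<close> their Bernstein filtration.\<close>

definition gens where
  "gens r B = {pure \<alpha> P ts \<omega> v | \<alpha> P ts \<omega> v. \<alpha> \<in> flats \<C> \<and> P \<in> B \<and> length ts = r \<and>
    set ts \<subseteq> lagr \<alpha> \<and> \<omega> \<in> top_forms \<alpha> \<and> v \<in> V \<alpha>}"

lemma gensI:
  assumes "\<alpha> \<in> flats \<C>" "P \<in> B" "length ts = r" "set ts \<subseteq> lagr \<alpha>" "\<omega> \<in> top_forms \<alpha>" "v \<in> V \<alpha>"
  shows "pure \<alpha> P ts \<omega> v \<in> gens r B"
  unfolding gens_def using assms by blast

lemma gensE:
  assumes "x \<in> gens r B"
  obtains \<alpha> P ts \<omega> v where "x = pure \<alpha> P ts \<omega> v" "\<alpha> \<in> flats \<C>" "P \<in> B" "length ts = r"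
    "set ts \<subseteq> lagr \<alpha>" "\<omega> \<in> top_forms \<alpha>" "v \<in> V \<alpha>"
  using assms unfolding gens_def by blast

lemma pure_in_span:
  assumes "\<alpha> \<in> flats \<C>" "P \<in> B" "length ts = r" "set ts \<subseteq> lagr \<alpha>" "\<omega> \<in> top_forms \<alpha>" "v \<in> V \<alpha>"
  shows "pure \<alpha> P ts \<omega> v \<in> cspan (gens r B)"
  by (rule complex_vector.span_base[OF gensI[OF assms]])

lemma csubspace_V: "\<alpha> \<in> flats \<C> \<Longrightarrow> csubspace (V \<alpha>)"
  by (rule csubspace_quiver[OF qui])

lemma chain_summands:
  assumes "x \<in> chains \<C> V r"
  shows "x = (\<Sum>\<alpha>\<in>flats \<C>. summand \<alpha> (x \<alpha>))"
proof
  fix \<gamma>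
  have "(\<Sum>\<alpha>\<in>flats \<C>. summand \<alpha> (x \<alpha>)) \<gamma> = (\<Sum>\<alpha>\<in>flats \<C>. if \<gamma> = \<alpha> then x \<alpha> else 0)"
    by (simp add: sum_fun_apply summand_def)
  also have "\<dots> = x \<gamma>" using assms finite_flats[OF arr] by (simp add: sum.delta' chains_def)
  finally show "x \<gamma> = (\<Sum>\<alpha>\<in>flats \<C>. summand \<alpha> (x \<alpha>)) \<gamma>" by simp
qed

lemma summand_space:
  assumes "\<alpha> \<in> flats \<C>"
  shows "(UNIV :: 'n weyl set) \<otimes>\<^sub>s ext_power r (lagr \<alpha>) \<otimes>\<^sub>s top_forms \<alpha> \<otimes>\<^sub>s V \<alpha> =
    cspan {P \<otimes> wedge ts \<otimes> \<omega> \<otimes> v | P ts \<omega> v.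
      length ts = r \<and> set ts \<subseteq> lagr \<alpha> \<and> \<omega> \<in> top_forms \<alpha> \<and> v \<in> V \<alpha>}"
proof -
  have U: "UNIV = cspan (UNIV :: 'n weyl set)" by simp
  have W: "top_forms \<alpha> = cspan (top_forms \<alpha>)" "V \<alpha> = cspan (V \<alpha>)"
    by (simp_all only: complex_vector.span_eq_iff[THEN iffD2, OF csubspace_top_forms]
        complex_vector.span_eq_iff[THEN iffD2, OF csubspace_V[OF assms]])
  have "(UNIV :: 'n weyl set) \<otimes>\<^sub>s ext_power r (lagr \<alpha>) \<otimes>\<^sub>s top_forms \<alpha> \<otimes>\<^sub>s V \<alpha> =
      cspan (UNIV :: 'n weyl set) \<otimes>\<^sub>s cspan {wedge ts | ts. length ts = r \<and> set ts \<subseteq> lagr \<alpha>} \<otimes>\<^sub>s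
        cspan (top_forms \<alpha>) \<otimes>\<^sub>s cspan (V \<alpha>)"
    by (simp only: U[symmetric] W[symmetric] ext_power_def)
  also have "\<dots> = cspan {P \<otimes> e | P e. P \<in> (UNIV :: 'n weyl set) \<and> e \<in> {e \<otimes> w | e w.
      e \<in> {wedge ts | ts. length ts = r \<and> set ts \<subseteq> lagr \<alpha>} \<and> w \<in> {\<omega> \<otimes> v | \<omega> v. \<omega> \<in> top_forms \<alpha> \<and> v \<in> V \<alpha>}}}"
    by (simp only: tensor_sub_cspan)
  also have "{P \<otimes> e | P e. P \<in> (UNIV :: 'n weyl set) \<and> e \<in> {e \<otimes> w | e w.
      e \<in> {wedge ts | ts. length ts = r \<and> set ts \<subseteq> lagr \<alpha>} \<and> w \<in> {\<omega> \<otimes> v | \<omega> v. \<omega> \<in> top_forms \<alpha> \<and> v \<in> V \<alpha>}}}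
    = {P \<otimes> wedge ts \<otimes> \<omega> \<otimes> v | P ts \<omega> v.
      length ts = r \<and> set ts \<subseteq> lagr \<alpha> \<and> \<omega> \<in> top_forms \<alpha> \<and> v \<in> V \<alpha>}"
    by blast
  finally show ?thesis .
qed

lemma csubspace_chains: "csubspace (chains \<C> V r)"
proof -
  have s: "csubspace (UNIV \<otimes>\<^sub>s ext_power r (lagr \<alpha>) \<otimes>\<^sub>s top_forms \<alpha> \<otimes>\<^sub>s V \<alpha>)" for \<alpha>
    by (simp add: tensor_sub_def)
  show ?thesis
    by (simp add: complex_vector.subspace_def chains_def scaleC_fun_def complex_vector.subspace_0[OF s]
        complex_vector.subspace_add[OF s] complex_vector.subspace_scale[OF s])
qed

lemma chains_eq_span: "chains \<C> V r = cspan (gens r UNIV)"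
proof
  show "chains \<C> V r \<subseteq> cspan (gens r UNIV)"
  proof
    fix x assume x: "x \<in> chains \<C> V r"
    have "summand \<alpha> (x \<alpha>) \<in> cspan (gens r UNIV)" if \<alpha>: "\<alpha> \<in> flats \<C>" for \<alpha>
    proof -
      have "x \<alpha> \<in> cspan {(P :: 'n weyl) \<otimes> wedge ts \<otimes> \<omega> \<otimes> v | P ts \<omega> v.
          length ts = r \<and> set ts \<subseteq> lagr \<alpha> \<and> \<omega> \<in> top_forms \<alpha> \<and> v \<in> V \<alpha>}"
        using x \<alpha> unfolding chains_def summand_space[OF \<alpha>, symmetric] by blast
      then show ?thesis
      proof (rule cspan_image_induct[OF clinear_summand complex_vector.subspace_span, rotated])
        fix y assume "y \<in> {(P :: 'n weyl) \<otimes> wedge ts \<otimes> \<omega> \<otimes> v | P ts \<omega> v.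
          length ts = r \<and> set ts \<subseteq> lagr \<alpha> \<and> \<omega> \<in> top_forms \<alpha> \<and> v \<in> V \<alpha>}"
        then obtain P ts \<omega> v where y: "y = P \<otimes> wedge ts \<otimes> \<omega> \<otimes> v" "length ts = r" "set ts \<subseteq> lagr \<alpha>"
          "\<omega> \<in> top_forms \<alpha>" "v \<in> V \<alpha>" by blast
        show "summand \<alpha> y \<in> cspan (gens r UNIV)"
          unfolding y(1) pure_summand[symmetric] by (rule pure_in_span[OF \<alpha> UNIV_I y(2-5)])
      qed
    qed
    then have "(\<Sum>\<alpha>\<in>flats \<C>. summand \<alpha> (x \<alpha>)) \<in> cspan (gens r UNIV)"
      by (rule complex_vector.span_sum)
    then show "x \<in> cspan (gens r UNIV)" using chain_summands[OF x] by simp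
  qed
  show "cspan (gens r UNIV) \<subseteq> chains \<C> V r"
  proof (rule complex_vector.span_minimal[OF _ csubspace_chains], rule subsetI)
    fix x assume "x \<in> gens r UNIV"
    then obtain \<alpha> P ts \<omega> v where x: "x = pure \<alpha> P ts \<omega> v" "\<alpha> \<in> flats \<C>" "length ts = r"
      "set ts \<subseteq> lagr \<alpha>" "\<omega> \<in> top_forms \<alpha>" "v \<in> V \<alpha>" by (rule gensE)
    have "P \<otimes> wedge ts \<otimes> \<omega> \<otimes> v \<in> UNIV \<otimes>\<^sub>s ext_power r (lagr \<alpha>) \<otimes>\<^sub>s top_forms \<alpha> \<otimes>\<^sub>s V \<alpha>"
      unfolding summand_space[OF x(2)] by (rule complex_vector.span_base) (use x in blast)
    moreover have "(0 :: ('n, 'v) summand) \<in> UNIV \<otimes>\<^sub>s ext_power r (lagr \<gamma>) \<otimes>\<^sub>s top_forms \<gamma> \<otimes>\<^sub>s V \<gamma>" for \<gamma>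
      unfolding tensor_sub_def by (rule complex_vector.span_zero)
    ultimately show "x \<in> chains \<C> V r"
      using x(2) unfolding x(1) pure_def chains_def by simp
  qed
qed

lemma clinear_D0: "clinear D0"
proof -
  have l: "clinear (tensor_map (\<lambda>P. P) (edge_op V A fr xi \<beta> \<gamma>))"
    if "\<beta> \<in> flats \<C>" "\<gamma> \<in> flats \<C>" "adjacent \<beta> \<gamma>" for \<beta> \<gamma>
    by (rule clinear_tensor_map[OF clinear_id' clinear_edge_op[OF arr qui fram that(2,1,3)
            complex_vector.subspace_0[OF csubspace_top_forms]
            complex_vector.subspace_0[OF csubspace_V[OF that(2)]]]])
  show ?thesis
    by (rule clinearI)
      (auto simp: d0_def fun_eq_iff scaleC_fun_def clinear_add[OF l] clinear_scale[OF l]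
        sum.distrib complex_vector.scale_sum_right intro!: sum.cong)
qed

lemma clinear_D: "clinear D"
  unfolding differential_def by (rule clinear_fun_diff[OF clinear_d1 clinear_D0])

section \<open>Images and squares of the two differentials\<close>

lemma finite_adjacent: "finite {\<beta> \<in> flats \<C>. adjacent \<beta> \<alpha>}"
  using finite_flats[OF arr] by simp

lemma A_in:
  assumes "\<alpha> \<in> flats \<C>" "\<beta> \<in> flats \<C>" "v \<in> V \<alpha>"
  shows "A \<beta> \<alpha> v \<in> V \<beta>"
proof -
  have "\<forall>\<alpha>\<in>flats \<C>. \<forall>\<beta>\<in>flats \<C>. clinear_on (V \<beta>) (A \<alpha> \<beta>) \<and> A \<alpha> \<beta> ` V \<beta> \<subseteq> V \<alpha>"
    using qui unfolding quiver_def by (elim conjE)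
  then show ?thesis using assms by blast
qed

lemma A_zero: "\<alpha> \<in> flats \<C> \<Longrightarrow> \<beta> \<in> flats \<C> \<Longrightarrow> A \<beta> \<alpha> 0 = 0"
proof -
  assume fl: "\<alpha> \<in> flats \<C>" "\<beta> \<in> flats \<C>"
  have "\<forall>\<alpha>\<in>flats \<C>. \<forall>\<beta>\<in>flats \<C>. clinear_on (V \<beta>) (A \<alpha> \<beta>) \<and> A \<alpha> \<beta> ` V \<beta> \<subseteq> V \<alpha>"
    using qui unfolding quiver_def by (elim conjE)
  then have "A \<beta> \<alpha> (0 *\<^sub>C 0) = 0 *\<^sub>C A \<beta> \<alpha> 0"
    using fl complex_vector.subspace_0[OF csubspace_V[OF fl(1)]] unfolding clinear_on_def by blast
  then show ?thesis by simp
qed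

lemma A_nonadjacent:
  assumes "\<alpha> \<in> flats \<C>" "\<beta> \<in> flats \<C>" "v \<in> V \<alpha>" "\<not> adjacent \<beta> \<alpha>"
  shows "A \<beta> \<alpha> v = 0"
proof -
  have "\<forall>\<alpha>\<in>flats \<C>. \<forall>\<beta>\<in>flats \<C>. \<not> adjacent \<alpha> \<beta> \<longrightarrow> (\<forall>v\<in>V \<beta>. A \<alpha> \<beta> v = 0)"
    using qui unfolding quiver_def by (elim conjE)
  then show ?thesis using assms by blast
qed

context
  fixes \<alpha> \<omega> v
  assumes gen: "\<alpha> \<in> flats \<C>" "\<omega> \<in> top_forms \<alpha>" "v \<in> V \<alpha>"
begin

lemma D0_pure_contract: "D0 (pure \<alpha> P ts \<omega> v) =
  (\<Sum>\<beta> | \<beta> \<in> flats \<C> \<and> adjacent \<beta> \<alpha>.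
    summand \<beta> (P \<otimes> contract (edge \<beta> \<alpha>) (wedge ts) \<otimes> fmap \<beta> \<alpha> \<omega> \<otimes> A \<beta> \<alpha> v))"
proof
  fix \<gamma>
  let ?x = "\<lambda>\<beta>. P \<otimes> contract (edge \<beta> \<alpha>) (wedge ts) \<otimes> fmap \<beta> \<alpha> \<omega> \<otimes> A \<beta> \<alpha> v"
  have "(\<Sum>\<beta> | \<beta> \<in> flats \<C> \<and> adjacent \<beta> \<alpha>. summand \<beta> (?x \<beta>)) \<gamma> =
      (\<Sum>\<beta> | \<beta> \<in> flats \<C> \<and> adjacent \<beta> \<alpha>. if \<gamma> = \<beta> then ?x \<beta> else 0)"
    by (simp add: sum_fun_apply summand_def)
  also have "\<dots> = (if \<gamma> \<in> flats \<C> \<and> adjacent \<gamma> \<alpha> then ?x \<gamma> else 0)"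
    using finite_adjacent by (simp add: sum.delta')
  finally show "D0 (pure \<alpha> P ts \<omega> v) \<gamma> = (\<Sum>\<beta> | \<beta> \<in> flats \<C> \<and> adjacent \<beta> \<alpha>. summand \<beta> (?x \<beta>)) \<gamma>"
    by (simp add: d0_pure[OF arr qui fram gen] edge_op_wedge[OF arr qui fram gen(1) _ _ gen(2,3)])
qed

lemma D0_pure: "D0 (pure \<alpha> P ts \<omega> v) =
  (\<Sum>\<beta> | \<beta> \<in> flats \<C> \<and> adjacent \<beta> \<alpha>.
    alt_sum (\<lambda>t us. edge \<beta> \<alpha> t *\<^sub>C pure \<beta> P us (fmap \<beta> \<alpha> \<omega>) (A \<beta> \<alpha> v)) ts)"
  unfolding D0_pure_contract by (simp only: summand_contract[OF clinear_edge_fun])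

end

text \<open>Along an edge one half of the Lagrangian subspace grows and the other shrinks by
  codimension one; the edge functional detects exactly the half that shrinks.\<close>

lemma edge_kernel:
  assumes "\<alpha> \<in> flats \<C>" "\<beta> \<in> flats \<C>" "adjacent \<beta> \<alpha>" "t \<in> lagr \<alpha>" "edge \<beta> \<alpha> t = 0"
  shows "t \<in> lagr \<beta>"
proof (cases "\<alpha> \<succ> \<beta>")
  case True
  then show ?thesis
    using assms pairing_fr_eq_0[OF assms(1,2) True] vanishing_covers[OF assms(1) True]
    by (auto simp: lagrangian_def edge_fun_def)
next
  case False
  then have "\<beta> \<succ> \<alpha>" using assms(3) by (auto simp: adjacent_def)
  then show ?thesis
    using False assms vanishing_of_pairing_xi[OF assms(1,2)] tangent_covers[OF assms(2,1)]
    by (auto simp: lagrangian_def edge_fun_def)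
qed

lemma csubspace_vanishing: "csubspace (vanishing \<C> \<alpha>)"
  using affine_fn_const[of 0]
  by (auto simp: complex_vector.subspace_def vanishing_def affine_fn_add affine_fn_scale
      plus_polyfn.rep_eq scaleC_polyfn.rep_eq zero_polyfn.rep_eq)

lemma csubspace_lagr: "\<alpha> \<in> flats \<C> \<Longrightarrow> csubspace (lagr \<alpha>)"
  using csubspace_tangent[OF arr, of \<alpha>] csubspace_vanishing[of \<alpha>]
  by (auto simp: complex_vector.subspace_def lagrangian_def scaleC_prod_def zero_prod_def)

text \<open>The factors left by the contraction lie in \<open>lagr \<alpha>\<close>, not visibly in
  \<open>lagr \<beta>\<close>. \<open>contract_wedge_proj\<close> replaces them by their projections
  to the kernel of the edge functional, which is contained in \<open>lagr \<beta>\<close>.\<close>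

lemma edge_contract_in_span:
  assumes fl: "\<alpha> \<in> flats \<C>" "\<beta> \<in> flats \<C>" "adjacent \<beta> \<alpha>" and P: "P \<in> B"
    and \<omega>: "\<omega> \<in> top_forms \<beta>" and v: "v \<in> V \<beta>" and ts: "set ts \<subseteq> lagr \<alpha>" "length ts = Suc r"
  shows "summand \<beta> (P \<otimes> contract (edge \<beta> \<alpha>) (wedge ts) \<otimes> \<omega> \<otimes> v) \<in> cspan (gens r B)"
proof (cases "\<exists>e\<in>lagr \<alpha>. edge \<beta> \<alpha> e \<noteq> 0")
  case True
  note lin = clinear_edge_fun[of fr xi \<beta> \<alpha>] and S = csubspace_lagr[OF fl(1)]
  obtain e' where e': "e' \<in> lagr \<alpha>" "edge \<beta> \<alpha> e' \<noteq> 0" using True by blast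
  define e where "e = (1 / edge \<beta> \<alpha> e') *\<^sub>C e'"
  have e: "e \<in> lagr \<alpha>" "edge \<beta> \<alpha> e = 1"
    using e' complex_vector.subspace_scale[OF S e'(1)]
    by (auto simp: e_def clinear_scale[OF lin] scaleC_complex_def)
  let ?p = "\<lambda>t. t - edge \<beta> \<alpha> t *\<^sub>C e"
  have p: "?p t \<in> lagr \<beta>" if "t \<in> lagr \<alpha>" for t
    by (intro edge_kernel[OF fl] complex_vector.subspace_diff complex_vector.subspace_scale S that e)
      (simp add: clinear_diff[OF lin] clinear_scale[OF lin] e(2) scaleC_complex_def)
  have "summand \<beta> (P \<otimes> contract (edge \<beta> \<alpha>) (wedge ts) \<otimes> \<omega> \<otimes> v) =
      alt_sum (\<lambda>t us. edge \<beta> \<alpha> t *\<^sub>C pure \<beta> P (map ?p us) \<omega> v) ts"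
    by (simp only: contract_wedge_proj[OF lin e(2)] clinear_alt_sum[OF clinear_summand_ext]
        clinear_scale[OF clinear_summand_ext] pure_summand)
  also have "\<dots> \<in> cspan (gens r B)"
    using ts by (intro alt_sum_in_subspace complex_vector.subspace_span complex_vector.span_scale
        pure_in_span fl(2) P \<omega> v) (auto intro!: p)
  finally show ?thesis .
next
  case False
  then have "edge \<beta> \<alpha> t = 0" if "t \<in> set ts" for t using that ts by blast
  then have "alt_sum (\<lambda>t us. edge \<beta> \<alpha> t *\<^sub>C wedge us) ts = alt_sum (\<lambda>t us. 0) ts"
    by (intro alt_sum_cong_set) simp
  then have "contract (edge \<beta> \<alpha>) (wedge ts) = 0"
    by (simp add: contract_wedge_alt[OF clinear_edge_fun] alt_sum_def)
  then show ?thesis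
    using clinear_0[OF clinear_summand_ext[of \<beta> P \<omega> v]] by (simp add: complex_vector.span_zero)
qed

text \<open>\<open>D0\<close> does not touch the coefficient operator, so it respects every
  restriction \<open>B\<close>, in particular the Bernstein filtration.\<close>

lemma D0_span:
  assumes "x \<in> cspan (gens (Suc r) B)"
  shows "D0 x \<in> cspan (gens r B)"
proof (rule cspan_image_induct[OF clinear_D0 complex_vector.subspace_span _ assms])
  fix x assume "x \<in> gens (Suc r) B"
  then obtain \<alpha> P ts \<omega> v where x: "x = pure \<alpha> P ts \<omega> v" "\<alpha> \<in> flats \<C>" "P \<in> B" "length ts = Suc r"
    "set ts \<subseteq> lagr \<alpha>" "\<omega> \<in> top_forms \<alpha>" "v \<in> V \<alpha>" by (rule gensE)
  show "D0 x \<in> cspan (gens r B)"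
    unfolding x(1) D0_pure_contract[OF x(2,6,7)]
    by (intro complex_vector.span_sum edge_contract_in_span[OF x(2)])
      (use x in \<open>auto intro: fmap_top A_in\<close>)
qed

lemma d1_chains:
  assumes "x \<in> chains \<C> V (Suc r)"
  shows "d1 x \<in> chains \<C> V r"
  unfolding chains_eq_span
proof (rule cspan_image_induct[OF clinear_d1 complex_vector.subspace_span _ assms[unfolded chains_eq_span]])
  fix x assume "x \<in> gens (Suc r) UNIV"
  then obtain \<alpha> P ts \<omega> v where x: "x = pure \<alpha> P ts \<omega> v" "\<alpha> \<in> flats \<C>" "P \<in> UNIV" "length ts = Suc r"
    "set ts \<subseteq> lagr \<alpha>" "\<omega> \<in> top_forms \<alpha>" "v \<in> V \<alpha>" by (rule gensE)
  show "d1 x \<in> cspan (gens r UNIV)"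
    unfolding x(1) d1_pure_alt
    by (intro alt_sum_in_subspace complex_vector.subspace_span pure_in_span) (use x in auto)
qed

lemma D_chains: "x \<in> chains \<C> V (Suc r) \<Longrightarrow> D x \<in> chains \<C> V r"
  unfolding differential_def
  by (intro complex_vector.subspace_diff[OF csubspace_chains] d1_chains)
    (simp_all add: chains_eq_span D0_span)

text \<open>Isotropy of \<open>lagr \<alpha>\<close> makes the operators commute, so the double
  alternating sum is symmetric.\<close>

lemma d1_d1_pure:
  assumes "\<alpha> \<in> flats \<C>" "set ts \<subseteq> lagr \<alpha>"
  shows "d1 (d1 (pure \<alpha> P ts \<omega> v)) = 0"
proof -
  have "P * weyl_embed t * weyl_embed s = P * weyl_embed s * weyl_embed t" if "t \<in> set ts" "s \<in> set ts" for t s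
  proof -
    have ts: "t \<in> lagr \<alpha>" "s \<in> lagr \<alpha>" using that assms(2) by auto
    then have "t \<in> affine_ops" "s \<in> affine_ops" by (auto simp: lagrangian_def vanishing_def)
    moreover have "symp t s = 0"
      using ts pairing_tangent[OF arr assms(1)] by (auto simp: symp_def lagrangian_def)
    ultimately show ?thesis using weyl_commutator[of t s] by (simp add: mult.assoc)
  qed
  then show ?thesis
    unfolding d1_pure_alt clinear_alt_sum[OF clinear_d1]
    by (intro alt_sum_symmetric_eq_0) (simp only:)
qed

text \<open>Each map deletes one factor, \<open>d1\<close> turning it into an operator and
  \<open>D0\<close> into a scalar, so only the order of deletion distinguishes the two
  composites.\<close>

lemma d1_D0_pure:
  assumes "\<alpha> \<in> flats \<C>" "\<omega> \<in> top_forms \<alpha>" "v \<in> V \<alpha>"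
  shows "d1 (D0 (pure \<alpha> P ts \<omega> v)) = - D0 (d1 (pure \<alpha> P ts \<omega> v))"
proof -
  let ?I = "{\<beta>. \<beta> \<in> flats \<C> \<and> adjacent \<beta> \<alpha>}"
  let ?B = "\<lambda>\<beta> t s us. edge \<beta> \<alpha> t *\<^sub>C pure \<beta> (P * weyl_embed s) us (fmap \<beta> \<alpha> \<omega>) (A \<beta> \<alpha> v)"
  have "d1 (D0 (pure \<alpha> P ts \<omega> v)) = (\<Sum>\<beta>\<in>?I. alt_sum (\<lambda>t. alt_sum (?B \<beta> t)) ts)"
    by (simp only: D0_pure[OF assms] clinear_sum[OF clinear_d1] clinear_alt_sum[OF clinear_d1]
        clinear_scale[OF clinear_d1] d1_pure_alt alt_sum_scale[symmetric])
  also have "\<dots> = - (\<Sum>\<beta>\<in>?I. alt_sum (\<lambda>t. alt_sum (\<lambda>s. ?B \<beta> s t)) ts)"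
    by (subst alt_sum_swap) (simp only: sum_negf)
  also have "(\<Sum>\<beta>\<in>?I. alt_sum (\<lambda>t. alt_sum (\<lambda>s. ?B \<beta> s t)) ts) = D0 (d1 (pure \<alpha> P ts \<omega> v))"
    by (simp only: d1_pure_alt clinear_alt_sum[OF clinear_D0] D0_pure[OF assms] alt_sum_sum)
  finally show ?thesis .
qed

lemma middle_sum:
  assumes fl: "\<alpha> \<in> flats \<C>" "\<gamma> \<in> flats \<C>" and v: "v \<in> V \<alpha>"
  shows "(\<Sum>\<beta>\<in>middle \<gamma> \<alpha>. A \<gamma> \<beta> (A \<beta> \<alpha> v)) = (\<Sum>\<beta>\<in>flats \<C>. A \<gamma> \<beta> (A \<beta> \<alpha> v))"
proof (rule sum.mono_neutral_left)
  show "\<forall>\<beta>\<in>flats \<C> - middle \<gamma> \<alpha>. A \<gamma> \<beta> (A \<beta> \<alpha> v) = 0"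
  proof
    fix \<beta> assume b: "\<beta> \<in> flats \<C> - middle \<gamma> \<alpha>"
    then consider "\<not> adjacent \<beta> \<alpha>" | "\<not> adjacent \<gamma> \<beta>" by (auto simp: middle_def)
    then show "A \<gamma> \<beta> (A \<beta> \<alpha> v) = 0"
      by cases (use b in \<open>simp_all add: A_nonadjacent fl v A_zero A_in\<close>)
  qed
qed (use finite_flats[OF arr] in \<open>auto simp: middle_def\<close>)

text \<open>By \<open>alt_sum_swap\<close>, twice the sum is the sum antisymmetrised in
  \<open>t\<close> and \<open>s\<close>. Its coefficients combine to \<open>path_form\<close>, and
  \<open>path_cases\<close> makes the sum over \<beta> vanish for each pair \<open>t\<close>,
  \<open>s\<close>.\<close>

lemma D0_D0_component:
  assumes fl: "\<alpha> \<in> flats \<C>" "\<gamma> \<in> flats \<C>" and \<omega>: "\<omega> \<in> top_forms \<alpha>" and v: "v \<in> V \<alpha>"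
    and ts: "set ts \<subseteq> lagr \<alpha>"
  shows "(\<Sum>\<beta>\<in>middle \<gamma> \<alpha>. alt_sum (\<lambda>t. alt_sum (\<lambda>s us. (edge \<beta> \<alpha> t * edge \<gamma> \<beta> s) *\<^sub>C
      pure \<gamma> P us (fmap \<gamma> \<beta> (fmap \<beta> \<alpha> \<omega>)) (A \<gamma> \<beta> (A \<beta> \<alpha> v)))) ts) = 0"
    (is "(\<Sum>\<beta>\<in>?M. alt_sum (\<lambda>t. alt_sum (?B \<beta> t)) ts) = 0")
proof (rule eq_neg_self_imp_0)
  let ?X = "\<Sum>\<beta>\<in>?M. alt_sum (\<lambda>t. alt_sum (?B \<beta> t)) ts"
  have B: "?B \<beta> t s us - ?B \<beta> s t us =
      pure \<gamma> P us (path_form \<gamma> \<beta> \<alpha> \<omega> t s) (A \<gamma> \<beta> (A \<beta> \<alpha> v))" for \<beta> t s us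
    by (simp only: path_form_def clinear_scale[OF clinear_pure_form] coef_def
        complex_vector.scale_left_diff_distrib clinear_diff[OF clinear_pure_form])
  have 0: "(\<Sum>\<beta>\<in>?M. pure \<gamma> P us (path_form \<gamma> \<beta> \<alpha> \<omega> t s) (A \<gamma> \<beta> (A \<beta> \<alpha> v))) = 0"
    if t: "t \<in> lagr \<alpha>" "s \<in> lagr \<alpha>" for t s us
    using path_cases[OF fl \<omega>]
  proof
    assume "\<forall>\<beta>\<in>?M. \<forall>t\<in>lagr \<alpha>. \<forall>s\<in>lagr \<alpha>. coef \<gamma> \<beta> \<alpha> t s = 0"
    then show ?thesis
      using t by (intro sum.neutral) (simp add: path_form_def clinear_0[OF clinear_pure_form])
  next
    assume h: "(\<forall>v\<in>V \<alpha>. (\<Sum>\<beta>\<in>flats \<C>. A \<gamma> \<beta> (A \<beta> \<alpha> v)) = 0) \<and>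
      (\<forall>\<beta>\<in>?M. \<forall>\<beta>'\<in>?M. \<forall>t\<in>lagr \<alpha>. \<forall>s\<in>lagr \<alpha>. path_form \<gamma> \<beta> \<alpha> \<omega> t s = path_form \<gamma> \<beta>' \<alpha> \<omega> t s)"
    show ?thesis
    proof (cases "?M = {}")
      case False
      then obtain \<beta>0 where "\<beta>0 \<in> ?M" by blast
      then have "path_form \<gamma> \<beta> \<alpha> \<omega> t s = path_form \<gamma> \<beta>0 \<alpha> \<omega> t s" if "\<beta> \<in> ?M" for \<beta>
        using conjunct2[OF h] t that by blast
      then have "(\<Sum>\<beta>\<in>?M. pure \<gamma> P us (path_form \<gamma> \<beta> \<alpha> \<omega> t s) (A \<gamma> \<beta> (A \<beta> \<alpha> v))) =
          pure \<gamma> P us (path_form \<gamma> \<beta>0 \<alpha> \<omega> t s) (\<Sum>\<beta>\<in>?M. A \<gamma> \<beta> (A \<beta> \<alpha> v))"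
        unfolding clinear_sum[OF clinear_pure_vec] by (intro sum.cong) simp_all
      also have "(\<Sum>\<beta>\<in>?M. A \<gamma> \<beta> (A \<beta> \<alpha> v)) = 0"
        using conjunct1[OF h] v unfolding middle_sum[OF fl v] by blast
      finally show ?thesis by (simp only: clinear_0[OF clinear_pure_vec])
    qed simp
  qed
  have "?X + ?X = ?X - (\<Sum>\<beta>\<in>?M. alt_sum (\<lambda>t. alt_sum (\<lambda>s. ?B \<beta> s t)) ts)"
    by (subst (2) alt_sum_swap) (simp only: sum_negf diff_conv_add_uminus)
  also have "\<dots> = (\<Sum>\<beta>\<in>?M. alt_sum (\<lambda>t. alt_sum (\<lambda>s us. ?B \<beta> t s us - ?B \<beta> s t us)) ts)"
    by (simp only: alt_sum2_diff sum_subtractf)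
  also have "\<dots> = alt_sum (\<lambda>t. alt_sum (\<lambda>s us. \<Sum>\<beta>\<in>?M.
      pure \<gamma> P us (path_form \<gamma> \<beta> \<alpha> \<omega> t s) (A \<gamma> \<beta> (A \<beta> \<alpha> v)))) ts"
    by (simp only: B alt_sum2_sum)
  also have "\<dots> = alt_sum (\<lambda>t. alt_sum (\<lambda>s us. 0)) ts"
    by (intro alt_sum_cong_set 0) (use ts in auto)
  also have "\<dots> = 0" by (simp add: alt_sum_def)
  finally show "?X = - ?X" by (simp only: eq_neg_iff_add_eq_0)
qed

lemma D0_D0_pure:
  assumes \<alpha>: "\<alpha> \<in> flats \<C>" and \<omega>: "\<omega> \<in> top_forms \<alpha>" and v: "v \<in> V \<alpha>" and ts: "set ts \<subseteq> lagr \<alpha>"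
  shows "D0 (D0 (pure \<alpha> P ts \<omega> v)) = 0"
proof -
  let ?I = "\<lambda>\<alpha>. {\<beta>. \<beta> \<in> flats \<C> \<and> adjacent \<beta> \<alpha>}"
  let ?Y = "\<lambda>\<beta> \<gamma>. alt_sum (\<lambda>t. alt_sum (\<lambda>s us. (edge \<beta> \<alpha> t * edge \<gamma> \<beta> s) *\<^sub>C
      pure \<gamma> P us (fmap \<gamma> \<beta> (fmap \<beta> \<alpha> \<omega>)) (A \<gamma> \<beta> (A \<beta> \<alpha> v)))) ts"
  have inner: "D0 (pure \<beta> P us (fmap \<beta> \<alpha> \<omega>) (A \<beta> \<alpha> v)) = (\<Sum>\<gamma>\<in>?I \<beta>. alt_sum (\<lambda>s ws. edge \<gamma> \<beta> s *\<^sub>C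
      pure \<gamma> P ws (fmap \<gamma> \<beta> (fmap \<beta> \<alpha> \<omega>)) (A \<gamma> \<beta> (A \<beta> \<alpha> v))) us)" if "\<beta> \<in> ?I \<alpha>" for \<beta> us
    by (rule D0_pure) (use that \<alpha> \<omega> v in \<open>auto intro: fmap_top A_in\<close>)
  have "D0 (D0 (pure \<alpha> P ts \<omega> v)) = (\<Sum>\<beta>\<in>?I \<alpha>. \<Sum>\<gamma>\<in>?I \<beta>. ?Y \<beta> \<gamma>)"
    unfolding D0_pure[OF \<alpha> \<omega> v] clinear_sum[OF clinear_D0] clinear_alt_sum[OF clinear_D0]
      clinear_scale[OF clinear_D0]
    by (intro sum.cong refl)
      (simp only: inner complex_vector.scale_sum_right alt_sum_sum scaleC_scaleC alt_sum_scale[symmetric])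
  also have "\<dots> = (\<Sum>\<beta>\<in>?I \<alpha>. \<Sum>\<gamma>\<in>flats \<C>. if adjacent \<gamma> \<beta> then ?Y \<beta> \<gamma> else 0)"
    by (rule sum.cong[OF refl], rule sum.inter_filter[OF finite_flats[OF arr]])
  also have "\<dots> = (\<Sum>\<gamma>\<in>flats \<C>. \<Sum>\<beta>\<in>?I \<alpha>. if adjacent \<gamma> \<beta> then ?Y \<beta> \<gamma> else 0)"
    by (rule sum.swap)
  also have "\<dots> = (\<Sum>\<gamma>\<in>flats \<C>. \<Sum>\<beta>\<in>middle \<gamma> \<alpha>. ?Y \<beta> \<gamma>)"
  proof (rule sum.cong[OF refl])
    fix \<gamma>
    have "middle \<gamma> \<alpha> = {\<beta> \<in> ?I \<alpha>. adjacent \<gamma> \<beta>}" by (auto simp: middle_def)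
    then show "(\<Sum>\<beta>\<in>?I \<alpha>. if adjacent \<gamma> \<beta> then ?Y \<beta> \<gamma> else 0) = (\<Sum>\<beta>\<in>middle \<gamma> \<alpha>. ?Y \<beta> \<gamma>)"
      by (simp only: sum.inter_filter[OF finite_adjacent])
  qed
  also have "\<dots> = 0" by (intro sum.neutral ballI D0_D0_component \<alpha> \<omega> v ts)
  finally show ?thesis .
qed

lemma D_D:
  assumes "x \<in> chains \<C> V r"
  shows "D (D x) = 0"
proof (rule cspan_kernel[OF clinear_compose[OF clinear_D clinear_D] _ assms[unfolded chains_eq_span]])
  fix x assume "x \<in> gens r UNIV"
  then obtain \<alpha> P ts \<omega> v where x: "x = pure \<alpha> P ts \<omega> v" "\<alpha> \<in> flats \<C>" "P \<in> UNIV" "length ts = r"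
    "set ts \<subseteq> lagr \<alpha>" "\<omega> \<in> top_forms \<alpha>" "v \<in> V \<alpha>" by (rule gensE)
  show "D (D x) = 0"
    by (simp add: differential_def clinear_diff[OF clinear_d1] clinear_diff[OF clinear_D0] x(1)
        d1_d1_pure[OF x(2,5)] d1_D0_pure[OF x(2,6,7)] D0_D0_pure[OF x(2,6,7,5)])
qed

end

section \<open>The Koszul homotopy\<close>

lemma peval_sum: "peval (sum g I) x = (\<Sum>i\<in>I. peval (g i) x)"
  by (induction I rule: infinite_finite_induct) (simp_all add: zero_polyfn.rep_eq plus_polyfn.rep_eq)

lemma affine_fn_of_functional:
  fixes lam :: "complex ^ 'n::finite \<Rightarrow> complex"
  assumes lam: "clinear lam"
  shows "\<exists>f :: 'n polyfn. affine_fn f \<and> (\<forall>x. peval f x = lam (x - p)) \<and> (\<forall>v. pairing v f = lam v)"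
proof -
  let ?c = "\<lambda>i. lam (axis i 1)"
  let ?f = "(\<Sum>i\<in>UNIV. ?c i *\<^sub>C Abs_polyfn (\<lambda>x. x $ i)) - lam p *\<^sub>C 1"
  have expand: "lam x = (\<Sum>i\<in>UNIV. ?c i * x $ i)" for x
  proof -
    have "lam (\<Sum>i\<in>UNIV. x $ i *s axis i 1) = (\<Sum>i\<in>UNIV. x $ i * ?c i)"
      by (simp add: clinear_sum[OF lam] clinear_scale[OF lam] scaleC_complex_def flip: scaleC_vec_eq)
    then show ?thesis by (simp add: basis_expansion mult.commute)
  qed
  have f: "peval ?f x = (\<Sum>i\<in>UNIV. ?c i * x $ i) - lam p" for x
    by (simp add: minus_polyfn.rep_eq peval_sum scaleC_polyfn.rep_eq one_polyfn.rep_eq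
        peval_coord)
  then have eq: "peval ?f x = lam (x - p)" for x by (simp only: clinear_diff[OF lam] expand[of x])
  have aff: "affine_fn ?f"
    unfolding affine_fn_def by (rule exI[of _ "\<chi> i. ?c i"], rule exI[of _ "- lam p"]) (simp add: f)
  have "pairing v ?f = lam v" for v
    using pairing_affine[OF aff, of p v] clinear_0[OF lam] by (simp add: eq)
  with aff eq show ?thesis by (intro exI[of _ ?f]) simp
qed

context quiver_complex
begin

lemma lagr_affine: "lagr \<alpha> \<subseteq> affine_ops"
  by (auto simp: lagrangian_def vanishing_def)

lemma symp_lagr: "\<alpha> \<in> flats \<C> \<Longrightarrow> t \<in> lagr \<alpha> \<Longrightarrow> s \<in> lagr \<alpha> \<Longrightarrow> symp t s = 0"
  using pairing_tangent[OF arr] by (auto simp: symp_def lagrangian_def)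

text \<open>A basis of \<open>tangent \<alpha>\<close> is extended to a basis \<open>b\<close> of
  the whole space, with dual affine coordinates \<open>Y\<close> centred at a point of \<alpha>.
  Then the \<open>b i\<close> tangent to \<alpha> and the \<open>Y i\<close> for the other indices,
  which vanish on \<alpha>, span \<open>lagr \<alpha>\<close>; the remaining vectors and coordinates
  form the complementary half.\<close>

lemma ex_darboux_basis:
  assumes \<alpha>: "\<alpha> \<in> flats \<C>"
  shows "\<exists>t s. darboux_basis (lagr \<alpha>) t s"
proof -
  obtain p where p: "p \<in> \<alpha>" using \<alpha> by (auto simp: flats_def)
  have T: "vec.subspace (tangent \<alpha>)" using csubspace_tangent[OF arr \<alpha>] by (simp add: csubspace_vec)
  obtain B1 where B1: "B1 \<subseteq> tangent \<alpha>" "vec.independent B1" "tangent \<alpha> \<subseteq> vec.span B1"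
    using vec.maximal_independent_subset by blast
  obtain B where B: "B1 \<subseteq> B" "vec.independent B" "UNIV \<subseteq> vec.span B"
    by (rule vec.maximal_independent_subset_extend[OF subset_UNIV B1(2)])
  have fin: "finite B" using vec.finiteI_independent[OF B(2)] .
  have "vec.span B = vec.span UNIV" using B(3) by auto
  from vec.dim_eq_card[OF this B(2)] have "card B = CARD('n)" by (simp only: vec_dim_card)
  then obtain b :: "'n \<Rightarrow> complex ^ 'n" where b: "bij_betw b UNIV B"
    using finite_same_card_bij[OF finite fin, of "UNIV :: 'n set"] by auto
  let ?r = "\<lambda>i v. vec.representation B v (b i)"
  have span: "v \<in> vec.span B" for v using B(3) by auto
  have lin: "clinear (?r i)" for i
    by (rule clinearI)
      (simp_all add: scaleC_vec_eq scaleC_complex_def vec.representation_add[OF B(2) span span]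
        vec.representation_scale[OF B(2) span])
  have r_sum: "v = (\<Sum>i\<in>UNIV. ?r i v *\<^sub>C b i)" for v
  proof -
    have "(\<Sum>i\<in>UNIV. ?r i v *\<^sub>C b i) = (\<Sum>c\<in>B. vec.representation B v c *s c)"
      unfolding scaleC_vec_eq by (rule sum.reindex_bij_betw[OF b])
    then show ?thesis using vec.sum_representation_eq[OF B(2) span fin order_refl] by simp
  qed
  have bB: "b i \<in> B" for i using b by (auto simp: bij_betw_def)
  have r_b: "?r i (b j) = (if i = j then 1 else 0)" for i j
    using b by (auto simp: vec.representation_basis[OF B(2) bB] bij_betw_def dest: injD)
  have "\<exists>f :: 'n polyfn. affine_fn f \<and> (\<forall>x. peval f x = ?r i (x - p)) \<and> (\<forall>v. pairing v f = ?r i v)" for i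
    by (rule affine_fn_of_functional[OF lin])
  then obtain Y :: "'n \<Rightarrow> 'n polyfn" where Y: "\<And>i. affine_fn (Y i)" "\<And>i x. peval (Y i) x = ?r i (x - p)"
    "\<And>i v. pairing v (Y i) = ?r i v" by metis
  define I where "I = {i. b i \<in> B1}"
  have r_tangent: "?r i v = 0" if "v \<in> tangent \<alpha>" "i \<notin> I" for i v
    using vec.representation_extend[OF B(2) subsetD[OF B1(3) that(1)] B(1)] that(2)
      vec.representation_ne_zero[of B1 v "b i"]
    by (auto simp: I_def)
  have b_tangent: "b i \<in> tangent \<alpha>" if "i \<in> I" for i using that B1(1) by (auto simp: I_def)
  define t where "t i = (if i \<in> I then (b i, 0) else (0, Y i))" for i
  \<comment> \<open>The sign gives \<open>symp (t i) (s i) = 1\<close> for the indices outside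
    \<open>I\<close> as well.\<close>
  define s where "s i = (if i \<in> I then (0, Y i) else (- b i, 0))" for i
  have aff0: "affine_fn (0 :: 'n polyfn)" using affine_fn_const[of 0] by simp
  have pairing_expand: "pairing v f = (\<Sum>i\<in>UNIV. ?r i v * pairing (b i) f)" for v and f :: "'n polyfn"
    using arg_cong[OF r_sum[of v], of "\<lambda>v. pairing v f"]
    by (simp add: clinear_sum[OF clinear_pairing(1)] clinear_scale[OF clinear_pairing(1)] scaleC_complex_def)
  have fun_expand: "f = peval f p *\<^sub>C 1 + (\<Sum>i\<in>UNIV. pairing (b i) f *\<^sub>C Y i)"
    if "affine_fn f" for f :: "'n polyfn"
  proof (rule peval_inject[THEN iffD1], rule ext)
    fix x
    have "peval f x = peval f p + pairing (x - p) f" using pairing_affine[OF that, of p "x - p"] by simp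
    then show "peval f x = peval (peval f p *\<^sub>C 1 + (\<Sum>i\<in>UNIV. pairing (b i) f *\<^sub>C Y i)) x"
      by (simp add: plus_polyfn.rep_eq scaleC_polyfn.rep_eq one_polyfn.rep_eq peval_sum Y(2)
          pairing_expand[of "x - p"] mult.commute)
  qed
  have fst_sum: "fst (\<Sum>i\<in>UNIV. g i) = (\<Sum>i\<in>UNIV. fst (g i))" "snd (\<Sum>i\<in>UNIV. g i) = (\<Sum>i\<in>UNIV. snd (g i))"
    for g :: "'n \<Rightarrow> (complex ^ 'n) \<times> 'n polyfn"
    by (simp_all add: fst_sum snd_sum)
  have expand: "w = (0, peval (snd w) p *\<^sub>C 1) +
      (\<Sum>i\<in>UNIV. ?r i (fst w) *\<^sub>C (b i, 0) + pairing (b i) (snd w) *\<^sub>C (0, Y i))"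
    if "w \<in> affine_ops" for w :: "(complex ^ 'n) \<times> 'n polyfn"
    using r_sum[of "fst w"] fun_expand[of "snd w"] that
    by (intro prod_eqI) (auto simp: fst_sum scaleC_prod_def)
  have p0: "pairing v (0 :: 'n polyfn) = 0" "pairing 0 f = 0" "pairing (- v) f = - pairing v f" for v and f :: "'n polyfn"
    using clinear_0[OF clinear_pairing(2)] clinear_0[OF clinear_pairing(1)]
      clinear_scale[OF clinear_pairing(1), of "- 1" v f]
    by (auto simp: complex_vector.scale_minus_left scaleC_one)
  have "darboux_basis (lagr \<alpha>) t s"
  proof
    show "lagr \<alpha> \<subseteq> affine_ops" by (rule lagr_affine)
    show "t i \<in> lagr \<alpha>" for i
    proof (cases "i \<in> I")
      case True
      then show ?thesis
        using b_tangent csubspace_vanishing[of \<alpha>] by (simp add: t_def lagrangian_def complex_vector.subspace_0)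
    next
      case False
      have "peval (Y i) x = 0" if "x \<in> \<alpha>" for x
        using r_tangent[OF _ False] tangent_iff[OF arr \<alpha> p, of "x - p"] that by (simp add: Y(2))
      then show ?thesis
        using False Y(1) csubspace_tangent[OF arr \<alpha>]
        by (auto simp: t_def lagrangian_def complex_vector.subspace_0 vanishing_def stratum_def)
    qed
    show "s i \<in> affine_ops" for i by (simp add: s_def Y(1) aff0)
    show "symp u w = 0" if "u \<in> lagr \<alpha>" "w \<in> lagr \<alpha>" for u w by (rule symp_lagr[OF \<alpha> that])
    show "symp (s i) (s j) = 0" for i j
      by (auto simp: symp_def s_def p0 Y(3) r_b clinear_0[OF lin] vec.representation_neg[OF B(2) span])
    show "u = (\<Sum>i\<in>UNIV. symp u (s i) *\<^sub>C t i)" if u: "u \<in> lagr \<alpha>" for u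
    proof -
      have u': "fst u \<in> tangent \<alpha>" "snd u \<in> vanishing \<C> \<alpha>" using u by (auto simp: lagrangian_def)
      have "?r i (fst u) *\<^sub>C (b i, 0) + pairing (b i) (snd u) *\<^sub>C (0, Y i) = symp u (s i) *\<^sub>C t i" for i
        using r_tangent[OF u'(1), of i] pairing_tangent[OF arr \<alpha> u'(2) b_tangent, of i]
        by (simp add: symp_def s_def t_def p0 Y(3) clinear_0[OF lin])
      moreover have "peval (snd u) p = 0" by (rule vanishing_flat[OF arr \<alpha> u'(2) p])
      ultimately show ?thesis
        using expand[of u] u lagr_affine[of \<alpha>] by (auto simp: zero_prod_def[symmetric])
    qed
    show "weyl_embed w \<in> cspan (insert 1 (weyl_embed ` (lagr \<alpha> \<union> range s)))" (is "_ \<in> ?M")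
      if w: "w \<in> affine_ops" for w
    proof -
      have t: "t i \<in> lagr \<alpha>" for i by fact
      have M: "weyl_embed (t i) \<in> ?M" "weyl_embed (s i) \<in> ?M" "1 \<in> ?M" for i
        using t by (auto intro!: complex_vector.span_base)
      have neg: "weyl_embed (b i, 0) = - weyl_embed (- b i, 0)" for i
        using clinear_scale[OF clinear_weyl_embed, of "- 1" "(b i, 0)"]
        by (simp add: scaleC_prod_def complex_vector.scale_minus_left scaleC_one)
      have "weyl_embed (b i, 0) \<in> ?M" "weyl_embed (0, Y i) \<in> ?M" for i
        using M(1,2)[of i] complex_vector.span_neg[OF M(2)[of i]] neg[of i]
        by (auto simp: t_def s_def split: if_splits)
      moreover have "weyl_embed (0, c *\<^sub>C 1) = (c *\<^sub>C 1 :: 'n weyl)" for c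
      proof -
        have "weyl_deriv (0 :: complex ^ 'n) = 0"
          using weyl_deriv_linear(2)[of 0 "0 :: complex ^ 'n"] by simp
        moreover have "weyl_mult (1 :: 'n polyfn) = 1"
          by (rule weyl_apply_inject[THEN iffD1]) (simp add: weyl_mult.rep_eq one_weyl.rep_eq)
        ultimately show ?thesis by (simp add: weyl_embed_def weyl_mult_linear)
      qed
      ultimately show ?thesis
        using M(3)
        by (subst expand[OF w])
          (simp only: clinear_add[OF clinear_weyl_embed] clinear_sum[OF clinear_weyl_embed]
            clinear_scale[OF clinear_weyl_embed] complex_vector.span_add complex_vector.span_sum
            complex_vector.span_scale)
    qed
  qed
  then show ?thesis by blast
qed

end

section \<open>The homotopy and its eigenvalues\<close>

locale quiver_homotopy = quiver_complex \<C> V A fr xi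
  for \<C> :: "(complex ^ 'n) set set"
    and V :: "(complex ^ 'n) set \<Rightarrow> 'v::complex_vector set"
    and A :: "(complex ^ 'n) set \<Rightarrow> (complex ^ 'n) set \<Rightarrow> 'v \<Rightarrow> 'v"
    and fr :: "(complex ^ 'n) set \<Rightarrow> (complex ^ 'n) set \<Rightarrow> 'n::finite polyfn"
    and xi :: "(complex ^ 'n) set \<Rightarrow> (complex ^ 'n) set \<Rightarrow> complex ^ 'n" +
  fixes T S :: "(complex ^ 'n) set \<Rightarrow> 'n \<Rightarrow> (complex ^ 'n) \<times> 'n polyfn"
  assumes darboux: "\<alpha> \<in> flats \<C> \<Longrightarrow> darboux_basis (lagr \<alpha>) (T \<alpha>) (S \<alpha>)"
begin

text \<open>The commutator with \<open>S \<alpha> i\<close> is the partial derivative with respect to \<open>T \<alpha> i\<close>, so \<open>h\<close> is the usual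
  homotopy of the Koszul complex of a polynomial ring.\<close>

definition h :: "('n, 'v) chain \<Rightarrow> ('n, 'v) chain"
  where "h x = (\<lambda>\<alpha>. \<Sum>i\<in>UNIV. tensor_map (\<lambda>P. P * weyl_embed (S \<alpha> i) - weyl_embed (S \<alpha> i) * P)
    (tensor_map (lwedge (T \<alpha> i)) (\<lambda>u. u)) (x \<alpha>))"

lemma clinear_h: "clinear h"
proof -
  note l = clinear_tensor_map[OF clinear_commutator clinear_tensor_map[OF clinear_lwedge clinear_id']]
  show ?thesis
    by (rule clinearI) (simp_all add: h_def fun_eq_iff scaleC_fun_def clinear_add[OF l]
        clinear_scale[OF l] sum.distrib complex_vector.scale_sum_right)
qed

lemma h_pure: "h (pure \<alpha> P ts \<omega> v) =
  (\<Sum>i\<in>UNIV. pure \<alpha> (P * weyl_embed (S \<alpha> i) - weyl_embed (S \<alpha> i) * P) (T \<alpha> i # ts) \<omega> v)"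
proof
  fix \<gamma>
  note e = clinear_tensor_map[OF clinear_lwedge clinear_id']
  show "h (pure \<alpha> P ts \<omega> v) \<gamma> =
    (\<Sum>i\<in>UNIV. pure \<alpha> (P * weyl_embed (S \<alpha> i) - weyl_embed (S \<alpha> i) * P) (T \<alpha> i # ts) \<omega> v) \<gamma>"
    by (cases "\<gamma> = \<alpha>") (simp_all add: h_def pure_def sum_fun_apply
        tensor_map_tensor[OF clinear_commutator e] tensor_map_tensor[OF clinear_lwedge clinear_id']
        lwedge_wedge clinear_0[OF clinear_tensor_map[OF clinear_commutator e]])
qed

text \<open>The commutator with \<open>S \<alpha> i\<close> deletes a letter; this is where the
  Bernstein degree drops.\<close>

lemma h_span:
  assumes "x \<in> cspan (gens r (words (Suc q)))"
  shows "h x \<in> cspan (gens (Suc r) (words q))"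
proof (rule cspan_image_induct[OF clinear_h complex_vector.subspace_span _ assms])
  fix x assume "x \<in> gens r (words (Suc q))"
  then obtain \<alpha> P ts \<omega> v where x: "x = pure \<alpha> P ts \<omega> v" "\<alpha> \<in> flats \<C>" "P \<in> words (Suc q)" "length ts = r"
    "set ts \<subseteq> lagr \<alpha>" "\<omega> \<in> top_forms \<alpha>" "v \<in> V \<alpha>" by (rule gensE)
  interpret B: darboux_basis "lagr \<alpha>" "T \<alpha>" "S \<alpha>" by (rule darboux[OF x(2)])
  show "h x \<in> cspan (gens (Suc r) (words q))"
    unfolding x(1) h_pure
    by (intro complex_vector.span_sum pure_in_span words_commutator x B.s_in) (use x B.t_in in auto)
qed

lemma h_chains: "x \<in> chains \<C> V r \<Longrightarrow> h x \<in> chains \<C> V (Suc r)"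
  unfolding chains_eq_span
proof (rule cspan_image_induct[OF clinear_h complex_vector.subspace_span])
  fix x assume "x \<in> gens r UNIV"
  then obtain \<alpha> P ts \<omega> v where x: "x = pure \<alpha> P ts \<omega> v" "\<alpha> \<in> flats \<C>" "P \<in> UNIV" "length ts = r"
    "set ts \<subseteq> lagr \<alpha>" "\<omega> \<in> top_forms \<alpha>" "v \<in> V \<alpha>" by (rule gensE)
  interpret B: darboux_basis "lagr \<alpha>" "T \<alpha>" "S \<alpha>" by (rule darboux[OF x(2)])
  show "h x \<in> cspan (gens (Suc r) UNIV)"
    unfolding x(1) h_pure
    by (intro complex_vector.span_sum pure_in_span x UNIV_I) (use x B.t_in in auto)
qed

text \<open>In d_1 h, deleting the new factor \<open>T \<alpha> i\<close> gives the Euler term and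
  the other deletions give minus the sum of \<open>?G\<close>. In h d_1, the Leibniz rule for the
  commutator returns the sum of \<open>?G\<close> and, through \<open>t_basis\<close>, terms with
  the deleted factor put back in front, which add up to r copies of the chain.\<close>

lemma d1_h_pure:
  assumes \<alpha>: "\<alpha> \<in> flats \<C>" and ts: "set ts \<subseteq> lagr \<alpha>"
  shows "d1 (h (pure \<alpha> P ts \<omega> v)) + h (d1 (pure \<alpha> P ts \<omega> v)) =
    pure \<alpha> (darboux_basis.euler (T \<alpha>) (S \<alpha>) P) ts \<omega> v + of_nat (length ts) *\<^sub>C pure \<alpha> P ts \<omega> v"
proof -
  interpret B: darboux_basis "lagr \<alpha>" "T \<alpha>" "S \<alpha>" by (rule darboux[OF \<alpha>])
  let ?c = "\<lambda>P i. P * weyl_embed (S \<alpha> i) - weyl_embed (S \<alpha> i) * P"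
  let ?G = "\<lambda>t us. \<Sum>i\<in>UNIV. pure \<alpha> (?c P i * weyl_embed t) (T \<alpha> i # us) \<omega> v"
  have 1: "d1 (h (pure \<alpha> P ts \<omega> v)) = pure \<alpha> (B.euler P) ts \<omega> v - alt_sum ?G ts"
    unfolding h_pure clinear_sum[OF clinear_d1] d1_pure_alt alt_sum_Cons sum_subtractf alt_sum_sum
    by (simp only: B.euler_def clinear_sum[OF clinear_pure_op])
  have comm: "?c (P * weyl_embed t) i = ?c P i * weyl_embed t + symp t (S \<alpha> i) *\<^sub>C P" if "t \<in> lagr \<alpha>" for t i
  proof -
    have "weyl_embed t * weyl_embed (S \<alpha> i) = weyl_embed (S \<alpha> i) * weyl_embed t + symp t (S \<alpha> i) *\<^sub>C 1"
      using that lagr_affine B.s_in by (intro weyl_commutator) auto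
    then show ?thesis by (simp add: mult.assoc distrib_left left_diff_distrib weyl_scale_mult)
  qed
  have "h (pure \<alpha> (P * weyl_embed t) us \<omega> v) = ?G t us + pure \<alpha> P (t # us) \<omega> v" if "t \<in> lagr \<alpha>" for t us
  proof -
    have "pure \<alpha> P (t # us) \<omega> v = (\<Sum>i\<in>UNIV. symp t (S \<alpha> i) *\<^sub>C pure \<alpha> P (T \<alpha> i # us) \<omega> v)"
      using arg_cong[OF B.t_basis[OF that], of "\<lambda>t. pure \<alpha> P (t # us) \<omega> v"]
      by (simp only: clinear_sum[OF clinear_pure_Cons] clinear_scale[OF clinear_pure_Cons])
    then show ?thesis
      by (simp only: h_pure comm[OF that] clinear_add[OF clinear_pure_op] clinear_scale[OF clinear_pure_op]
          sum.distrib)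
  qed
  then have "h (d1 (pure \<alpha> P ts \<omega> v)) = alt_sum (\<lambda>t us. ?G t us + pure \<alpha> P (t # us) \<omega> v) ts"
    unfolding d1_pure_alt clinear_alt_sum[OF clinear_h] by (intro alt_sum_cong_set) (use ts in auto)
  also have "\<dots> = alt_sum ?G ts + of_nat (length ts) *\<^sub>C pure \<alpha> P ts \<omega> v"
    by (simp only: alt_sum_add pure_summand flip: clinear_alt_sum[OF clinear_summand_ext]
        alt_sum_wedge_Cons clinear_scale[OF clinear_summand_ext])
  finally show ?thesis by (simp add: 1)
qed

text \<open>The rank orders the normally ordered monomials first by degree, then by their degree in the symbols of
  \<open>lagr \<alpha>\<close>, which is the eigenvalue of the Euler operator.\<close>

definition ranked where
  "ranked r n = {pure \<alpha> (word us * word ws) ts \<omega> v | \<alpha> us ws ts \<omega> v. \<alpha> \<in> flats \<C> \<and>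
    set us \<subseteq> range (S \<alpha>) \<and> set ws \<subseteq> lagr \<alpha> \<and> (length us + length ws)\<^sup>2 + length ws < n \<and>
    length ts = r \<and> set ts \<subseteq> lagr \<alpha> \<and> \<omega> \<in> top_forms \<alpha> \<and> v \<in> V \<alpha>}"

lemma ranked_mono: "m \<le> n \<Longrightarrow> ranked r m \<subseteq> ranked r n"
  unfolding ranked_def by (smt (verit) Collect_mono order_less_le_trans)

text \<open>A normally ordered monomial of degree l has at most l Lagrangian letters, so its rank
  stays below (l + 1)^2, and degree below q means rank below q^2.\<close>

lemma words_ranked: "cspan (gens r (words q)) \<subseteq> cspan (ranked r (q\<^sup>2))"
proof (rule complex_vector.span_minimal[OF _ complex_vector.subspace_span], rule subsetI)
  fix x assume "x \<in> gens r (words q)"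
  then obtain \<alpha> P ts \<omega> v where x: "x = pure \<alpha> P ts \<omega> v" "\<alpha> \<in> flats \<C>" "P \<in> words q" "length ts = r"
    "set ts \<subseteq> lagr \<alpha>" "\<omega> \<in> top_forms \<alpha>" "v \<in> V \<alpha>" by (rule gensE)
  interpret B: darboux_basis "lagr \<alpha>" "T \<alpha>" "S \<alpha>" by (rule darboux[OF x(2)])
  have "P \<in> cspan (B.normal_words q)" using B.words_normal x(3) by blast
  then show "x \<in> cspan (ranked r (q\<^sup>2))"
    unfolding x(1)
  proof (rule cspan_image_induct[OF clinear_pure_op complex_vector.subspace_span, rotated])
    fix Q assume "Q \<in> B.normal_words q"
    then obtain us ws where Q: "Q = word us * word ws" "set us \<subseteq> range (S \<alpha>)" "set ws \<subseteq> lagr \<alpha>"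
      "length us + length ws < q" unfolding B.normal_words_def by blast
    let ?l = "length us + length ws"
    have "?l\<^sup>2 + length ws < (Suc ?l)\<^sup>2" by (simp add: power2_eq_square)
    also have "(Suc ?l)\<^sup>2 \<le> q\<^sup>2" using Q(4) by (intro power_mono) auto
    finally have "pure \<alpha> Q ts \<omega> v \<in> ranked r (q\<^sup>2)"
      unfolding Q(1) ranked_def using Q x by blast
    then show "pure \<alpha> Q ts \<omega> v \<in> cspan (ranked r (q\<^sup>2))" by (rule complex_vector.span_base)
  qed
qed

text \<open>Since k <= l + k, the rank lies between (l + k)^2 and (l + k + 1)^2, the latter
  excluded; it therefore determines the total degree and then k.\<close>

lemma rank_determines:
  fixes l k l' k' :: nat
  assumes "(l + k)\<^sup>2 + k = (l' + k')\<^sup>2 + k'"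
  shows "k = k'"
proof -
  have less: "(a + b)\<^sup>2 + b < (a' + b')\<^sup>2 + b'" if "a + b < a' + b'" for a b a' b' :: nat
  proof -
    have "(a + b)\<^sup>2 + b < (Suc (a + b))\<^sup>2" by (simp add: power2_eq_square)
    also have "\<dots> \<le> (a' + b')\<^sup>2" using that by (intro power_mono) auto
    finally show ?thesis by simp
  qed
  have "l + k = l' + k'" using less[of l k l' k'] less[of l' k' l k] assms by (metis linorder_neqE_nat nat_less_le)
  then show ?thesis using assms by simp
qed

text \<open>Of the two maps only \<open>h\<close> changes the coefficient operator, and in either
  order it lowers its degree.\<close>

lemma remainder_span:
  assumes "x \<in> cspan (gens (Suc r) (words (Suc q)))"
  shows "D0 (h x) + h (D0 x) \<in> cspan (gens (Suc r) (words q))"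
  using assms by (intro complex_vector.span_add D0_span h_span) auto

text \<open>All monomials of rank exactly \<open>n\<close> have the same number of Lagrangian
  letters, so modulo smaller rank the homotopy is one scalar. The scalar is nonzero because the
  exterior degree is positive.\<close>

lemma homotopy_ranked:
  "\<exists>c :: complex. c \<noteq> 0 \<and> (\<forall>x\<in>cspan (ranked (Suc r) (Suc n)).
    D (h x) + h (D x) - c *\<^sub>C x \<in> cspan (ranked (Suc r) n))"
proof -
  \<comment> \<open>If no monomial has rank \<open>n\<close>, the condition is vacuous and any
    \<kappa> will do.\<close>
  obtain \<kappa> where \<kappa>: "\<And>l k :: nat. (l + k)\<^sup>2 + k = n \<Longrightarrow> k = \<kappa>"
    using rank_determines by metis
  let ?c = "of_nat (\<kappa> + Suc r) :: complex"
  let ?F = "\<lambda>x. D (h x) + h (D x) - ?c *\<^sub>C x"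
  have lin: "clinear ?F"
    by (intro clinear_fun_diff clinear_plus clinear_compose[OF clinear_D clinear_h]
        clinear_compose[OF clinear_h clinear_D] clinear_scaled clinear_id')
  have "?F x \<in> cspan (ranked (Suc r) n)" if gen: "x \<in> ranked (Suc r) (Suc n)" for x
  proof -
    obtain \<alpha> us ws ts \<omega> v where x: "x = pure \<alpha> (word us * word ws) ts \<omega> v" "\<alpha> \<in> flats \<C>"
      "set us \<subseteq> range (S \<alpha>)" "set ws \<subseteq> lagr \<alpha>" "(length us + length ws)\<^sup>2 + length ws < Suc n"
      "length ts = Suc r" "set ts \<subseteq> lagr \<alpha>" "\<omega> \<in> top_forms \<alpha>" "v \<in> V \<alpha>"
      using gen unfolding ranked_def by blast
    interpret B: darboux_basis "lagr \<alpha>" "T \<alpha>" "S \<alpha>" by (rule darboux[OF x(2)])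
    let ?l = "length us + length ws"
    have "D (h x) + h (D x) = (d1 (h x) + h (d1 x)) - (D0 (h x) + h (D0 x))"
      by (simp add: differential_def clinear_diff[OF clinear_h])
    also have "d1 (h x) + h (d1 x) = of_nat (length ws + Suc r) *\<^sub>C x"
      unfolding x(1) d1_h_pure[OF x(2,7)]
      by (simp add: B.euler_normal[OF x(3,4)] clinear_scale[OF clinear_pure_op] x(6) scaleC_add_left algebra_simps)
    finally have Dh: "D (h x) + h (D x) = of_nat (length ws + Suc r) *\<^sub>C x - (D0 (h x) + h (D0 x))" .
    have "of_nat (length ws + Suc r) *\<^sub>C x - ?c *\<^sub>C x = (of_nat (length ws) - of_nat \<kappa>) *\<^sub>C x"
      by (simp flip: complex_vector.scale_left_diff_distrib)
    then have F: "?F x = (of_nat (length ws) - of_nat \<kappa>) *\<^sub>C x - (D0 (h x) + h (D0 x))"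
      unfolding Dh cancel_ab_semigroup_add_class.diff_right_commute[of _ "D0 (h x) + h (D0 x)"] by (simp only:)
    have "word (us @ ws) \<in> words (Suc ?l)"
    proof (rule word_in_words)
      have "range (S \<alpha>) \<subseteq> affine_ops" using B.s_in by blast
      then show "set (us @ ws) \<subseteq> affine_ops" using x(3,4) lagr_affine[of \<alpha>] by (simp only: set_append) blast
    qed simp
    then have "x \<in> cspan (gens (Suc r) (words (Suc ?l)))"
      unfolding x(1) by (intro pure_in_span x) simp
    \<comment> \<open>The remainder has degree below \<open>?l\<close>, hence rank below
      \<open>?l\<^sup>2\<close>, which is at most \<open>n\<close>.\<close>
    then have "D0 (h x) + h (D0 x) \<in> cspan (ranked (Suc r) (?l\<^sup>2))"
      using remainder_span words_ranked by blast
    moreover have "ranked (Suc r) (?l\<^sup>2) \<subseteq> ranked (Suc r) n" by (rule ranked_mono) (use x(5) in simp)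
    ultimately have R: "D0 (h x) + h (D0 x) \<in> cspan (ranked (Suc r) n)"
      using complex_vector.span_mono by blast
    have "(of_nat (length ws) - of_nat \<kappa>) *\<^sub>C x \<in> cspan (ranked (Suc r) n)"
    proof (cases "?l\<^sup>2 + length ws = n")
      case True
      then show ?thesis using \<kappa>[OF True] by (simp add: complex_vector.span_zero)
    next
      case False
      then have "x \<in> ranked (Suc r) n" unfolding ranked_def using x by fastforce
      then show ?thesis by (intro complex_vector.span_scale complex_vector.span_base)
    qed
    then show ?thesis unfolding F using R by (rule complex_vector.span_diff)
  qed
  then have "?F x \<in> cspan (ranked (Suc r) n)" if "x \<in> cspan (ranked (Suc r) (Suc n))" for x
    using cspan_image_induct[OF lin complex_vector.subspace_span _ that] by blast
  moreover have "?c \<noteq> 0" by (simp only: of_nat_eq_0_iff)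
  ultimately show ?thesis by blast
qed

section \<open>Descent along the rank\<close>

lemma chain_in_words:
  assumes "x \<in> chains \<C> V r"
  shows "\<exists>q. x \<in> cspan (gens r (words q))"
  using assms unfolding chains_eq_span
proof (induction rule: complex_vector.span_induct_alt)
  case base
  show ?case using complex_vector.span_zero by blast
next
  case (step c x y)
  obtain \<alpha> P ts \<omega> v where x: "x = pure \<alpha> P ts \<omega> v" "\<alpha> \<in> flats \<C>" "P \<in> UNIV" "length ts = r"
    "set ts \<subseteq> lagr \<alpha>" "\<omega> \<in> top_forms \<alpha>" "v \<in> V \<alpha>" using step(1) by (rule gensE)
  obtain p where p: "P \<in> words p" using ex_words by blast
  obtain q where q: "y \<in> cspan (gens r (words q))" using step(2) by blast
  have "gens r (words q) \<subseteq> gens r (words (max p q))"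
    using words_mono[of q "max p q"] unfolding gens_def by fastforce
  then have "y \<in> cspan (gens r (words (max p q)))" using q complex_vector.span_mono by blast
  moreover have "x \<in> cspan (gens r (words (max p q)))"
    unfolding x(1) by (intro pure_in_span x) (use p words_mono[of p "max p q"] in auto)
  ultimately show ?case by (blast intro: complex_vector.span_add complex_vector.span_scale)
qed

lemma ranked_chains: "cspan (ranked r n) \<subseteq> chains \<C> V r"
proof -
  have "ranked r n \<subseteq> gens r UNIV" unfolding ranked_def gens_def by blast
  then show ?thesis unfolding chains_eq_span by (rule complex_vector.span_mono)
qed

text \<open>For a cycle \<open>x\<close>, the chain \<open>D (h x) - c x\<close> is again a cycle
  and has smaller rank, so it is a boundary by induction; dividing by \<open>c\<close> exhibits
  \<open>x\<close> as one. At rank bound 0 there are no generators and \<open>x\<close> is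
  zero.\<close>

lemma ranked_exact:
  assumes "x \<in> cspan (ranked (Suc r) n)" "D x = 0"
  shows "x \<in> D ` chains \<C> V (Suc (Suc r))"
  using assms
proof (induction n arbitrary: x)
  case 0
  then have "x = D 0" by (simp add: ranked_def clinear_0[OF clinear_D])
  then show ?case using complex_vector.subspace_0[OF csubspace_chains] by blast
next
  case (Suc n)
  obtain c :: complex where c: "c \<noteq> 0" "\<And>x. x \<in> cspan (ranked (Suc r) (Suc n)) \<Longrightarrow>
      D (h x) + h (D x) - c *\<^sub>C x \<in> cspan (ranked (Suc r) n)"
    using homotopy_ranked[of r n] by blast
  have hx: "h x \<in> chains \<C> V (Suc (Suc r))" using Suc.prems(1) ranked_chains h_chains by blast
  have "D (h x) - c *\<^sub>C x \<in> cspan (ranked (Suc r) n)"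
    using c(2)[OF Suc.prems(1)] by (simp only: Suc.prems(2) clinear_0[OF clinear_h] add_0_right)
  moreover have "D (D (h x) - c *\<^sub>C x) = 0"
    by (simp only: clinear_diff[OF clinear_D] clinear_scale[OF clinear_D] Suc.prems(2) D_D[OF hx]
        complex_vector.scale_zero_right diff_0_right)
  ultimately obtain y where y: "y \<in> chains \<C> V (Suc (Suc r))" "D (h x) - c *\<^sub>C x = D y"
    using Suc.IH by blast
  have "c *\<^sub>C x = D (h x - y)" by (simp only: clinear_diff[OF clinear_D] y(2)[symmetric] diff_diff_eq2) simp
  then have "(1 / c) *\<^sub>C c *\<^sub>C x = D ((1 / c) *\<^sub>C (h x - y))" by (simp only: clinear_scale[OF clinear_D])
  then have "x = D ((1 / c) *\<^sub>C (h x - y))" using c(1) by (simp add: scaleC_scaleC scaleC_one)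
  moreover have "(1 / c) *\<^sub>C (h x - y) \<in> chains \<C> V (Suc (Suc r))"
    by (intro complex_vector.subspace_scale complex_vector.subspace_diff csubspace_chains hx y(1))
  ultimately show ?case by blast
qed

lemma exact:
  "{x \<in> chains \<C> V (Suc r). D x = 0} = D ` chains \<C> V (Suc (Suc r))"
proof
  show "{x \<in> chains \<C> V (Suc r). D x = 0} \<subseteq> D ` chains \<C> V (Suc (Suc r))"
    using chain_in_words words_ranked ranked_exact by blast
  show "D ` chains \<C> V (Suc (Suc r)) \<subseteq> {x \<in> chains \<C> V (Suc r). D x = 0}"
    using D_chains D_D by blast
qed

text \<open>\<open>lagr \<alpha>\<close> is spanned by as many vectors as the ambient dimension.
  Injectivity at the left end thus becomes exactness in degree N with zero source.\<close>

lemma chains_above_dimension: "chains \<C> V (Suc CARD('n)) = {0}"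
proof -
  have "x = 0" if gen: "x \<in> gens (Suc CARD('n)) UNIV" for x
  proof -
    obtain \<alpha> P ts \<omega> v where x: "x = pure \<alpha> P ts \<omega> v" "\<alpha> \<in> flats \<C>" "P \<in> UNIV" "length ts = Suc CARD('n)"
      "set ts \<subseteq> lagr \<alpha>" "\<omega> \<in> top_forms \<alpha>" "v \<in> V \<alpha>" using gen by (rule gensE)
    interpret B: darboux_basis "lagr \<alpha>" "T \<alpha>" "S \<alpha>" by (rule darboux[OF x(2)])
    have "u \<in> cspan (range (T \<alpha>))" if "u \<in> lagr \<alpha>" for u
      by (subst B.t_basis[OF that]) (intro complex_vector.span_sum complex_vector.span_scale
          complex_vector.span_base rangeI)
    then have "wedge ts = 0"
      using x(4,5) card_image_le[of UNIV "T \<alpha>"] by (intro wedge_eq_0_of_card[of "range (T \<alpha>)"]) auto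
    then show ?thesis
      unfolding x(1) pure_summand using clinear_0[OF clinear_summand_ext] by metis
  qed
  then have "gens (Suc CARD('n)) UNIV \<subseteq> {0}" by blast
  then have "chains \<C> V (Suc CARD('n)) \<subseteq> {0}"
    unfolding chains_eq_span by (intro complex_vector.span_minimal) simp_all
  then show ?thesis using complex_vector.subspace_0[OF csubspace_chains] by blast
qed

end

context quiver_complex
begin

section \<open>The augmentation\<close>

lemma D_weyl_act: "D (weyl_act P x) = weyl_act P (D x)"
  by (simp add: differential_def d1_weyl_act d0_weyl_act[OF arr qui fram] clinear_diff[OF clinear_weyl_act])

lemma weyl_act_chains: "x \<in> chains \<C> V r \<Longrightarrow> weyl_act P x \<in> chains \<C> V r"
  unfolding chains_eq_span
proof (rule cspan_image_induct[OF clinear_weyl_act complex_vector.subspace_span])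
  fix x assume "x \<in> gens r UNIV"
  then obtain \<alpha> Q ts \<omega> v where x: "x = pure \<alpha> Q ts \<omega> v" "\<alpha> \<in> flats \<C>" "Q \<in> UNIV" "length ts = r"
    "set ts \<subseteq> lagr \<alpha>" "\<omega> \<in> top_forms \<alpha>" "v \<in> V \<alpha>" by (rule gensE)
  show "weyl_act P x \<in> cspan (gens r UNIV)"
    unfolding x(1) weyl_act_pure by (rule pure_in_span) (use x in auto)
qed

lemma D_pure_1:
  assumes "\<alpha> \<in> flats \<C>" "\<omega> \<in> top_forms \<alpha>" "v \<in> V \<alpha>"
  shows "D (pure \<alpha> P [t] \<omega> v) = pure \<alpha> (P * weyl_embed t) [] \<omega> v -
    (\<Sum>\<beta> | \<beta> \<in> flats \<C> \<and> adjacent \<beta> \<alpha>. edge \<beta> \<alpha> t *\<^sub>C pure \<beta> P [] (fmap \<beta> \<alpha> \<omega>) (A \<beta> \<alpha> v))"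
  by (simp add: differential_def d1_pure_alt D0_pure[OF assms] alt_sum_Cons)

text \<open>The defining relations of the quiver module are the differentials of generators of
  degree one with coefficient \<open>1\<close>: the edge functional of a pure vector vanishes on
  upward edges, that of a pure function on downward edges.\<close>

lemma
  assumes g: "\<alpha> \<in> flats \<C>" "\<omega> \<in> top_forms \<alpha>" "v \<in> V \<alpha>"
  shows D_pure_deriv: "D (pure \<alpha> 1 [(\<xi>, 0)] \<omega> v) = pure \<alpha> (weyl_deriv \<xi>) [] \<omega> v -
      (\<Sum>\<beta> | \<beta> \<in> flats \<C> \<and> \<alpha> \<succ> \<beta>. pairing \<xi> (fr \<beta> \<alpha>) *\<^sub>C pure \<beta> 1 [] (fmap \<beta> \<alpha> \<omega>) (A \<beta> \<alpha> v))"
    and D_pure_mult: "D (pure \<alpha> 1 [(0, f)] \<omega> v) = pure \<alpha> (weyl_mult f) [] \<omega> v -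
      (\<Sum>\<beta> | \<beta> \<in> flats \<C> \<and> \<beta> \<succ> \<alpha>. pairing (xi \<beta> \<alpha>) f *\<^sub>C pure \<beta> 1 [] (fmap \<beta> \<alpha> \<omega>) (A \<beta> \<alpha> v))"
proof -
  have e: "weyl_embed (\<xi>, 0) = weyl_deriv \<xi>" "weyl_embed (0, f) = weyl_mult f"
    using weyl_mult_linear(2)[of 0 "0 :: 'n polyfn"] weyl_deriv_linear(2)[of 0 "0 :: complex ^ 'n"]
    by (simp_all add: weyl_embed_def)
  have z: "pairing \<zeta> 0 = 0" "pairing 0 g = 0" for \<zeta> and g :: "'n polyfn"
    using clinear_0[OF clinear_pairing(2)] clinear_0[OF clinear_pairing(1)] by auto
  have 1: "(\<Sum>\<beta> | \<beta> \<in> flats \<C> \<and> adjacent \<beta> \<alpha>. edge \<beta> \<alpha> (\<xi>, 0) *\<^sub>C pure \<beta> 1 [] (fmap \<beta> \<alpha> \<omega>) (A \<beta> \<alpha> v)) =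
      (\<Sum>\<beta> | \<beta> \<in> flats \<C> \<and> \<alpha> \<succ> \<beta>. pairing \<xi> (fr \<beta> \<alpha>) *\<^sub>C pure \<beta> 1 [] (fmap \<beta> \<alpha> \<omega>) (A \<beta> \<alpha> v))"
    by (rule sum.mono_neutral_cong_right) (auto simp: finite_flats[OF arr] edge_fun_def z adjacent_def)
  have 2: "(\<Sum>\<beta> | \<beta> \<in> flats \<C> \<and> adjacent \<beta> \<alpha>. edge \<beta> \<alpha> (0, f) *\<^sub>C pure \<beta> 1 [] (fmap \<beta> \<alpha> \<omega>) (A \<beta> \<alpha> v)) =
      (\<Sum>\<beta> | \<beta> \<in> flats \<C> \<and> \<beta> \<succ> \<alpha>. pairing (xi \<beta> \<alpha>) f *\<^sub>C pure \<beta> 1 [] (fmap \<beta> \<alpha> \<omega>) (A \<beta> \<alpha> v))"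
    by (rule sum.mono_neutral_cong_right)
      (auto simp: finite_flats[OF arr] edge_fun_def z adjacent_def dest: not_covers_sym)
  show "D (pure \<alpha> 1 [(\<xi>, 0)] \<omega> v) = pure \<alpha> (weyl_deriv \<xi>) [] \<omega> v -
      (\<Sum>\<beta> | \<beta> \<in> flats \<C> \<and> \<alpha> \<succ> \<beta>. pairing \<xi> (fr \<beta> \<alpha>) *\<^sub>C pure \<beta> 1 [] (fmap \<beta> \<alpha> \<omega>) (A \<beta> \<alpha> v))"
    unfolding D_pure_1[OF g] 1 by (simp add: e)
  show "D (pure \<alpha> 1 [(0, f)] \<omega> v) = pure \<alpha> (weyl_mult f) [] \<omega> v -
      (\<Sum>\<beta> | \<beta> \<in> flats \<C> \<and> \<beta> \<succ> \<alpha>. pairing (xi \<beta> \<alpha>) f *\<^sub>C pure \<beta> 1 [] (fmap \<beta> \<alpha> \<omega>) (A \<beta> \<alpha> v))"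
    unfolding D_pure_1[OF g] 2 by (simp add: e)
qed

text \<open>The image is a submodule because \<open>D\<close> commutes with \<open>weyl_act\<close>.
  Conversely every generator of degree one splits into its vector part and its function part, and
  each part is a multiple of one whose differential is a relation.\<close>

lemma relations_hull: "weyl_submodule hull relations \<C> V A fr xi = D ` chains \<C> V 1"
proof (rule hull_unique)
  have 1: "csubspace (chains \<C> V 1)" by (rule csubspace_chains)
  have zv: "0 \<in> vanishing \<C> \<alpha>" for \<alpha> by (rule complex_vector.subspace_0[OF csubspace_vanishing])
  have zt: "0 \<in> tangent \<alpha>" if "\<alpha> \<in> flats \<C>" for \<alpha>
    by (rule complex_vector.subspace_0[OF csubspace_tangent[OF arr that]])
  show "relations \<C> V A fr xi \<subseteq> D ` chains \<C> V 1"
    unfolding relations_def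
  proof (rule Un_least; rule subsetI; elim CollectE exE conjE)
    fix x \<alpha> \<xi> \<omega> v
    assume x: "x = pure \<alpha> (weyl_deriv \<xi>) [] \<omega> v -
        (\<Sum>\<beta> | \<beta> \<in> flats \<C> \<and> \<alpha> \<succ> \<beta>. pairing \<xi> (fr \<beta> \<alpha>) *\<^sub>C pure \<beta> 1 [] (fmap \<beta> \<alpha> \<omega>) (A \<beta> \<alpha> v))"
      and g: "\<alpha> \<in> flats \<C>" "\<xi> \<in> tangent \<alpha>" "\<omega> \<in> top_forms \<alpha>" "v \<in> V \<alpha>"
    have "pure \<alpha> 1 [(\<xi>, 0)] \<omega> v \<in> chains \<C> V 1"
      unfolding chains_eq_span by (rule pure_in_span) (use g zv in \<open>auto simp: lagrangian_def\<close>)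
    then show "x \<in> D ` chains \<C> V 1"
      unfolding x D_pure_deriv[OF g(1,3,4), symmetric] by (rule imageI)
  next
    fix x \<alpha> f \<omega> v
    assume x: "x = pure \<alpha> (weyl_mult f) [] \<omega> v -
        (\<Sum>\<beta> | \<beta> \<in> flats \<C> \<and> \<beta> \<succ> \<alpha>. pairing (xi \<beta> \<alpha>) f *\<^sub>C pure \<beta> 1 [] (fmap \<beta> \<alpha> \<omega>) (A \<beta> \<alpha> v))"
      and g: "\<alpha> \<in> flats \<C>" "f \<in> vanishing \<C> \<alpha>" "\<omega> \<in> top_forms \<alpha>" "v \<in> V \<alpha>"
    have "pure \<alpha> 1 [(0, f)] \<omega> v \<in> chains \<C> V 1"
      unfolding chains_eq_span by (rule pure_in_span) (use g zt in \<open>auto simp: lagrangian_def\<close>)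
    then show "x \<in> D ` chains \<C> V 1"
      unfolding x D_pure_mult[OF g(1,3,4), symmetric] by (rule imageI)
  qed
  have "x + y \<in> D ` chains \<C> V 1" if "x \<in> D ` chains \<C> V 1" "y \<in> D ` chains \<C> V 1" for x y
    using that complex_vector.subspace_add[OF 1] clinear_add[OF clinear_D, symmetric] by (auto intro!: imageI)
  moreover have "weyl_act P x \<in> D ` chains \<C> V 1" if "x \<in> D ` chains \<C> V 1" for P x
    using that weyl_act_chains D_weyl_act[symmetric] by (auto intro!: imageI)
  moreover have "0 \<in> D ` chains \<C> V 1"
    using complex_vector.subspace_0[OF 1] clinear_0[OF clinear_D] by (metis imageI)
  ultimately show "weyl_submodule (D ` chains \<C> V 1)" unfolding weyl_submodule_def by blast
  fix M :: "('n, 'v) chain set"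
  assume M: "relations \<C> V A fr xi \<subseteq> M" "weyl_submodule M"
  have Mcl: "0 \<in> M" "\<And>x y. x \<in> M \<Longrightarrow> y \<in> M \<Longrightarrow> x + y \<in> M" "\<And>P x. x \<in> M \<Longrightarrow> weyl_act P x \<in> M"
    using M(2) unfolding weyl_submodule_def by blast+
  have "D x \<in> M" if "x \<in> cspan (gens 1 UNIV)" for x
    using that
  proof (induction rule: complex_vector.span_induct_alt)
    case base
    show ?case using Mcl(1) by (simp only: clinear_0[OF clinear_D])
  next
    case (step c x y)
    obtain \<alpha> P ts \<omega> v where x: "x = pure \<alpha> P ts \<omega> v" "\<alpha> \<in> flats \<C>" "P \<in> UNIV" "length ts = 1"
      "set ts \<subseteq> lagr \<alpha>" "\<omega> \<in> top_forms \<alpha>" "v \<in> V \<alpha>" using step(1) by (rule gensE)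
    obtain \<xi> f where ts: "ts = [(\<xi>, f)]" using x(4) by (cases ts) auto
    then have \<xi>f: "\<xi> \<in> tangent \<alpha>" "f \<in> vanishing \<C> \<alpha>" using x(5) by (auto simp: lagrangian_def)
    have "D (pure \<alpha> 1 [(\<xi>, 0)] \<omega> v) \<in> M"
      unfolding D_pure_deriv[OF x(2,6,7)]
      by (rule subsetD[OF M(1)], unfold relations_def, rule UnI1, rule CollectI, rule exI[of _ \<alpha>],
          rule exI[of _ "\<xi>"], rule exI[of _ \<omega>], rule exI[of _ v]) (intro conjI refl x \<xi>f)
    moreover have "D (pure \<alpha> 1 [(0, f)] \<omega> v) \<in> M"
      unfolding D_pure_mult[OF x(2,6,7)]
      by (rule subsetD[OF M(1)], unfold relations_def, rule UnI2, rule CollectI, rule exI[of _ \<alpha>],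
          rule exI[of _ "f"], rule exI[of _ \<omega>], rule exI[of _ v]) (intro conjI refl x \<xi>f)
    \<comment> \<open>The scalar is absorbed into the operator, since \<open>weyl_submodule\<close>
      provides closure under \<open>weyl_act\<close>.\<close>
    moreover have "c *\<^sub>C x = weyl_act (c *\<^sub>C P) (pure \<alpha> 1 [(\<xi>, 0)] \<omega> v + pure \<alpha> 1 [(0, f)] \<omega> v)"
    proof -
      have "pure \<alpha> (c *\<^sub>C P) [(\<xi>, 0) + (0, f)] \<omega> v =
          pure \<alpha> (c *\<^sub>C P) [(\<xi>, 0)] \<omega> v + pure \<alpha> (c *\<^sub>C P) [(0, f)] \<omega> v"
        by (rule clinear_add[OF clinear_pure_Cons])
      then show ?thesis
        by (simp add: x(1) ts clinear_add[OF clinear_weyl_act] weyl_act_pure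
            flip: clinear_scale[OF clinear_pure_op])
    qed
    ultimately have "D (c *\<^sub>C x) \<in> M" by (simp add: D_weyl_act clinear_add[OF clinear_D] Mcl)
    then show ?case unfolding clinear_add[OF clinear_D] using step(2) by (rule Mcl(2))
  qed
  then show "D ` chains \<C> V 1 \<subseteq> M" unfolding chains_eq_span by blast
qed

text \<open>By \<open>relations_hull\<close> the classes are the cosets of \<open>?K\<close>; that
  \<open>?K\<close> is a subspace also provides the subtraction needed to compare them.\<close>

lemma E_class_eq_0:
  "{x \<in> chains \<C> V 0. E_class \<C> V A fr xi x = E_class \<C> V A fr xi 0} = D ` chains \<C> V 1"
proof -
  let ?K = "D ` chains \<C> V 1"
  have K: "csubspace ?K"
  proof (rule complex_vector.subspaceI)
    show "0 \<in> ?K" using complex_vector.subspace_0[OF csubspace_chains] clinear_0[OF clinear_D] by (metis imageI)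
    show "x + y \<in> ?K" if "x \<in> ?K" "y \<in> ?K" for x y
      using that complex_vector.subspace_add[OF csubspace_chains] clinear_add[OF clinear_D, symmetric]
      by (auto intro!: imageI)
    show "c *\<^sub>C x \<in> ?K" if "x \<in> ?K" for c x
      using that complex_vector.subspace_scale[OF csubspace_chains] clinear_scale[OF clinear_D, symmetric]
      by (auto intro!: imageI)
  qed
  have "E_class \<C> V A fr xi x = E_class \<C> V A fr xi 0 \<longleftrightarrow> x \<in> ?K" for x
  proof
    assume "E_class \<C> V A fr xi x = E_class \<C> V A fr xi 0"
    moreover have "x \<in> E_class \<C> V A fr xi x"
      using complex_vector.subspace_0[OF K] by (simp add: E_class_def relations_hull)
    ultimately show "x \<in> ?K" by (simp add: E_class_def relations_hull)
  next
    assume x: "x \<in> ?K"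
    have "y - x \<in> ?K \<longleftrightarrow> y \<in> ?K" for y
      using complex_vector.subspace_add[OF K _ x, of "y - x"] complex_vector.subspace_diff[OF K _ x, of y] by auto
    then show "E_class \<C> V A fr xi x = E_class \<C> V A fr xi 0" by (simp add: E_class_def relations_hull)
  qed
  moreover have "?K \<subseteq> chains \<C> V 0" using D_chains[of _ 0] by auto
  ultimately show ?thesis by blast
qed

end

theorem theorem4p13:
  fixes \<C> :: "(complex ^ 'n) set set"
    and V :: "(complex ^ 'n) set \<Rightarrow> 'v::complex_vector set"
    and A :: "(complex ^ 'n) set \<Rightarrow> (complex ^ 'n) set \<Rightarrow> 'v \<Rightarrow> 'v"
    and fr :: "(complex ^ 'n) set \<Rightarrow> (complex ^ 'n) set \<Rightarrow> 'n polyfn"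
    and xi :: "(complex ^ 'n) set \<Rightarrow> (complex ^ 'n) set \<Rightarrow> complex ^ 'n"
  assumes "arrangement \<C>"
    and "quiver \<C> V A"
    and "edge_framing \<C> fr xi"
  shows
    "{x \<in> chains \<C> V CARD('n). differential \<C> V A fr xi x = 0} = {0} \<and>
     (\<forall>r. 0 < r \<and> r < CARD('n) \<longrightarrow>
       {x \<in> chains \<C> V r. differential \<C> V A fr xi x = 0}
         = differential \<C> V A fr xi ` chains \<C> V (r + 1)) \<and>
     {x \<in> chains \<C> V 0. E_class \<C> V A fr xi x = E_class \<C> V A fr xi 0}
       = differential \<C> V A fr xi ` chains \<C> V 1 \<and>
     E_class \<C> V A fr xi ` chains \<C> V 0 = E_module \<C> V A fr xi"
proof -
  interpret Q: quiver_complex \<C> V A fr xi by unfold_locales (rule assms)+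
  have "\<forall>\<alpha>\<in>flats \<C>. \<exists>ts. darboux_basis (lagrangian \<C> \<alpha>) (fst ts) (snd ts)"
    using Q.ex_darboux_basis by (metis fst_conv snd_conv)
  then obtain F where F: "\<And>\<alpha>. \<alpha> \<in> flats \<C> \<Longrightarrow> darboux_basis (lagrangian \<C> \<alpha>) (fst (F \<alpha>)) (snd (F \<alpha>))"
    by metis
  \<comment> \<open>The homotopy depends on a Darboux basis at every flat; any choice
    serves.\<close>
  interpret quiver_homotopy \<C> V A fr xi "\<lambda>\<alpha>. fst (F \<alpha>)" "\<lambda>\<alpha>. snd (F \<alpha>)"
    by (intro quiver_homotopy.intro quiver_homotopy_axioms.intro Q.quiver_complex_axioms F)
  let ?D = "differential \<C> V A fr xi"
  have ex: "{x \<in> chains \<C> V r. ?D x = 0} = ?D ` chains \<C> V (Suc r)" if "0 < r" for r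
    using exact[of "r - 1"] that by simp
  \<comment> \<open>In top degree the boundaries come from the zero space of chains one degree
    higher.\<close>
  have "{x \<in> chains \<C> V CARD('n). ?D x = 0} = {0}"
    using ex[of "CARD('n)"] clinear_0[OF Q.clinear_D] by (simp add: chains_above_dimension)
  \<comment> \<open>Surjectivity of the augmentation holds by the definition of
    \<open>E_module\<close>.\<close>
  then show ?thesis
    using ex Q.E_class_eq_0 by (simp add: E_module_def)
qed

end
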